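(* Let $A, B$ be $C^*$-algebras, let $X$ be a (right) Hilbert $C^*$-module over $A$, and assume that $B$ acts on $X$ from the left via adjointable operators. Then $B$ acts nondegenerately on $X$ (i.e. $[BX] = X$) if and only if for every representation $\sigma: A \rightarrow B(\mathcal{H})$ of $A$ on a Hilbert space $\mathcal{H}$, the $C^*$-algebra $B$ acts $\sigma$-nondegenerately on $X$, i.e., $BX \otimes_{\sigma} \mathcal{H} = X \otimes_{\sigma} \mathcal{H}$.
   Context: A Hilbert $A$-module $X$ is a linear space that is a right $A$-module with an $A$-valued inner product $\langle \cdot, \cdot\rangle : X \times X \to A$, linear in the second variable, which is complete in the norm $\|\xi\| = \|\langle \xi, \xi\rangle\|^{1/2}$. $L(X)$ denotes the $C^*$-algebra of adjointable maps on $X$, i.e. maps $s: X \to X$ for which there is a map $s^*: X \to X$ with $\langle s\xi, \eta\rangle = \langle \xi, s^*\eta\rangle$ for all $\xi, \eta \in X$. That $B$ acts on $X$ from the left via adjointable operators means that a $*$-homomorphism $\phi: B \to L(X)$ is given; one writes $b\xi$ for $\phi(b)\xi$. The notation $[\,\cdot\,]$ denotes closed linear span, and $[BX]$ is the closed linear span of $\{b\xi : b \in B, \xi \in X\}$. The action of $B$ on $X$ is nondegenerate if $[BX] = X$. A representation $\sigma : A \to B(\mathcal{H})$ is a $*$-homomorphism into the bounded operators on a Hilbert space $\mathcal{H}$ (not assumed nondegenerate). $X \otimes_\sigma \mathcal{H}$ denotes the Hilbert space obtained by completing the quotient of the algebraic tensor product $X \otimes_{\mathrm{alg}} \mathcal{H}$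 by the subspace generated by the elements $\xi a \otimes h - \xi \otimes \sigma(a)h$ ($\xi \in X$, $a \in A$, $h \in \mathcal{H}$), with respect to the inner product determined by $\langle \xi_1 \otimes h_1, \xi_2 \otimes h_2\rangle := \langle h_1, \sigma(\langle \xi_1, \xi_2\rangle) h_2\rangle$ (inner products being linear in the second variable). $BX \otimes_\sigma \mathcal{H}$ denotes the closed subspace of $X \otimes_\sigma \mathcal{H}$ generated by the elements $b\xi \otimes h$ with $b \in B$, $\xi \in X$, $h \in \mathcal{H}$. *)

theory Defs
  imports "HOL-Analysis.Analysis" "HOL-Library.Poly_Mapping"
begin

section \<open>Complex Banach spaces and C*-algebras as type classes\<close>

class complex_vector = real_vector +
  fixes scaleC :: "complex \<Rightarrow> 'a \<Rightarrow> 'a"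
  assumes scaleC_add_right: "scaleC c (x + y) = scaleC c x + scaleC c y"
    and scaleC_add_left: "scaleC (c + d) x = scaleC c x + scaleC d x"
    and scaleC_scaleC: "scaleC c (scaleC d x) = scaleC (c * d) x"
    and scaleC_one: "scaleC 1 x = x"
    and scaleR_scaleC: "scaleR r x = scaleC (complex_of_real r) x"

global_interpretation complex_vector: vector_space "scaleC :: complex \<Rightarrow> 'a \<Rightarrow> 'a::complex_vector"
  by unfold_locales (rule scaleC_add_right scaleC_add_left scaleC_scaleC scaleC_one)+

class complex_banach = complex_vector + banach +
  assumes norm_scaleC: "norm (scaleC c x) = cmod c * norm x"

text \<open>Neither commutativity nor a unit is required, and the zero algebra is allowed.\<close>

class cstar_algebra = complex_banach + real_normed_algebra +
  fixes star :: "'a \<Rightarrow> 'a"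
  assumes mult_scaleC_left: "scaleC c x * y = scaleC c (x * y)"
    and mult_scaleC_right: "x * scaleC c y = scaleC c (x * y)"
    and star_star: "star (star x) = x"
    and star_add: "star (x + y) = star x + star y"
    and star_scaleC: "star (scaleC c x) = scaleC (cnj c) (star x)"
    and star_mult: "star (x * y) = star y * star x"
    and cstar_identity: "norm (star x * x) = (norm x)\<^sup>2"

definition cstar_positive :: "'a::cstar_algebra \<Rightarrow> bool" where
  "cstar_positive a \<longleftrightarrow> (\<exists>b. a = star b * b)"


section \<open>Hilbert C*-modules\<close>

text \<open>
  The norm of the type \<open>'x\<close> is required to be the one induced by the \<open>'a\<close>-valued inner
  product \<open>ip\<close>; completeness of that norm is part of the class \<^class>\<open>complex_banach\<close>.
\<close>

locale hilbert_module =
  fixes ip :: "'x::complex_banach \<Rightarrow> 'x \<Rightarrow> 'a::cstar_algebra"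
    and act :: "'x \<Rightarrow> 'a \<Rightarrow> 'x"
  assumes act_add_left: "act (x + y) a = act x a + act y a"
    and act_add_right: "act x (a + b) = act x a + act x b"
    and act_mult: "act x (a * b) = act (act x a) b"
    and act_scaleC_left: "act (scaleC c x) a = scaleC c (act x a)"
    and act_scaleC_right: "act x (scaleC c a) = scaleC c (act x a)"
    and ip_add_right: "ip x (y + z) = ip x y + ip x z"
    and ip_scaleC_right: "ip x (scaleC c y) = scaleC c (ip x y)"
    and ip_act_right: "ip x (act y a) = ip x y * a"
    and ip_star: "star (ip x y) = ip y x"
    and ip_positive: "cstar_positive (ip x x)"
    and ip_definite: "ip x x = 0 \<Longrightarrow> x = 0"
    and norm_eq: "norm x = sqrt (norm (ip x x))"

definition is_adjoint :: "('x \<Rightarrow> 'x \<Rightarrow> 'a) \<Rightarrow> ('x \<Rightarrow> 'x) \<Rightarrow> ('x \<Rightarrow> 'x) \<Rightarrow> bool" where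
  "is_adjoint ip s t \<longleftrightarrow> (\<forall>x y. ip (s x) y = ip x (t y))"

definition adjointable_maps :: "('x \<Rightarrow> 'x \<Rightarrow> 'a) \<Rightarrow> ('x \<Rightarrow> 'x) set" where
  "adjointable_maps ip = {s. \<exists>t. is_adjoint ip s t}"

definition adjoint_of :: "('x \<Rightarrow> 'x \<Rightarrow> 'a) \<Rightarrow> ('x \<Rightarrow> 'x) \<Rightarrow> ('x \<Rightarrow> 'x)" where
  "adjoint_of ip s = (THE t. is_adjoint ip s t)"

lemma (in hilbert_module) adjoint_of_eq:
  assumes "is_adjoint ip s t"
  shows "adjoint_of ip s = t"
  unfolding adjoint_of_def
proof (rule the_equality)
  show "is_adjoint ip s t" by (rule assms)
next
  fix t' assume t': "is_adjoint ip s t'"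
  show "t' = t"
  proof
    fix y
    have eq: "ip x (t' y) = ip x (t y)" for x
      using assms t' unfolding is_adjoint_def by metis
    have "ip x (t' y - t y) + ip x (t y) = ip x (t' y)" for x
      by (simp flip: ip_add_right)
    then have "ip (t' y - t y) (t' y - t y) = 0"
      by (metis add_cancel_left_left eq)
    then show "t' y = t y" using ip_definite by force
  qed
qed

text \<open>A *-homomorphism from \<open>B\<close> into the C*-algebra of adjointable maps.\<close>

definition star_hom_into_adjointable ::
    "('x::complex_banach \<Rightarrow> 'x \<Rightarrow> 'a::cstar_algebra) \<Rightarrow> ('b::cstar_algebra \<Rightarrow> 'x \<Rightarrow> 'x) \<Rightarrow> bool" where
  "star_hom_into_adjointable ip \<phi> \<longleftrightarrow>
     (\<forall>b. \<phi> b \<in> adjointable_maps ip) \<and>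
     (\<forall>b c. \<phi> (b + c) = (\<lambda>x. \<phi> b x + \<phi> c x)) \<and>
     (\<forall>z b. \<phi> (scaleC z b) = (\<lambda>x. scaleC z (\<phi> b x))) \<and>
     (\<forall>b c. \<phi> (b * c) = \<phi> b \<circ> \<phi> c) \<and>
     (\<forall>b. \<phi> (star b) = adjoint_of ip (\<phi> b))"

definition acts_nondegenerately :: "('b \<Rightarrow> 'x::complex_banach \<Rightarrow> 'x) \<Rightarrow> bool" where
  "acts_nondegenerately \<phi> \<longleftrightarrow> closure (complex_vector.span {\<phi> b x | b x. True}) = UNIV"


section \<open>Hilbert spaces with explicit carriers\<close>

text \<open>
  Hilbert spaces are bound variables of the statement, hence they cannot be types. They are
  given by a carrier set inside a type together with the operations, which are relevant on
  the carrier only. The type \<open>'a \<Rightarrow> complex\<close> is large enough to carry every cyclic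
  representation of \<open>'a\<close>: with cyclic vector \<open>w\<close>, identify a vector \<open>v\<close> with the function
  \<open>a \<mapsto> \<langle>\<sigma> a w, v\<rangle>\<close>.
\<close>

record 'h ip_space =
  hcarrier :: "'h set"
  hplus :: "'h \<Rightarrow> 'h \<Rightarrow> 'h"
  hzero :: "'h"
  hscale :: "complex \<Rightarrow> 'h \<Rightarrow> 'h"
  hinner :: "'h \<Rightarrow> 'h \<Rightarrow> complex"

definition hdist :: "'h ip_space \<Rightarrow> 'h \<Rightarrow> 'h \<Rightarrow> real" where
  "hdist H u v = (let d = hplus H u (hscale H (- 1) v) in sqrt (Re (hinner H d d)))"

definition hcauchy :: "'h ip_space \<Rightarrow> (nat \<Rightarrow> 'h) \<Rightarrow> bool" where
  "hcauchy H s \<longleftrightarrow> (\<forall>n. s n \<in> hcarrier H) \<and>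
     (\<forall>e>0. \<exists>N. \<forall>m\<ge>N. \<forall>n\<ge>N. hdist H (s m) (s n) < e)"

definition hconverges :: "'h ip_space \<Rightarrow> (nat \<Rightarrow> 'h) \<Rightarrow> 'h \<Rightarrow> bool" where
  "hconverges H s v \<longleftrightarrow> (\<lambda>n. hdist H (s n) v) \<longlonglongrightarrow> 0"

locale hilbert_space =
  fixes H :: "'h ip_space"
  assumes hplus_closed: "\<lbrakk>u \<in> hcarrier H; v \<in> hcarrier H\<rbrakk> \<Longrightarrow> hplus H u v \<in> hcarrier H"
    and hzero_closed: "hzero H \<in> hcarrier H"
    and hscale_closed: "u \<in> hcarrier H \<Longrightarrow> hscale H c u \<in> hcarrier H"
    and hplus_assoc: "\<lbrakk>u \<in> hcarrier H; v \<in> hcarrier H; w \<in> hcarrier H\<rbrakk>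
          \<Longrightarrow> hplus H (hplus H u v) w = hplus H u (hplus H v w)"
    and hplus_commute: "\<lbrakk>u \<in> hcarrier H; v \<in> hcarrier H\<rbrakk> \<Longrightarrow> hplus H u v = hplus H v u"
    and hplus_zero: "u \<in> hcarrier H \<Longrightarrow> hplus H (hzero H) u = u"
    and hplus_minus: "u \<in> hcarrier H \<Longrightarrow> hplus H u (hscale H (- 1) u) = hzero H"
    and hscale_plus: "\<lbrakk>u \<in> hcarrier H; v \<in> hcarrier H\<rbrakk>
          \<Longrightarrow> hscale H c (hplus H u v) = hplus H (hscale H c u) (hscale H c v)"
    and hscale_add: "u \<in> hcarrier H \<Longrightarrow> hscale H (c + d) u = hplus H (hscale H c u) (hscale H d u)"
    and hscale_hscale: "u \<in> hcarrier H \<Longrightarrow> hscale H c (hscale H d u) = hscale H (c * d) u"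
    and hscale_one: "u \<in> hcarrier H \<Longrightarrow> hscale H 1 u = u"
    and hinner_plus: "\<lbrakk>u \<in> hcarrier H; v \<in> hcarrier H; w \<in> hcarrier H\<rbrakk>
          \<Longrightarrow> hinner H u (hplus H v w) = hinner H u v + hinner H u w"
    and hinner_scale: "\<lbrakk>u \<in> hcarrier H; v \<in> hcarrier H\<rbrakk>
          \<Longrightarrow> hinner H u (hscale H c v) = c * hinner H u v"
    and hinner_cnj: "\<lbrakk>u \<in> hcarrier H; v \<in> hcarrier H\<rbrakk> \<Longrightarrow> hinner H v u = cnj (hinner H u v)"
    and hinner_nonneg: "u \<in> hcarrier H \<Longrightarrow> Re (hinner H u u) \<ge> 0"
    and hinner_definite: "\<lbrakk>u \<in> hcarrier H; hinner H u u = 0\<rbrakk> \<Longrightarrow> u = hzero H"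
    and hcomplete: "hcauchy H s \<Longrightarrow> \<exists>v\<in>hcarrier H. hconverges H s v"

definition bounded_operator :: "'h ip_space \<Rightarrow> ('h \<Rightarrow> 'h) \<Rightarrow> bool" where
  "bounded_operator H T \<longleftrightarrow>
     (\<forall>u\<in>hcarrier H. T u \<in> hcarrier H) \<and>
     (\<forall>u\<in>hcarrier H. \<forall>v\<in>hcarrier H. T (hplus H u v) = hplus H (T u) (T v)) \<and>
     (\<forall>c. \<forall>u\<in>hcarrier H. T (hscale H c u) = hscale H c (T u)) \<and>
     (\<exists>K. \<forall>u\<in>hcarrier H. hdist H (T u) (hzero H) \<le> K * hdist H u (hzero H))"

text \<open>
  A *-homomorphism from \<open>A\<close> into the bounded operators on \<open>H\<close>; the last clause says
  that the Hilbert space adjoint of \<open>\<sigma> a\<close> is \<open>\<sigma> (star a)\<close>.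
\<close>

definition cstar_representation :: "'h ip_space \<Rightarrow> ('a::cstar_algebra \<Rightarrow> 'h \<Rightarrow> 'h) \<Rightarrow> bool" where
  "cstar_representation H \<sigma> \<longleftrightarrow>
     (\<forall>a. bounded_operator H (\<sigma> a)) \<and>
     (\<forall>a b. \<forall>u\<in>hcarrier H. \<sigma> (a + b) u = hplus H (\<sigma> a u) (\<sigma> b u)) \<and>
     (\<forall>c a. \<forall>u\<in>hcarrier H. \<sigma> (scaleC c a) u = hscale H c (\<sigma> a u)) \<and>
     (\<forall>a b. \<forall>u\<in>hcarrier H. \<sigma> (a * b) u = \<sigma> a (\<sigma> b u)) \<and>
     (\<forall>a. \<forall>u\<in>hcarrier H. \<forall>v\<in>hcarrier H. hinner H (\<sigma> a u) v = hinner H u (\<sigma> (star a) v))"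

definition closed_subspace :: "'h ip_space \<Rightarrow> 'h set \<Rightarrow> bool" where
  "closed_subspace H M \<longleftrightarrow>
     M \<subseteq> hcarrier H \<and> hzero H \<in> M \<and>
     (\<forall>u\<in>M. \<forall>v\<in>M. hplus H u v \<in> M) \<and>
     (\<forall>c. \<forall>u\<in>M. hscale H c u \<in> M) \<and>
     (\<forall>s v. (\<forall>n. s n \<in> M) \<and> v \<in> hcarrier H \<and> hconverges H s v \<longrightarrow> v \<in> M)"

definition closed_subspace_generated :: "'h ip_space \<Rightarrow> 'h set \<Rightarrow> 'h set" where
  "closed_subspace_generated H S = \<Inter> {M. closed_subspace H M \<and> S \<subseteq> M}"


section \<open>Completion of a space with an inner product\<close>

text \<open>
  Points of the completion are classes of Cauchy sequences modulo sequences whose distance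
  tends to zero. Operations on classes are computed on representatives.
\<close>

definition rep :: "'a set \<Rightarrow> 'a" where
  "rep C = (SOME x. x \<in> C)"

definition completion_class :: "'v ip_space \<Rightarrow> (nat \<Rightarrow> 'v) \<Rightarrow> (nat \<Rightarrow> 'v) set" where
  "completion_class V s = {t. hcauchy V t \<and> (\<lambda>n. hdist V (s n) (t n)) \<longlonglongrightarrow> 0}"

definition completion :: "'v ip_space \<Rightarrow> (nat \<Rightarrow> 'v) set ip_space" where
  "completion V = \<lparr>
     hcarrier = {completion_class V s | s. hcauchy V s},
     hplus = (\<lambda>P Q. completion_class V (\<lambda>n. hplus V (rep P n) (rep Q n))),
     hzero = completion_class V (\<lambda>_. hzero V),
     hscale = (\<lambda>c P. completion_class V (\<lambda>n. hscale V c (rep P n))),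
     hinner = (\<lambda>P Q. lim (\<lambda>n. hinner V (rep P n) (rep Q n))) \<rparr>"


section \<open>The interior tensor product\<close>

text \<open>
  The complex vector space with basis \<open>'x \<times> 'h\<close>; the basis vectors stand for the
  symbols \<open>x \<otimes> h\<close>.
\<close>

definition fscale :: "complex \<Rightarrow> ('k \<Rightarrow>\<^sub>0 complex) \<Rightarrow> ('k \<Rightarrow>\<^sub>0 complex)" where
  "fscale c f = Poly_Mapping.map ((*) c) f"

lemma lookup_fscale: "Poly_Mapping.lookup (fscale c f) k = c * Poly_Mapping.lookup f k"
  unfolding fscale_def by (simp add: Poly_Mapping.map.rep_eq when_def)

global_interpretation free_space: vector_space "fscale :: complex \<Rightarrow> ('k \<Rightarrow>\<^sub>0 complex) \<Rightarrow> _"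
  by unfold_locales
    (auto intro!: poly_mapping_eqI simp: lookup_fscale lookup_add algebra_simps)

definition gen :: "'x \<Rightarrow> 'h \<Rightarrow> ('x \<times> 'h) \<Rightarrow>\<^sub>0 complex" where
  "gen x h = Poly_Mapping.single (x, h) 1"

text \<open>
  Dividing by the bilinearity relations gives the algebraic tensor product over the complex
  numbers; dividing further by the balancing relations gives the domain of the inner product.
\<close>

definition bilinear_relations ::
    "'h ip_space \<Rightarrow> (('x::complex_banach \<times> 'h) \<Rightarrow>\<^sub>0 complex) set" where
  "bilinear_relations H =
     {gen (x + y) h - gen x h - gen y h | x y h. h \<in> hcarrier H} \<union>
     {gen x (hplus H h k) - gen x h - gen x k | x h k. h \<in> hcarrier H \<and> k \<in> hcarrier H} \<union>
     {gen (scaleC c x) h - fscale c (gen x h) | c x h. h \<in> hcarrier H} \<union>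
     {gen x (hscale H c h) - fscale c (gen x h) | c x h. h \<in> hcarrier H}"

definition balancing_relations ::
    "('x \<Rightarrow> 'a \<Rightarrow> 'x) \<Rightarrow> 'h ip_space \<Rightarrow> ('a \<Rightarrow> 'h \<Rightarrow> 'h) \<Rightarrow> (('x \<times> 'h) \<Rightarrow>\<^sub>0 complex) set" where
  "balancing_relations act H \<sigma> =
     {gen (act x a) h - gen x (\<sigma> a h) | x a h. h \<in> hcarrier H}"

definition tensor_coset ::
    "('x::complex_banach \<Rightarrow> 'a \<Rightarrow> 'x) \<Rightarrow> 'h ip_space \<Rightarrow> ('a \<Rightarrow> 'h \<Rightarrow> 'h) \<Rightarrow>
     (('x \<times> 'h) \<Rightarrow>\<^sub>0 complex) \<Rightarrow> (('x \<times> 'h) \<Rightarrow>\<^sub>0 complex) set" where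
  "tensor_coset act H \<sigma> f =
     {g. g - f \<in> free_space.span (bilinear_relations H \<union> balancing_relations act H \<sigma>)}"

text \<open>
  The sesquilinear extension of
  \<open>\<langle>x\<^sub>1 \<otimes> h\<^sub>1, x\<^sub>2 \<otimes> h\<^sub>2\<rangle> = \<langle>h\<^sub>1, \<sigma> \<langle>x\<^sub>1, x\<^sub>2\<rangle> h\<^sub>2\<rangle>\<close>.
\<close>

definition tensor_form ::
    "('x \<Rightarrow> 'x \<Rightarrow> 'a) \<Rightarrow> 'h ip_space \<Rightarrow> ('a \<Rightarrow> 'h \<Rightarrow> 'h) \<Rightarrow>
     (('x \<times> 'h) \<Rightarrow>\<^sub>0 complex) \<Rightarrow> (('x \<times> 'h) \<Rightarrow>\<^sub>0 complex) \<Rightarrow> complex" where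
  "tensor_form ip H \<sigma> f g =
     (\<Sum>p\<in>Poly_Mapping.keys f. \<Sum>q\<in>Poly_Mapping.keys g.
        cnj (Poly_Mapping.lookup f p) * Poly_Mapping.lookup g q *
        hinner H (snd p) (\<sigma> (ip (fst p) (fst q)) (snd q)))"

text \<open>
  All relations involve only second components in the carrier of \<open>H\<close>, hence so do all
  elements of the cosets in the carrier below, in particular the chosen representatives.
\<close>

definition balanced_tensor ::
    "('x::complex_banach \<Rightarrow> 'x \<Rightarrow> 'a) \<Rightarrow> ('x \<Rightarrow> 'a \<Rightarrow> 'x) \<Rightarrow> 'h ip_space \<Rightarrow> ('a \<Rightarrow> 'h \<Rightarrow> 'h) \<Rightarrow>
     (('x \<times> 'h) \<Rightarrow>\<^sub>0 complex) set ip_space" where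
  "balanced_tensor ip act H \<sigma> = (let coset = tensor_coset act H \<sigma> in \<lparr>
     hcarrier = {coset f | f. Poly_Mapping.keys f \<subseteq> UNIV \<times> hcarrier H},
     hplus = (\<lambda>C D. coset (rep C + rep D)),
     hzero = coset 0,
     hscale = (\<lambda>c C. coset (fscale c (rep C))),
     hinner = (\<lambda>C D. tensor_form ip H \<sigma> (rep C) (rep D)) \<rparr>)"

definition interior_tensor ::
    "('x::complex_banach \<Rightarrow> 'x \<Rightarrow> 'a) \<Rightarrow> ('x \<Rightarrow> 'a \<Rightarrow> 'x) \<Rightarrow> 'h ip_space \<Rightarrow> ('a \<Rightarrow> 'h \<Rightarrow> 'h) \<Rightarrow>
     (nat \<Rightarrow> (('x \<times> 'h) \<Rightarrow>\<^sub>0 complex) set) set ip_space" where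
  "interior_tensor ip act H \<sigma> = completion (balanced_tensor ip act H \<sigma>)"

definition elementary_tensor ::
    "('x::complex_banach \<Rightarrow> 'x \<Rightarrow> 'a) \<Rightarrow> ('x \<Rightarrow> 'a \<Rightarrow> 'x) \<Rightarrow> 'h ip_space \<Rightarrow> ('a \<Rightarrow> 'h \<Rightarrow> 'h) \<Rightarrow>
     'x \<Rightarrow> 'h \<Rightarrow> (nat \<Rightarrow> (('x \<times> 'h) \<Rightarrow>\<^sub>0 complex) set) set" where
  "elementary_tensor ip act H \<sigma> x h =
     completion_class (balanced_tensor ip act H \<sigma>) (\<lambda>_. tensor_coset act H \<sigma> (gen x h))"

definition acts_sigma_nondegenerately ::
    "('x::complex_banach \<Rightarrow> 'x \<Rightarrow> 'a) \<Rightarrow> ('x \<Rightarrow> 'a \<Rightarrow> 'x) \<Rightarrow> ('b \<Rightarrow> 'x \<Rightarrow> 'x) \<Rightarrow>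
     'h ip_space \<Rightarrow> ('a \<Rightarrow> 'h \<Rightarrow> 'h) \<Rightarrow> bool" where
  "acts_sigma_nondegenerately ip act \<phi> H \<sigma> \<longleftrightarrow>
     closed_subspace_generated (interior_tensor ip act H \<sigma>)
       {elementary_tensor ip act H \<sigma> (\<phi> b x) h | b x h. h \<in> hcarrier H}
     = hcarrier (interior_tensor ip act H \<sigma>)"

end

theory Submission
  imports Defs
begin

text \<open>
  If \<open>[BX] = X\<close>, approximating \<open>x\<close> by elements of \<open>BX\<close> approximates \<open>x \<otimes> h\<close>, because
  \<open>\<parallel>x \<otimes> h\<parallel> \<le> \<parallel>x\<parallel> \<parallel>h\<parallel>\<close>.

  Conversely let \<open>Y = span BX\<close> and \<open>x \<notin> closure Y\<close>. Since \<open>x\<close> lies in the closure of \<open>xA\<close>, some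
  \<open>xm\<close> has distance \<open>d > 0\<close> from \<open>Y\<close>. The elements \<open>\<langle>xm - y, xm - y\<rangle>\<close> with \<open>y \<in> Y\<close> generate,
  together with the positive elements of \<open>A\<close>, a convex cone to which the Hahn-Banach theorem applies: there
  is a positive functional \<open>F\<close> with \<open>F \<langle>xm - y, xm - y\<rangle> \<ge> d\<^sup>2\<close> for all \<open>y \<in> Y\<close>. In
  the GNS representation of \<open>F\<close>, \<open>\<parallel>\<Sum> x\<^sub>i \<otimes> a\<^sub>i\<parallel>\<^sup>2 = F \<langle>z, z\<rangle>\<close> with
  \<open>z = \<Sum> x\<^sub>i a\<^sub>i\<close>, hence \<open>x \<otimes> m\<close> has distance at least \<open>d\<close> from \<open>BX \<otimes> H\<close>.

  That the norm is monotone on positive elements, and that all \<open>b\<^sup>* b\<close> form part of a convex cone, rests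
  on the theorem of Fukamachi and Kaplansky. It is proved in the multiplier algebra, without spectral theory: the only
  functional calculus is the square root, obtained from Banach's fixed point theorem.
\<close>

section \<open>Square roots and positivity in C*-algebras\<close>

text \<open>Only some \<open>b\<close> with \<open>a = star b * b\<close> comes with
  \<open>cstar_positive a\<close>, so sums of positive elements are not visibly positive. A cone
  closed under sums is needed for the separation, but also for
  \<open>(\<epsilon> + k)\<^sup>-\<^sup>1\<close> with \<open>k = ip x x\<close>: it gives the
  approximation of \<open>x\<close> by elements of \<open>xA\<close>, and it completes squares in
  the proof that the tensor form is positive at all.

  The passage from \<open>x\<close> to \<open>x m\<close> makes up for the missing unit: the GNS
  space has a vector \<open>e m\<close> for each \<open>m\<close>, but none that stands for
  \<open>1\<close>, and \<open>x \<otimes> e m\<close> is the tensor that corresponds to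
  \<open>x m\<close>.

  The lower bound for \<open>F\<close> must hold for all \<open>y\<close> simultaneously, so a
  functional adapted to a single element does not suffice. Pairs of an element and the value
  demanded there turn these requirements into a convex cone.

  The representation that refutes nondegeneracy must live on the one carrier type over which the
  statement quantifies; therefore the GNS space is transported into functions on
  \<open>A\<close>.\<close>

lemma scaleC_of_real: "scaleC (of_real r) x = r *\<^sub>R x"
  by (simp add: scaleR_scaleC)

lemma star_zero [simp]: "star (0::'a::cstar_algebra) = 0"
  using star_add[of 0 "0::'a"] by simp

lemma star_minus: "star (- x::'a::cstar_algebra) = - star x"
  using star_add[of x "- x"] by (simp add: eq_neg_iff_add_eq_0 add.commute)

lemma star_diff: "star (x - y::'a::cstar_algebra) = star x - star y"
  using star_add[of x "- y"] by (simp add: star_minus)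

lemma star_scaleR: "star (r *\<^sub>R x::'a::cstar_algebra) = r *\<^sub>R star x"
  by (simp add: scaleR_scaleC star_scaleC)

lemmas star_simps = star_star star_add star_minus star_diff star_scaleR star_scaleC star_mult

lemma norm_star: "norm (star x) = norm (x::'a::cstar_algebra)"
proof -
  have le: "norm x \<le> norm (star x)" for x :: 'a
  proof (cases "norm x = 0")
    case False
    have "norm x * norm x \<le> norm (star x) * norm x"
      using cstar_identity[of x] norm_mult_ineq[of "star x" x] by (simp add: power2_eq_square)
    with False show ?thesis by simp
  qed simp
  show ?thesis using le[of x] le[of "star x"] by (simp add: star_star)
qed

lemma bounded_linear_star: "bounded_linear (star :: 'a::cstar_algebra \<Rightarrow> 'a)"
  by (rule bounded_linear_intro[where K=1]) (simp_all add: star_simps norm_star)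

lemma norm_selfadjoint_square: "star x = x \<Longrightarrow> norm (x * x :: 'a::cstar_algebra) = (norm x)\<^sup>2"
  using cstar_identity[of x] by simp

text \<open>Formally \<open>b = 1 - sqrt (1 - a)\<close>, the fixed point of \<open>b \<mapsto> (a + b\<^sup>2) / 2\<close>; no unit is needed.\<close>

lemma selfadjoint_one_minus_sqrt:
  fixes a :: "'a::cstar_algebra"
  assumes a: "star a = a" "norm a < 1"
  obtains b where "star b = b" "norm b < 1" "a = 2 *\<^sub>R b - b * b"
    "\<And>c. a * c = c * a \<Longrightarrow> b * c = c * b"
proof -
  \<comment> \<open>\<open>r\<close> is the smaller root of
    \<open>r\<^sup>2 - 2 r + norm a = 0\<close>: \<open>f\<close> maps the ball of radius
    \<open>r\<close> into itself and contracts there by the factor \<open>r < 1\<close>.\<close>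
  define r where "r = 1 - sqrt (1 - norm a)"
  have r: "0 \<le> r" "r < 1" using a(2) by (auto simp: r_def)
  have "(1 - r)\<^sup>2 = 1 - norm a" using a(2) by (simp add: r_def)
  then have rr: "norm a + r * r = 2 * r" by (simp add: power2_eq_square algebra_simps)
  \<comment> \<open>Selfadjointness and commutation with everything that commutes with
    \<open>a\<close> are closed conditions kept by \<open>f\<close>; built into \<open>S\<close>,
    they pass to the fixed point.\<close>
  define S where "S = {b. norm b \<le> r} \<inter> {b. star b = b} \<inter> (\<Inter>c\<in>{c. a * c = c * a}. {b. b * c = c * b})"
  define f where "f b = (1/2) *\<^sub>R (a + b * b)" for b
  have "closed {b. star b = (b::'a)}"
    by (rule closed_Collect_eq[OF linear_continuous_on[OF bounded_linear_star] continuous_on_id])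
  moreover have "closed (\<Inter>c\<in>{c. a * c = c * a}. {b. b * c = c * b})"
    by (intro closed_INT ballI closed_Collect_eq continuous_intros)
  moreover have "closed {b::'a. norm b \<le> r}"
    by (intro closed_Collect_le continuous_intros)
  ultimately have "closed S" unfolding S_def by (intro closed_Int)
  then have S: "complete S" by (simp add: complete_eq_closed)
  have "0 \<in> S" using r by (auto simp: S_def)
  have fS: "f ` S \<subseteq> S"
  proof clarify
    fix b assume b: "b \<in> S"
    have "norm (b * b) \<le> r * r"
      using b r by (intro norm_mult_ineq[THEN order_trans] mult_mono) (auto simp: S_def)
    then have "norm (a + b * b) \<le> norm a + r * r"
      by (intro norm_triangle_mono) auto
    then have "norm (f b) \<le> r" unfolding f_def norm_scaleR using rr by simp
    moreover have "star b = b" using b unfolding S_def by blast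
    then have "star (f b) = f b" using a by (simp add: f_def star_simps)
    moreover have "f b * c = c * f b" if "a * c = c * a" for c
    proof -
      have bc: "b * c = c * b" using b that unfolding S_def by blast
      have "b * b * c = c * (b * b)" by (metis bc mult.assoc)
      with that show ?thesis by (simp add: f_def distrib_left distrib_right)
    qed
    ultimately show "f b \<in> S" unfolding S_def by blast
  qed
  have lip: "dist (f x) (f y) \<le> r * dist x y" if "x \<in> S \<and> y \<in> S" for x y
  proof -
    have "f x - f y = (1/2) *\<^sub>R (x * (x - y) + (x - y) * y)"
      by (simp add: f_def algebra_simps)
    then have "norm (f x - f y) \<le> (1/2) * (norm (x * (x - y)) + norm ((x - y) * y))"
      using norm_triangle_ineq[of "x * (x - y)" "(x - y) * y"] by simp
    also have "\<dots> \<le> (1/2) * (norm x * norm (x - y) + norm (x - y) * norm y)"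
      using norm_mult_ineq[of x "x - y"] norm_mult_ineq[of "x - y" y] by simp
    also have "\<dots> \<le> (1/2) * (r * norm (x - y) + norm (x - y) * r)"
      using that by (intro mult_left_mono add_mono mult_right_mono) (simp_all add: S_def r)
    finally show ?thesis by (simp add: dist_norm algebra_simps)
  qed
  obtain b where b: "b \<in> S" "f b = b"
    using Banach_fix[OF S _ r(1,2) fS] lip \<open>0 \<in> S\<close> by blast
  have "2 *\<^sub>R b = 2 *\<^sub>R f b" by (simp add: b(2))
  also have "\<dots> = a + b * b" by (simp add: f_def)
  finally have "2 *\<^sub>R b = a + b * b" .
  then have "a = 2 *\<^sub>R b - b * b" by simp
  have b': "norm b \<le> r" "star b = b" "\<And>c. a * c = c * a \<Longrightarrow> b * c = c * b"
    using b(1) unfolding S_def by blast+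
  have "norm b < 1" using b'(1) r(2) by simp
  from b'(2) this \<open>a = _\<close> b'(3) show ?thesis by (rule that)
qed

section \<open>Positive elements of a unital C*-algebra, without spectra\<close>

class cstar_algebra_1 = cstar_algebra + monoid_mult

text \<open>For selfadjoint \<open>a\<close>, the norm condition means that the spectrum lies in
  \<open>[0, 2 t]\<close>. In this form, sums of positive elements are positive by the triangle
  inequality.\<close>

definition pos_elem :: "'a::cstar_algebra_1 \<Rightarrow> bool" where
  "pos_elem a \<longleftrightarrow> star a = a \<and> (\<exists>t\<ge>0. norm (t *\<^sub>R 1 - a) \<le> t)"

lemma star_one [simp]: "star (1::'a::cstar_algebra_1) = 1"
  by (metis mult_1_left star_mult star_star)

text \<open>\<open>cstar_algebra_1\<close> does not exclude \<open>1 = 0\<close>, so that the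
  multipliers of the zero algebra form an instance; hence an inequality.\<close>

lemma norm_one_le: "norm (1::'a::cstar_algebra_1) \<le> 1"
proof -
  have "(norm (1::'a))\<^sup>2 = norm (1::'a)" using cstar_identity[of "1::'a"] by simp
  then show ?thesis by (auto simp: power2_eq_square)
qed

lemma norm_power_le: "norm ((x::'a::cstar_algebra_1) ^ n) \<le> norm x ^ n"
proof (induction n)
  case (Suc n)
  then show ?case
    using norm_mult_ineq[of x "x ^ n"] by (simp add: order_trans[OF _ mult_left_mono])
qed (simp add: norm_one_le)

lemma norm_scaleR_one_le: "0 \<le> r \<Longrightarrow> norm (r *\<^sub>R (1::'a::cstar_algebra_1)) \<le> r"
  using norm_one_le[where 'a='a] by (simp add: mult_left_le)

lemma pos_elemI: "star a = a \<Longrightarrow> 0 \<le> t \<Longrightarrow> norm (t *\<^sub>R 1 - a) \<le> t \<Longrightarrow> pos_elem a"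
  by (auto simp: pos_elem_def)

lemma pos_elem_sa: "pos_elem a \<Longrightarrow> star a = a"
  by (simp add: pos_elem_def)

lemma pos_elem_add: assumes "pos_elem a" "pos_elem b" shows "pos_elem (a + b)"
proof -
  obtain s t where "0 \<le> s" "norm (s *\<^sub>R 1 - a) \<le> s" "0 \<le> t" "norm (t *\<^sub>R 1 - b) \<le> t"
    using assms by (auto simp: pos_elem_def)
  moreover have "(s + t) *\<^sub>R 1 - (a + b) = (s *\<^sub>R 1 - a) + (t *\<^sub>R 1 - b)"
    by (simp add: algebra_simps)
  ultimately have "norm ((s + t) *\<^sub>R 1 - (a + b)) \<le> s + t"
    using norm_triangle_mono by metis
  then show ?thesis using assms \<open>0 \<le> s\<close> \<open>0 \<le> t\<close>
    by (intro pos_elemI[of _ "s + t"]) (auto simp: pos_elem_sa star_simps)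
qed

lemma pos_elem_scaleR: assumes "pos_elem a" "0 \<le> r" shows "pos_elem (r *\<^sub>R a)"
proof -
  obtain t where t: "0 \<le> t" "norm (t *\<^sub>R 1 - a) \<le> t"
    using assms by (auto simp: pos_elem_def)
  have "norm ((r * t) *\<^sub>R 1 - r *\<^sub>R a) = r * norm (t *\<^sub>R 1 - a)"
    using assms by (simp flip: scaleR_scaleR scaleR_diff_right)
  then show ?thesis using assms t
    by (intro pos_elemI[of _ "r * t"]) (auto simp: pos_elem_sa star_simps mult_left_mono)
qed

lemma pos_elem_scaleR_one_diff: "star a = a \<Longrightarrow> norm a \<le> t \<Longrightarrow> pos_elem (t *\<^sub>R 1 - a)"
  using norm_ge_zero[of a] by (intro pos_elemI[of _ t]) (auto simp: star_simps simp del: norm_ge_zero)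

text \<open>\<open>a + \<epsilon> = s (1 - v)\<close>, where the shift by \<epsilon> makes
  \<open>norm v < 1\<close> strict. If \<open>v = 2 b - b\<^sup>2\<close>, then
  \<open>1 - v = (1 - b)\<^sup>2\<close>, which leads to \<open>e = sqrt s (1 - b)\<close>.\<close>

lemma pos_elem_sqrt:
  assumes "pos_elem a" "0 < \<epsilon>"
  obtains e where "pos_elem e" "e * e = a + \<epsilon> *\<^sub>R 1" "\<And>c. a * c = c * a \<Longrightarrow> e * c = c * e"
proof -
  obtain t where t: "0 \<le> t" "norm (t *\<^sub>R 1 - a) \<le> t"
    using assms by (auto simp: pos_elem_def)
  define s where "s = t + \<epsilon>"
  define v where "v = (1/s) *\<^sub>R (t *\<^sub>R 1 - a)"
  have s: "0 < s" "t < s" using t assms by (auto simp: s_def)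
  have "norm v \<le> t / s" using t s by (simp add: v_def divide_right_mono)
  also have "\<dots> < 1" using s by simp
  finally have "norm v < 1" .
  have "star v = v" using assms by (simp add: v_def star_simps pos_elem_sa)
  from this \<open>norm v < 1\<close> obtain b where b: "star b = b" "norm b < 1" "v = 2 *\<^sub>R b - b * b"
      "\<And>c. v * c = c * v \<Longrightarrow> b * c = c * b"
    by (rule selfadjoint_one_minus_sqrt) blast
  define e where "e = sqrt s *\<^sub>R (1 - b)"
  have "norm (sqrt s *\<^sub>R 1 - e) = sqrt s * norm b"
    using s by (simp add: e_def algebra_simps)
  also have "\<dots> \<le> sqrt s" using b(2) s by (simp add: mult_left_le)
  finally have "pos_elem e"
    using s b(1) by (intro pos_elemI[of _ "sqrt s"]) (auto simp: e_def star_simps)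
  moreover have "e * e = a + \<epsilon> *\<^sub>R 1"
  proof -
    have "e * e = s *\<^sub>R (1 - v)"
      using s by (simp add: e_def b(3) algebra_simps scaleR_2)
    also have "\<dots> = a + \<epsilon> *\<^sub>R 1"
      using s by (simp add: v_def scaleR_diff_right) (simp add: s_def algebra_simps)
    finally show ?thesis .
  qed
  moreover have "e * c = c * e" if "a * c = c * a" for c
  proof -
    have "b * c = c * b" using that by (intro b(4)) (simp add: v_def algebra_simps)
    then show ?thesis by (simp add: e_def algebra_simps)
  qed
  ultimately show ?thesis by (rule that)
qed

text \<open>The trick is that \<open>e\<close> is the real part of \<open>e + \<i>g\<close>.\<close>

lemma norm_square_le_add_squares:
  fixes e g :: "'a::cstar_algebra"
  assumes "star e = e" "star g = g" "e * g = g * e"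
  shows "norm (e * e) \<le> norm (e * e + g * g)"
proof -
  define u where "u = e + scaleC \<i> g"
  have su: "star u = e - scaleC \<i> g"
    using assms by (simp add: u_def star_simps)
  have "2 *\<^sub>R e = u + star u" by (simp only: su) (simp add: u_def scaleR_2)
  then have "2 * norm e \<le> norm u + norm (star u)"
    by (metis norm_scaleR norm_triangle_ineq abs_numeral)
  then have "norm e \<le> norm u" by (simp add: norm_star)
  moreover have "star u * u = e * e + g * g"
    unfolding su unfolding u_def
    by (simp add: distrib_left left_diff_distrib mult_scaleC_left mult_scaleC_right assms(3)
        scaleC_scaleC complex_vector.scale_minus_left complex_vector.scale_right_diff_distrib scaleC_one)
  ultimately show ?thesis
    using cstar_identity[of u] norm_selfadjoint_square[OF assms(1)] by (simp add: power_mono)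
qed

text \<open>The square roots \<open>e\<close> of \<open>a + \<epsilon>\<close> and \<open>g\<close>
  of \<open>K - a + \<epsilon>\<close> commute, and their squares add up to the scalar
  \<open>K + 2 \<epsilon>\<close>, which bounds the norm of \<open>e * e\<close>.\<close>

lemma norm_le_of_pos_elem:
  fixes a :: "'a::cstar_algebra_1"
  assumes "pos_elem a" "pos_elem (K *\<^sub>R 1 - a)" "0 \<le> K"
  shows "norm a \<le> K"
proof (rule field_le_epsilon)
  fix \<delta> :: real assume "0 < \<delta>"
  \<comment> \<open>Two thirds of \<delta> are spent on \<open>e * e + g * g\<close>, one third on
    \<open>a = e * e - \<epsilon>\<close>.\<close>
  define \<epsilon> where "\<epsilon> = \<delta> / 3"
  have \<epsilon>: "0 < \<epsilon>" "\<delta> = 3 * \<epsilon>" using \<open>0 < \<delta>\<close> by (auto simp: \<epsilon>_def)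
  obtain e where e: "pos_elem e" "e * e = a + \<epsilon> *\<^sub>R 1" "\<And>c. a * c = c * a \<Longrightarrow> e * c = c * e"
    using pos_elem_sqrt[OF assms(1) \<epsilon>(1)] by blast
  obtain g where g: "pos_elem g" "g * g = (K *\<^sub>R 1 - a) + \<epsilon> *\<^sub>R 1"
      "\<And>c. (K *\<^sub>R 1 - a) * c = c * (K *\<^sub>R 1 - a) \<Longrightarrow> g * c = c * g"
    using pos_elem_sqrt[OF assms(2) \<epsilon>(1)] by blast
  have "g * a = a * g" by (rule g(3)) (simp add: algebra_simps)
  then have "e * g = g * e" by (intro e(3)) simp
  then have "norm (e * e) \<le> norm (e * e + g * g)"
    using e(1) g(1) by (intro norm_square_le_add_squares) (auto simp: pos_elem_sa)
  also have "e * e + g * g = (K + 2 * \<epsilon>) *\<^sub>R 1"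
    by (simp add: e(2) g(2) algebra_simps scaleR_2 flip: scaleR_scaleR)
  also have "norm \<dots> \<le> K + 2 * \<epsilon>"
    using assms(3) \<epsilon> by (intro norm_scaleR_one_le) simp
  finally have "norm (e * e) \<le> K + 2 * \<epsilon>" .
  moreover have "norm a \<le> norm (e * e) + norm (\<epsilon> *\<^sub>R (1::'a))"
    unfolding e(2) by (metis add_diff_cancel_right' norm_triangle_ineq4)
  moreover have "norm (\<epsilon> *\<^sub>R (1::'a)) \<le> \<epsilon>" using \<epsilon> by (intro norm_scaleR_one_le) simp
  ultimately show "norm a \<le> K + \<delta>" using \<epsilon> by linarith
qed

text \<open>The definition of \<open>pos_elem\<close> grants one \<open>t\<close>; this admits every
  \<open>t \<ge> norm a\<close>. The preceding bound is applied to \<open>t - a\<close>, whose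
  complement in \<open>t\<close> is \<open>a\<close>.\<close>

lemma pos_elem_norm:
  assumes "pos_elem a" "norm a \<le> t"
  shows "norm (t *\<^sub>R 1 - a) \<le> t"
proof (rule norm_le_of_pos_elem)
  show "pos_elem (t *\<^sub>R 1 - a)" using assms by (intro pos_elem_scaleR_one_diff pos_elem_sa)
  show "0 \<le> t" using assms(2) norm_ge_zero[of a] by linarith
qed (use assms in simp)

lemma pos_elem_norm_mono:
  assumes "pos_elem a" "pos_elem b"
  shows "norm a \<le> norm (a + b)"
proof (rule norm_le_of_pos_elem)
  have "pos_elem (norm (a + b) *\<^sub>R 1 - (a + b))"
    using assms by (intro pos_elem_scaleR_one_diff pos_elem_sa pos_elem_add order_refl)
  from pos_elem_add[OF this assms(2)] show "pos_elem (norm (a + b) *\<^sub>R 1 - a)"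
    by (simp add: algebra_simps)
qed (use assms in auto)

text \<open>By \<open>pos_elem_norm\<close> one and the same \<open>t = norm a + 1\<close> serves
  all \<open>a + \<delta>\<close> with \<open>\<delta> \<le> 1\<close>, so \<delta> can tend to
  0.\<close>

lemma pos_elem_closed:
  assumes "\<And>\<delta>. 0 < \<delta> \<Longrightarrow> pos_elem (a + \<delta> *\<^sub>R 1)"
  shows "pos_elem a"
proof (rule pos_elemI)
  show "star a = a" using pos_elem_sa[OF assms[of 1]] by (simp add: star_simps)
  show "norm ((norm a + 1) *\<^sub>R 1 - a) \<le> norm a + 1"
  proof (rule field_le_epsilon)
    fix d :: real assume "0 < d"
    define \<delta> where "\<delta> = min (d / 2) 1"
    have \<delta>: "0 < \<delta>" "\<delta> \<le> 1" "2 * \<delta> \<le> d" using \<open>0 < d\<close> by (auto simp: \<delta>_def)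
    have n: "norm (\<delta> *\<^sub>R (1::'a)) \<le> \<delta>" using \<delta> by (intro norm_scaleR_one_le) simp
    have "norm (a + \<delta> *\<^sub>R 1) \<le> norm a + 1"
      using order_trans[OF n \<delta>(2)] by (intro norm_triangle_mono) auto
    then have "norm ((norm a + 1) *\<^sub>R 1 - (a + \<delta> *\<^sub>R 1)) \<le> norm a + 1"
      using assms \<delta> by (intro pos_elem_norm) auto
    from norm_triangle_mono[OF this n] show "norm ((norm a + 1) *\<^sub>R 1 - a) \<le> norm a + 1 + d"
      using \<delta> by (simp add: algebra_simps)
  qed
qed simp

text \<open>For \<open>norm c < 1\<close> write \<open>1 - c\<^sup>2 = (1 - b)\<^sup>2\<close> with
  \<open>b\<close> selfadjoint and commuting with \<open>c\<close>. As
  \<open>(1 - b)\<^sup>2 + c\<^sup>2 = 1\<close>, \<open>norm_square_le_add_squares\<close> gives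
  \<open>norm (1 - c\<^sup>2) \<le> 1\<close>, which is positivity with
  \<open>t = 1\<close>.\<close>

lemma pos_elem_square:
  fixes c :: "'a::cstar_algebra_1"
  assumes "star c = c"
  shows "pos_elem (c * c)"
proof -
  have lt: "pos_elem (c * c)" if c: "star c = c" "norm c < 1" for c :: 'a
  proof -
    have "norm (c * c) = (norm c)\<^sup>2" by (rule norm_selfadjoint_square[OF c(1)])
    also have "\<dots> < 1" using c(2) by (simp add: power_less_one_iff abs_square_less_1)
    finally have "norm (c * c) < 1" .
    moreover have "star (c * c) = c * c" using c by (simp add: star_simps)
    ultimately obtain b where b: "star b = b" "c * c = 2 *\<^sub>R b - b * b"
        "\<And>d. (c * c) * d = d * (c * c) \<Longrightarrow> b * d = d * b"
      by (metis selfadjoint_one_minus_sqrt)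
    have "b * c = c * b" by (rule b(3)) (simp add: mult.assoc)
    then have "norm ((1 - b) * (1 - b)) \<le> norm ((1 - b) * (1 - b) + c * c)"
      using b(1) c(1) by (intro norm_square_le_add_squares) (auto simp: star_simps algebra_simps)
    also have "(1 - b) * (1 - b) = 1 - c * c" by (simp add: b(2) algebra_simps scaleR_2)
    finally have "norm (1 - c * c) \<le> 1" using norm_one_le[where 'a='a] by simp
    then show ?thesis using c by (intro pos_elemI[of _ 1]) (auto simp: star_simps)
  qed
  define s where "s = norm c + 1"
  have s: "0 < s" by (simp add: s_def add_nonneg_pos)
  have "pos_elem (((1/s) *\<^sub>R c) * ((1/s) *\<^sub>R c))"
    using s assms by (intro lt) (auto simp: star_simps s_def)
  then have "pos_elem ((s * s) *\<^sub>R (((1/s) *\<^sub>R c) * ((1/s) *\<^sub>R c)))"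
    by (rule pos_elem_scaleR) (use s in auto)
  then show ?thesis using s by simp
qed

text \<open>If \<open>e\<close> is a square root of \<open>a + \<epsilon>\<close>, then
  \<open>c e\<close> is selfadjoint by commutation and
  \<open>(c e)\<^sup>2 = c a c + \<epsilon> c\<^sup>2\<close>. Squares of selfadjoint elements
  suffice here, so the lemma may be used on the way to \<open>star b * b\<close>.\<close>

lemma pos_elem_conj_commuting:
  assumes "pos_elem a" "star c = c" "a * c = c * a"
  shows "pos_elem (c * a * c)"
proof (rule pos_elem_closed)
  fix \<delta> :: real assume "0 < \<delta>"
  \<comment> \<open>\<open>N - c\<^sup>2\<close> is positive, so
    \<open>\<epsilon> (N - c\<^sup>2)\<close> fills the error up to
    \<open>\<epsilon> N = \<delta>\<close>; the summand 1 keeps \<open>N\<close> nonzero.\<close>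
  define N where "N = norm (c * c) + 1"
  define \<epsilon> where "\<epsilon> = \<delta> / N"
  have N: "0 < N" by (simp add: N_def add_nonneg_pos)
  then have \<epsilon>: "0 < \<epsilon>" "\<epsilon> * N = \<delta>" using \<open>0 < \<delta>\<close> by (auto simp: \<epsilon>_def)
  obtain e where e: "pos_elem e" "e * e = a + \<epsilon> *\<^sub>R 1" "\<And>c. a * c = c * a \<Longrightarrow> e * c = c * e"
    using pos_elem_sqrt[OF assms(1) \<epsilon>(1)] by blast
  have ec: "e * c = c * e" by (rule e(3)[OF assms(3)])
  have "pos_elem ((c * e) * (c * e))"
    using e(1) assms ec by (intro pos_elem_square) (simp add: star_simps pos_elem_sa)
  moreover have "(c * e) * (c * e) = c * a * c + \<epsilon> *\<^sub>R (c * c)"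
  proof -
    have "(c * e) * (c * e) = c * (e * e) * c" by (metis ec mult.assoc)
    then show ?thesis by (simp add: e(2) distrib_left distrib_right)
  qed
  moreover have "pos_elem (\<epsilon> *\<^sub>R (N *\<^sub>R 1 - c * c))"
    using \<epsilon> assms by (intro pos_elem_scaleR pos_elem_scaleR_one_diff) (auto simp: star_simps N_def)
  ultimately show "pos_elem (c * a * c + \<delta> *\<^sub>R 1)"
    using pos_elem_add[of "c * a * c + \<epsilon> *\<^sub>R (c * c)" "\<epsilon> *\<^sub>R (N *\<^sub>R 1 - c * c)"] \<epsilon>(2)
    by (simp add: scaleR_diff_right)
qed

text \<open>A substitute for the spectral radius formula: the C*-identity for selfadjoint elements
  allows repeated squaring, hence the exponents \<open>2 ^ k\<close>.\<close>

lemma norm_selfadjoint_power: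
  fixes u :: "'a::cstar_algebra_1"
  assumes "star u = u"
  shows "norm (u ^ (2 ^ k)) = norm u ^ (2 ^ k)"
proof (induction k)
  case (Suc k)
  have "star (u ^ n) = u ^ n" for n
    by (induction n) (auto simp: star_simps assms power_commutes)
  then have "norm (u ^ 2 ^ k * u ^ 2 ^ k) = (norm (u ^ 2 ^ k))\<^sup>2"
    by (rule norm_selfadjoint_square)
  then show ?case by (simp add: Suc power2_eq_square mult_2 power_add)
qed simp

text \<open>
  The spectra of \<open>y y\<^sup>*\<close> and \<open>y\<^sup>* y\<close> agree up to \<open>0\<close>. Here this is reflected by
  \<open>y\<^sup>* y (T - y\<^sup>* y)\<^sup>n = y\<^sup>* (T - y y\<^sup>*)\<^sup>n y\<close>, which controls the spectral radius of \<open>T - y\<^sup>* y\<close>.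
\<close>

lemma norm_scaleR_one_diff_swap:
  fixes y :: "'a::cstar_algebra_1"
  assumes "norm (T *\<^sub>R 1 - y * star y) \<le> S" "0 \<le> T" "T \<le> S"
  shows "norm (T *\<^sub>R 1 - star y * y) \<le> S"
proof (rule ccontr)
  define u where "u = T *\<^sub>R 1 - star y * y"
  define v where "v = T *\<^sub>R 1 - y * star y"
  define m where "m = norm u"
  define C where "C = norm (star y) * norm y"
  assume "\<not> norm (T *\<^sub>R 1 - star y * y) \<le> S"
  then have m: "S < m" "0 < m" "T < m" using assms by (auto simp: m_def u_def)
  have yv: "star y * v = u * star y"
    by (simp add: u_def v_def algebra_simps)
  have yvn: "star y * v ^ n = u ^ n * star y" for n
  proof (induction n)
    case (Suc n)
    have "star y * v ^ Suc n = u ^ n * (star y * v)"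
      by (simp only: power_Suc2 mult.assoc[symmetric] Suc)
    also have "\<dots> = u ^ Suc n * star y" by (simp only: yv power_Suc2 mult.assoc)
    finally show ?case .
  qed simp
  have su: "star u = u" by (simp add: u_def star_simps)
  \<comment> \<open>The exponent \<open>Suc n = 2 ^ k\<close> makes the norm of
    \<open>u ^ Suc n\<close> exactly \<open>m ^ Suc n\<close>. One factor
    \<open>u = T - star y * y\<close> is split off; the part with \<open>v ^ n\<close> grows at most
    like \<open>S ^ n\<close>, too slowly if \<open>S < m\<close>.\<close>
  have bound: "(m - T) * m ^ n \<le> C * S ^ n" if n: "Suc n = 2 ^ k" for n k
  proof -
    have "u ^ Suc n = T *\<^sub>R u ^ n - star y * v ^ n * y"
      by (simp only: yvn power_Suc2) (simp add: u_def right_diff_distrib mult.assoc)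
    then have "norm (u ^ Suc n) \<le> norm (T *\<^sub>R u ^ n) + norm (star y * v ^ n * y)"
      by (simp only: norm_triangle_ineq4)
    moreover have "norm (u ^ Suc n) = m ^ Suc n"
      unfolding n m_def by (rule norm_selfadjoint_power[OF su])
    moreover have "norm (T *\<^sub>R u ^ n) \<le> T * m ^ n"
      using assms(2) norm_power_le[of u n] by (simp add: m_def mult_left_mono)
    moreover have "norm (star y * v ^ n * y) \<le> norm (star y) * norm (v ^ n) * norm y"
      by (meson norm_mult_ineq order_trans mult_right_mono norm_ge_zero)
    moreover have "norm (v ^ n) \<le> S ^ n"
      using norm_power_le[of v n] power_mono[OF assms(1), of n] by (simp add: v_def)
    then have "norm (star y) * norm (v ^ n) * norm y \<le> C * S ^ n"
      using mult_left_mono[of "norm (v ^ n)" "S ^ n" C] by (simp add: C_def ac_simps)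
    ultimately have "m ^ Suc n \<le> T * m ^ n + C * S ^ n" by linarith
    then show ?thesis by (simp add: algebra_simps)
  qed
  have S: "0 \<le> S" using assms by simp
  have le: "m - T \<le> C * (S / m) ^ k" for k
  proof -
    define n where "n = (2::nat) ^ k - 1"
    have n: "Suc n = 2 ^ k" by (simp add: n_def)
    \<comment> \<open>Since \<open>S / m < 1\<close>, the exponent \<open>2 ^ k - 1\<close> may be
      lowered to \<open>k\<close>, which leaves a geometric sequence.\<close>
    have "k \<le> n" using less_exp[of k] n by linarith
    have "m - T \<le> C * (S / m) ^ n"
      using bound[OF n] m by (simp add: field_simps)
    also have "\<dots> \<le> C * (S / m) ^ k"
      using m S \<open>k \<le> n\<close> by (intro mult_left_mono power_decreasing) (auto simp: C_def)
    finally show ?thesis .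
  qed
  have "(\<lambda>k. C * (S / m) ^ k) \<longlonglongrightarrow> C * 0"
    using m S by (intro tendsto_mult_left LIMSEQ_power_zero) auto
  then have "m - T \<le> C * 0" using le by (intro LIMSEQ_le_const) auto
  then show False using m by simp
qed

text \<open>
  With \<open>c = b\<^sup>* b\<close>, \<open>e = sqrt (c\<^sup>2 + \<epsilon>)\<close> and \<open>w = e - c\<close> (about twice the negative part of \<open>c\<close>),
  \<open>y = b w\<close> satisfies \<open>y\<^sup>* y = \<epsilon> w - w e w\<close>, which is almost negative. Hence \<open>y y\<^sup>*\<close> is almost
  positive, and by the preceding lemma so is \<open>y\<^sup>* y\<close>. This forces \<open>w\<close> to be small.
\<close>

lemma pos_elem_star_mult: "pos_elem (star b * (b::'a::cstar_algebra_1))"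
proof (rule pos_elem_closed)
  fix \<delta> :: real assume \<delta>: "0 < \<delta>"
  define c where "c = star b * b"
  \<comment> \<open>The 9 anticipates \<open>norm (w * w * w) \<le> 9 * D\<close>: then \<open>N ^ 4
    \<le> 9 \<epsilon> N\<^sup>2 = \<delta>\<^sup>2 N\<^sup>2\<close>.\<close>
  define \<epsilon> where "\<epsilon> = \<delta>\<^sup>2 / 9"
  have \<epsilon>: "0 < \<epsilon>" "9 * \<epsilon> = \<delta>\<^sup>2" using \<delta> by (auto simp: \<epsilon>_def)
  have sc: "star c = c" by (simp add: c_def star_simps)
  obtain e where e: "pos_elem e" "e * e = c * c + \<epsilon> *\<^sub>R 1"
      "\<And>d. (c * c) * d = d * (c * c) \<Longrightarrow> e * d = d * e"
    using pos_elem_sqrt[OF pos_elem_square[OF sc] \<epsilon>(1)] by blast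
  have ec: "e * c = c * e" by (rule e(3)) (simp add: mult.assoc)
  have se: "star e = e" using e(1) by (rule pos_elem_sa)
  define w where "w = e - c"
  define N where "N = norm w"
  define D where "D = \<epsilon> * N"
  define y where "y = b * w"
  have sw: "star w = w" by (simp add: w_def star_simps se sc)
  have D: "0 \<le> D" using \<epsilon> by (simp add: D_def N_def)
  have "w * (e + c) = \<epsilon> *\<^sub>R 1" using ec e(2) by (simp add: w_def algebra_simps)
  then have wsum: "w * e * w + w * c * w = \<epsilon> *\<^sub>R w"
    by (metis distrib_left distrib_right mult_scaleR_left mult_1_left)
  have yy: "star y * y = w * c * w" by (simp add: y_def star_simps sw c_def mult.assoc)
  have nw: "norm (\<epsilon> *\<^sub>R w) = D" using \<epsilon> by (simp add: D_def N_def)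
  have pos1: "pos_elem (D *\<^sub>R 1 - star y * y)"
  proof -
    have "pos_elem (\<epsilon> *\<^sub>R (N *\<^sub>R 1 - w))"
      using \<epsilon> sw by (intro pos_elem_scaleR pos_elem_scaleR_one_diff) (auto simp: N_def)
    moreover have "pos_elem (w * e * w)"
      using e(1) sw by (rule pos_elem_conj_commuting) (simp add: w_def algebra_simps ec)
    ultimately have "pos_elem (\<epsilon> *\<^sub>R (N *\<^sub>R 1 - w) + w * e * w)" by (rule pos_elem_add)
    moreover have "\<epsilon> *\<^sub>R (N *\<^sub>R 1 - w) + w * e * w = D *\<^sub>R 1 - star y * y"
      using wsum by (simp add: yy D_def scaleR_diff_right flip: wsum)
    ultimately show ?thesis by simp
  qed
  \<comment> \<open>\<open>h\<close> and \<open>k\<close> are proportional to the real and the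
    imaginary part of \<open>y\<close>, so half of \<open>h\<^sup>2 + k\<^sup>2\<close> is
    \<open>star y * y + y * star y\<close>; adding \<open>D - star y * y\<close> leaves
    \<open>D + y * star y\<close>.\<close>
  have pos2: "pos_elem (D *\<^sub>R 1 + y * star y)"
  proof -
    define h where "h = y + star y"
    define k where "k = scaleC \<i> (y - star y)"
    have "pos_elem (h * h)" "pos_elem (k * k)"
      by (intro pos_elem_square; simp add: h_def k_def star_simps complex_vector.scale_right_diff_distrib add.commute
          complex_vector.scale_minus_left)+
    then have "pos_elem ((1/2) *\<^sub>R (h * h + k * k) + (D *\<^sub>R 1 - star y * y))"
      by (intro pos_elem_add pos_elem_scaleR pos1) auto
    moreover have "k * k = - ((y - star y) * (y - star y))"
      by (simp add: k_def mult_scaleC_left mult_scaleC_right scaleC_scaleC complex_vector.scale_minus_left scaleC_one)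
    then have "h * h + k * k = 2 *\<^sub>R (star y * y + y * star y)"
      by (simp add: h_def algebra_simps scaleR_2)
    ultimately show ?thesis by (simp add: algebra_simps)
  qed
  have n3: "norm (star y * y) \<le> 3 * D"
  proof -
    \<comment> \<open>The swap is applied with \<open>T = t - D\<close> and \<open>S = t\<close>;
      the summand \<open>D\<close> in \<open>t\<close> makes \<open>T\<close> nonnegative.\<close>
    define t where "t = norm (D *\<^sub>R 1 + y * star y) + D"
    have "norm (t *\<^sub>R 1 - (D *\<^sub>R 1 + y * star y)) \<le> t"
      using pos2 D by (intro pos_elem_norm) (auto simp: t_def)
    then have "norm ((t - D) *\<^sub>R 1 - y * star y) \<le> t" by (simp add: algebra_simps)
    then have "norm ((t - D) *\<^sub>R 1 - star y * y) \<le> t"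
      using D by (rule_tac norm_scaleR_one_diff_swap) (auto simp: t_def)
    then have "pos_elem (D *\<^sub>R 1 + star y * y)"
      using D by (intro pos_elemI[of _ t]) (auto simp: t_def star_simps algebra_simps)
    moreover have "pos_elem ((2 * D) *\<^sub>R 1 - (D *\<^sub>R 1 + star y * y))"
      using pos1 by (simp add: algebra_simps scaleR_2 flip: scaleR_scaleR)
    ultimately have "norm (D *\<^sub>R 1 + star y * y) \<le> 2 * D"
      using D by (intro norm_le_of_pos_elem) auto
    moreover have "norm (D *\<^sub>R (1::'a)) \<le> D" using D by (rule norm_scaleR_one_le)
    moreover have "norm (star y * y) \<le> norm (D *\<^sub>R 1 + star y * y) + norm (D *\<^sub>R (1::'a))"
      by (metis norm_triangle_ineq4 add_diff_cancel_left')
    ultimately show ?thesis by linarith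
  qed
  \<comment> \<open>This is \<open>\<epsilon> w - 2 (star y * y)\<close>; uncancelled, it is bounded
    by \<open>2 D + D + 6 D\<close>.\<close>
  have w3: "w * w * w = 2 *\<^sub>R (\<epsilon> *\<^sub>R w) - \<epsilon> *\<^sub>R w - 2 *\<^sub>R (star y * y)"
  proof -
    have "w * w * w = w * e * w - w * c * w" by (simp add: w_def algebra_simps)
    then show ?thesis by (simp add: yy scaleR_2 flip: wsum)
  qed
  have "norm (w * w * w) \<le> norm (2 *\<^sub>R (\<epsilon> *\<^sub>R w)) + norm (\<epsilon> *\<^sub>R w) + norm (2 *\<^sub>R (star y * y))"
    unfolding w3 by (rule order_trans[OF norm_triangle_ineq4 add_right_mono[OF norm_triangle_ineq4]])
  then have "norm (w * w * w) \<le> 2 * D + D + 2 * norm (star y * y)"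
    unfolding norm_scaleR[of 2] nw by simp
  with n3 have www: "norm (w * w * w) \<le> 9 * D" by simp
  have "N ^ 4 = norm (w * w * (w * w))"
    using norm_selfadjoint_square[OF sw] norm_selfadjoint_square[of "w * w"] by (simp add: N_def star_simps sw power_mult[symmetric])
  also have "\<dots> \<le> norm (w * w * w) * N"
    using norm_mult_ineq[of "w * w * w" w] by (simp add: N_def mult.assoc)
  also have "\<dots> \<le> 9 * D * N" using www by (simp add: N_def mult_right_mono)
  also have "\<dots> = \<delta>\<^sup>2 * N\<^sup>2" unfolding \<epsilon>(2)[symmetric] by (simp add: D_def power2_eq_square)
  finally have "N\<^sup>2 * N\<^sup>2 \<le> \<delta>\<^sup>2 * N\<^sup>2" by (simp flip: power_add)
  then have "N = 0 \<or> N\<^sup>2 \<le> \<delta>\<^sup>2" unfolding mult_le_cancel_right by auto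
  then have "N \<le> \<delta>" using \<delta> by (auto intro: power2_le_imp_le)
  \<comment> \<open>As \<open>e - w = c\<close>, replacing \<open>w\<close> by its bound \<delta>
    costs only \<delta>.\<close>
  then have "pos_elem (e + (\<delta> *\<^sub>R 1 - w))"
    using e(1) sw unfolding N_def by (intro pos_elem_add pos_elem_scaleR_one_diff)
  moreover have "e + (\<delta> *\<^sub>R 1 - w) = star b * b + \<delta> *\<^sub>R 1"
    unfolding w_def c_def by simp
  ultimately show "pos_elem (star b * b + \<delta> *\<^sub>R 1)" by simp
qed


section \<open>The multiplier algebra\<close>

text \<open>
  Multipliers are the adjointable maps of the algebra, seen as a Hilbert module over itself.
  They form a unital C*-algebra which contains the given one.
\<close>

definition mult_adjoint :: "('a::cstar_algebra \<Rightarrow>\<^sub>L 'a) \<Rightarrow> ('a \<Rightarrow>\<^sub>L 'a) \<Rightarrow> bool" where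
  "mult_adjoint T S \<longleftrightarrow> (\<forall>x y. star (blinfun_apply T x) * y = star x * blinfun_apply S y)"

text \<open>Test with \<open>x = y - z\<close>: the inner product \<open>star x * y\<close> of the
  algebra is definite.\<close>

lemma star_mult_cancel:
  assumes "\<And>x. star x * y = star x * (z::'a::cstar_algebra)"
  shows "y = z"
proof -
  have "star (y - z) * (y - z) = 0"
    using assms[of "y - z"] by (simp add: right_diff_distrib)
  then show ?thesis using cstar_identity[of "y - z"] by simp
qed

lemma mult_adjointD: "mult_adjoint T S \<Longrightarrow> star (blinfun_apply T x) * y = star x * blinfun_apply S y"
  by (simp add: mult_adjoint_def)

lemma mult_adjoint_sym:
  assumes "mult_adjoint T S"
  shows "mult_adjoint S T"
  unfolding mult_adjoint_def
proof (intro allI)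
  fix x y
  have "star (star (blinfun_apply T y) * x) = star (star y * blinfun_apply S x)"
    by (simp only: mult_adjointD[OF assms])
  then show "star (blinfun_apply S x) * y = star x * blinfun_apply T y"
    by (simp only: star_mult star_star)
qed

lemma mult_adjoint_unique:
  assumes "mult_adjoint T S" "mult_adjoint T S'"
  shows "S = S'"
proof (rule blinfun_eqI, rule star_mult_cancel)
  fix x y
  show "star x * blinfun_apply S y = star x * blinfun_apply S' y"
    using mult_adjointD[OF assms(1), of x y] mult_adjointD[OF assms(2), of x y] by simp
qed

text \<open>A \<open>blinfun\<close> is only real-linear; having an adjoint forces complex
  linearity.\<close>

lemma mult_adjoint_scaleC:
  assumes "mult_adjoint T S"
  shows "blinfun_apply T (scaleC c x) = scaleC c (blinfun_apply T x)"
proof (rule star_mult_cancel)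
  note S = mult_adjointD[OF mult_adjoint_sym[OF assms], symmetric]
  fix z show "star z * blinfun_apply T (scaleC c x) = star z * scaleC c (blinfun_apply T x)"
    by (simp add: S mult_scaleC_right)
qed

text \<open>The square of the norm of \<open>T x\<close> is the norm of
  \<open>star x * S (T x)\<close>. This is the harder half of the C*-identity for
  multipliers.\<close>

lemma norm_mult_adjoint_le:
  assumes "mult_adjoint T S"
  shows "(norm T)\<^sup>2 \<le> norm (S o\<^sub>L T)"
proof -
  have "norm (blinfun_apply T x) \<le> sqrt (norm (S o\<^sub>L T)) * norm x" for x
  proof -
    have "(norm (blinfun_apply T x))\<^sup>2 = norm (star x * blinfun_apply (S o\<^sub>L T) x)"
      using mult_adjointD[OF assms, of x "blinfun_apply T x"] cstar_identity[of "blinfun_apply T x"] by simp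
    also have "\<dots> \<le> norm x * (norm (S o\<^sub>L T) * norm x)"
      using norm_blinfun[of "S o\<^sub>L T" x] by (intro norm_mult_ineq[THEN order_trans] mult_mono) (auto simp: norm_star)
    also have "\<dots> = (sqrt (norm (S o\<^sub>L T)) * norm x)\<^sup>2" by (simp add: power_mult_distrib power2_eq_square)
    finally show ?thesis by (rule power2_le_imp_le) simp
  qed
  then have "norm T \<le> sqrt (norm (S o\<^sub>L T))" by (intro norm_blinfun_bound) auto
  then have "(norm T)\<^sup>2 \<le> (sqrt (norm (S o\<^sub>L T)))\<^sup>2" by (rule power_mono) simp
  then show ?thesis by simp
qed

lemma norm_mult_adjoint:
  assumes "mult_adjoint T S"
  shows "norm S = norm T"
proof -
  have le: "norm T \<le> norm S" if "mult_adjoint T S" for T S :: "'a \<Rightarrow>\<^sub>L 'a"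
  proof (cases "norm T = 0")
    case False
    have "norm T * norm T \<le> norm S * norm T"
      using norm_mult_adjoint_le[OF that] norm_blinfun_compose[of S T] by (simp add: power2_eq_square)
    with False show ?thesis by simp
  qed simp
  show ?thesis using le[OF assms] le[OF mult_adjoint_sym[OF assms]] by simp
qed

lemma mult_adjoint_add: "mult_adjoint T S \<Longrightarrow> mult_adjoint T' S' \<Longrightarrow> mult_adjoint (T + T') (S + S')"
  by (simp add: mult_adjoint_def blinfun.add_left star_add distrib_left distrib_right)

lemma mult_adjoint_scaleR: "mult_adjoint T S \<Longrightarrow> mult_adjoint (r *\<^sub>R T) (r *\<^sub>R S)"
  by (simp add: mult_adjoint_def blinfun.scaleR_left star_scaleR)

lemma mult_adjoint_minus: "mult_adjoint T S \<Longrightarrow> mult_adjoint (- T) (- S)"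
  by (simp add: mult_adjoint_def blinfun.minus_left star_minus)

lemma mult_adjoint_zero: "mult_adjoint 0 0"
  by (simp add: mult_adjoint_def)

lemma mult_adjoint_id: "mult_adjoint id_blinfun id_blinfun"
  by (simp add: mult_adjoint_def)

lemma mult_adjoint_compose: "mult_adjoint T S \<Longrightarrow> mult_adjoint T' S' \<Longrightarrow> mult_adjoint (T o\<^sub>L T') (S' o\<^sub>L S)"
  by (simp add: mult_adjoint_def)

lemma scaleC_scaleR_commute: "scaleC c (r *\<^sub>R x) = r *\<^sub>R scaleC c x"
  unfolding scaleR_scaleC scaleC_scaleC by (simp only: mult.commute)

lemma bounded_linear_scaleC: "bounded_linear (scaleC c :: 'a::complex_banach \<Rightarrow> 'a)"
  by (rule bounded_linear_intro[where K="cmod c"])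
    (simp_all add: scaleC_add_right scaleC_scaleR_commute norm_scaleC)

definition scaleC_blinfun :: "complex \<Rightarrow> 'a::complex_banach \<Rightarrow>\<^sub>L 'a" where
  "scaleC_blinfun c = Blinfun (scaleC c)"

lemma scaleC_blinfun_apply [simp]: "blinfun_apply (scaleC_blinfun c) x = scaleC c x"
  by (simp add: scaleC_blinfun_def bounded_linear_Blinfun_apply bounded_linear_scaleC)

lemma mult_adjoint_scaleC_blinfun: "mult_adjoint (scaleC_blinfun c) (scaleC_blinfun (cnj c))"
  by (simp add: mult_adjoint_def star_scaleC mult_scaleC_left mult_scaleC_right)

definition mult_left_blinfun :: "'a::cstar_algebra \<Rightarrow> 'a \<Rightarrow>\<^sub>L 'a" where
  "mult_left_blinfun a = Blinfun ((*) a)"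

lemma mult_left_blinfun_apply [simp]: "blinfun_apply (mult_left_blinfun a) x = a * x"
  by (simp add: mult_left_blinfun_def bounded_linear_Blinfun_apply bounded_linear_mult_right)

lemma mult_adjoint_mult_left: "mult_adjoint (mult_left_blinfun a) (mult_left_blinfun (star a))"
  by (simp add: mult_adjoint_def  star_mult mult.assoc)

lemma norm_mult_left_blinfun: "norm (mult_left_blinfun (a::'a::cstar_algebra)) = norm a"
proof (rule antisym)
  show "norm (mult_left_blinfun a) \<le> norm a"
    by (rule norm_blinfun_bound) (auto simp:  norm_mult_ineq)
  \<comment> \<open>The test vector \<open>star a\<close> recovers the norm of \<open>a\<close>, as
    \<open>norm (a * star a) = (norm a)\<^sup>2\<close>.\<close>
  have "norm a * norm a \<le> norm (mult_left_blinfun a) * norm a"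
    using norm_blinfun[of "mult_left_blinfun a" "star a"] cstar_identity[of "star a"]
    by (simp add:  norm_star star_star power2_eq_square)
  then show "norm a \<le> norm (mult_left_blinfun a)" by (cases "a = 0") auto
qed

text \<open>Taking adjoints is isometric, so the adjoints of a convergent sequence converge as well.
  The completeness of the multiplier algebra comes from this.\<close>

lemma closed_adjointable: "closed {T :: 'a::cstar_algebra \<Rightarrow>\<^sub>L 'a. \<exists>S. mult_adjoint T S}"
  unfolding closed_sequential_limits
proof (intro allI impI, elim conjE)
  fix T and L :: "'a \<Rightarrow>\<^sub>L 'a"
  assume T: "\<forall>n. T n \<in> {T. \<exists>S. mult_adjoint T S}" and lim: "T \<longlonglongrightarrow> L"
  then have "\<forall>n. \<exists>S. mult_adjoint (T n) S" by simp
  from choice[OF this] obtain S where S: "\<And>n. mult_adjoint (T n) (S n)" by blast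
  have "dist (S m) (S n) = dist (T m) (T n)" for m n
    using norm_mult_adjoint[OF mult_adjoint_add[OF S[of m] mult_adjoint_minus[OF S[of n]]]]
    by (simp add: dist_norm)
  moreover have "Cauchy T" using lim by (rule LIMSEQ_imp_Cauchy)
  ultimately have "Cauchy S" by (simp add: Cauchy_def)
  then obtain R where R: "S \<longlonglongrightarrow> R" using Cauchy_convergent convergent_def by blast
  have "mult_adjoint L R"
    unfolding mult_adjoint_def
  proof (intro allI)
    fix x y
    have "(\<lambda>n. star (blinfun_apply (T n) x) * y) \<longlonglongrightarrow> star (blinfun_apply L x) * y"
      by (intro tendsto_intros bounded_linear.tendsto[OF bounded_linear_star] lim)
    moreover have "(\<lambda>n. star x * blinfun_apply (S n) y) \<longlonglongrightarrow> star x * blinfun_apply R y"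
      by (intro tendsto_intros R)
    ultimately show "star (blinfun_apply L x) * y = star x * blinfun_apply R y"
      using LIMSEQ_unique by (simp add: mult_adjointD[OF S])
  qed
  then show "L \<in> {T. \<exists>S. mult_adjoint T S}" by blast
qed

text \<open>Only \<open>T\<close> is stored, since its adjoint is unique. The operator norm is a
  C*-norm whether or not the algebra has a unit.\<close>

typedef (overloaded) 'a multiplier = "{T :: 'a::cstar_algebra \<Rightarrow>\<^sub>L 'a. \<exists>S. mult_adjoint T S}"
  using mult_adjoint_zero by blast

setup_lifting type_definition_multiplier

definition blinfun_adjoint :: "('a::cstar_algebra \<Rightarrow>\<^sub>L 'a) \<Rightarrow> ('a \<Rightarrow>\<^sub>L 'a)" where
  "blinfun_adjoint T = (THE S. mult_adjoint T S)"

lemma blinfun_adjoint_eq: "mult_adjoint T S \<Longrightarrow> blinfun_adjoint T = S"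
  unfolding blinfun_adjoint_def by (rule the_equality) (auto intro: mult_adjoint_unique)

lemma mult_adjoint_blinfun_adjoint: "\<exists>S. mult_adjoint T S \<Longrightarrow> mult_adjoint T (blinfun_adjoint T)"
  using blinfun_adjoint_eq by blast

section \<open>The C*-algebra structure on multipliers\<close>

instantiation multiplier :: (cstar_algebra) real_vector
begin

lift_definition zero_multiplier :: "'a multiplier" is 0
  using mult_adjoint_zero by blast

lift_definition plus_multiplier :: "'a multiplier \<Rightarrow> 'a multiplier \<Rightarrow> 'a multiplier" is "(+)"
  using mult_adjoint_add by blast

lift_definition uminus_multiplier :: "'a multiplier \<Rightarrow> 'a multiplier" is uminus
  using mult_adjoint_minus by blast

lift_definition minus_multiplier :: "'a multiplier \<Rightarrow> 'a multiplier \<Rightarrow> 'a multiplier" is "(-)"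
  by (metis mult_adjoint_add mult_adjoint_minus diff_conv_add_uminus)

lift_definition scaleR_multiplier :: "real \<Rightarrow> 'a multiplier \<Rightarrow> 'a multiplier" is "scaleR"
  using mult_adjoint_scaleR by blast

instance
proof
  fix a b c :: "'a multiplier" and r s :: real
  show "a + b + c = a + (b + c)" by transfer (rule add.assoc)
  show "a + b = b + a" by transfer (rule add.commute)
  show "0 + a = a" by transfer (rule add_0)
  show "- a + a = 0" by transfer (rule ab_left_minus)
  show "a - b = a + - b" by transfer (rule diff_conv_add_uminus)
  show "r *\<^sub>R (a + b) = r *\<^sub>R a + r *\<^sub>R b" by transfer (rule scaleR_right_distrib)
  show "(r + s) *\<^sub>R a = r *\<^sub>R a + s *\<^sub>R a" by transfer (rule scaleR_left_distrib)
  show "r *\<^sub>R s *\<^sub>R a = (r * s) *\<^sub>R a" by transfer (rule scaleR_scaleR)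
  show "1 *\<^sub>R a = a" by transfer (rule scaleR_one)
qed

end

instantiation multiplier :: (cstar_algebra) real_normed_vector
begin

lift_definition norm_multiplier :: "'a multiplier \<Rightarrow> real" is norm .

definition sgn_multiplier :: "'a multiplier \<Rightarrow> 'a multiplier" where
  "sgn_multiplier x = x /\<^sub>R norm x"

definition dist_multiplier :: "'a multiplier \<Rightarrow> 'a multiplier \<Rightarrow> real" where
  "dist_multiplier x y = norm (x - y)"

definition uniformity_multiplier :: "('a multiplier \<times> 'a multiplier) filter" where
  "uniformity_multiplier = (INF e\<in>{0<..}. principal {(x, y). dist x y < e})"

definition open_multiplier :: "'a multiplier set \<Rightarrow> bool" where
  "open_multiplier U \<longleftrightarrow> (\<forall>x\<in>U. eventually (\<lambda>(x', y). x' = x \<longrightarrow> y \<in> U) uniformity)"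

instance
proof
  fix a b :: "'a multiplier" and r :: real
  show "norm a = 0 \<longleftrightarrow> a = 0" by transfer simp
  show "norm (a + b) \<le> norm a + norm b" by transfer (rule norm_triangle_ineq)
  show "norm (r *\<^sub>R a) = \<bar>r\<bar> * norm a" by transfer simp
qed (rule dist_multiplier_def sgn_multiplier_def uniformity_multiplier_def open_multiplier_def)+

end

lemma dist_Rep_multiplier: "dist (Rep_multiplier x) (Rep_multiplier y) = dist x y"
  unfolding dist_norm by transfer simp

instance multiplier :: (cstar_algebra) banach
proof
  fix X :: "nat \<Rightarrow> 'a multiplier" assume "Cauchy X"
  then have "Cauchy (\<lambda>n. Rep_multiplier (X n))" by (simp add: Cauchy_def dist_Rep_multiplier)
  then obtain L where L: "(\<lambda>n. Rep_multiplier (X n)) \<longlonglongrightarrow> L"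
    using Cauchy_convergent convergent_def by blast
  have "L \<in> {T. \<exists>S. mult_adjoint T S}"
    using Rep_multiplier by (rule closed_sequentially[OF closed_adjointable _ L])
  then obtain l where "L = Rep_multiplier l" by (metis Rep_multiplier_cases)
  with L have "X \<longlonglongrightarrow> l" by (simp add: lim_sequentially dist_Rep_multiplier)
  then show "convergent X" by (rule convergentI)
qed

instantiation multiplier :: (cstar_algebra) complex_banach
begin

lift_definition scaleC_multiplier :: "complex \<Rightarrow> 'a multiplier \<Rightarrow> 'a multiplier" is
  "\<lambda>c T. scaleC_blinfun c o\<^sub>L T"
  using mult_adjoint_scaleC_blinfun mult_adjoint_compose by blast

instance
proof
  fix c d :: complex and x y :: "'a multiplier" and r :: real
  show "scaleC c (x + y) = scaleC c x + scaleC c y"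
    by transfer (auto intro!: blinfun_eqI simp: blinfun.add_left scaleC_add_right)
  show "scaleC (c + d) x = scaleC c x + scaleC d x"
    by transfer (auto intro!: blinfun_eqI simp: blinfun.add_left scaleC_add_left)
  show "scaleC c (scaleC d x) = scaleC (c * d) x"
    by transfer (auto intro!: blinfun_eqI simp: scaleC_scaleC)
  show "scaleC 1 x = x"
    by transfer (auto intro!: blinfun_eqI simp: scaleC_one)
  show "r *\<^sub>R x = scaleC (complex_of_real r) x"
    by transfer (auto intro!: blinfun_eqI simp: blinfun.scaleR_left scaleC_of_real)
  show "norm (scaleC c x) = cmod c * norm x"
  proof transfer
    fix c :: complex and T :: "'a \<Rightarrow>\<^sub>L 'a"
    have le: "norm (scaleC_blinfun c o\<^sub>L T) \<le> cmod c * norm T" for c and T :: "'a \<Rightarrow>\<^sub>L 'a"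
      by (rule norm_blinfun_bound) (auto simp: norm_scaleC mult_left_mono mult.assoc norm_blinfun)
    show "norm (scaleC_blinfun c o\<^sub>L T) = cmod c * norm T"
    proof (cases "c = 0")
      case True
      then have "scaleC_blinfun c o\<^sub>L T = 0" by (intro blinfun_eqI) simp
      then show ?thesis using True by simp
    next
      case False
      have "scaleC_blinfun (1 / c) o\<^sub>L (scaleC_blinfun c o\<^sub>L T) = T"
        using False by (intro blinfun_eqI) (simp add: scaleC_scaleC scaleC_one)
      then have "norm T \<le> cmod (1 / c) * norm (scaleC_blinfun c o\<^sub>L T)"
        using le[of "1 / c" "scaleC_blinfun c o\<^sub>L T"] by simp
      then show ?thesis using le[of c T] False by (simp add: norm_divide field_simps)
    qed
  qed
qed

end

instantiation multiplier :: (cstar_algebra) cstar_algebra_1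
begin

lift_definition times_multiplier :: "'a multiplier \<Rightarrow> 'a multiplier \<Rightarrow> 'a multiplier" is "(o\<^sub>L)"
  using mult_adjoint_compose by blast

lift_definition one_multiplier :: "'a multiplier" is id_blinfun
  using mult_adjoint_id by blast

lift_definition star_multiplier :: "'a multiplier \<Rightarrow> 'a multiplier" is blinfun_adjoint
  using mult_adjoint_sym mult_adjoint_blinfun_adjoint by blast

instance
proof
  fix a b c :: "'a multiplier" and r :: real and z :: complex
  show "a * b * c = a * (b * c)" by transfer (auto intro!: blinfun_eqI)
  show "(a + b) * c = a * c + b * c" by transfer (auto intro!: blinfun_eqI simp: blinfun.add_left)
  show "a * (b + c) = a * b + a * c"
    by transfer (auto intro!: blinfun_eqI simp: blinfun.add_left blinfun.add_right)
  show "r *\<^sub>R a * b = r *\<^sub>R (a * b)" by transfer (auto intro!: blinfun_eqI simp: blinfun.scaleR_left)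
  show "a * r *\<^sub>R b = r *\<^sub>R (a * b)"
    by transfer (auto intro!: blinfun_eqI simp: blinfun.scaleR_left blinfun.scaleR_right)
  show "norm (a * b) \<le> norm a * norm b" by transfer (rule norm_blinfun_compose)
  show "scaleC z a * b = scaleC z (a * b)" by transfer (auto intro!: blinfun_eqI)
  show "a * scaleC z b = scaleC z (a * b)"
    by transfer (auto intro!: blinfun_eqI simp: mult_adjoint_scaleC)
  show "star (star a) = a"
    by transfer (metis blinfun_adjoint_eq mult_adjoint_sym)
  show "star (a + b) = star a + star b"
    by transfer (metis blinfun_adjoint_eq mult_adjoint_add)
  show "star (scaleC z a) = scaleC (cnj z) (star a)"
  proof transfer
    fix z and T :: "'a \<Rightarrow>\<^sub>L 'a" assume "\<exists>S. mult_adjoint T S"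
    then obtain S where S: "mult_adjoint T S" by blast
    have "S o\<^sub>L scaleC_blinfun (cnj z) = scaleC_blinfun (cnj z) o\<^sub>L S"
      by (intro blinfun_eqI) (simp add: mult_adjoint_scaleC[OF mult_adjoint_sym[OF S]])
    then show "blinfun_adjoint (scaleC_blinfun z o\<^sub>L T) = scaleC_blinfun (cnj z) o\<^sub>L blinfun_adjoint T"
      using blinfun_adjoint_eq[OF mult_adjoint_compose[OF mult_adjoint_scaleC_blinfun[of z] S]]
        blinfun_adjoint_eq[OF S] by simp
  qed
  show "star (a * b) = star b * star a"
    by transfer (metis blinfun_adjoint_eq mult_adjoint_compose)
  show "norm (star a * a) = (norm a)\<^sup>2"
  proof transfer
    fix T :: "'a \<Rightarrow>\<^sub>L 'a" assume "\<exists>S. mult_adjoint T S"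
    then obtain S where S: "mult_adjoint T S" by blast
    have "norm (S o\<^sub>L T) \<le> (norm T)\<^sup>2"
      using norm_blinfun_compose[of S T] norm_mult_adjoint[OF S] by (simp add: power2_eq_square)
    then show "norm (blinfun_adjoint T o\<^sub>L T) = (norm T)\<^sup>2"
      using norm_mult_adjoint_le[OF S] blinfun_adjoint_eq[OF S] by simp
  qed
  show "1 * a = a" by transfer (auto intro!: blinfun_eqI)
  show "a * 1 = a" by transfer (auto intro!: blinfun_eqI)
qed

end

lift_definition multiplier_of :: "'a::cstar_algebra \<Rightarrow> 'a multiplier" is mult_left_blinfun
  using mult_adjoint_mult_left by blast

lemma multiplier_of_add: "multiplier_of (a + b) = multiplier_of a + multiplier_of b"
  by transfer (auto intro!: blinfun_eqI simp: blinfun.add_left distrib_right)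

lemma multiplier_of_diff: "multiplier_of (a - b) = multiplier_of a - multiplier_of b"
  by transfer (auto intro!: blinfun_eqI simp: blinfun.diff_left left_diff_distrib)

lemma multiplier_of_scaleR: "multiplier_of (r *\<^sub>R a) = r *\<^sub>R multiplier_of a"
  by transfer (auto intro!: blinfun_eqI simp: blinfun.scaleR_left)

lemma multiplier_of_mult: "multiplier_of (a * b) = multiplier_of a * multiplier_of b"
  by transfer (auto intro!: blinfun_eqI simp: mult.assoc)

lemma multiplier_of_star: "multiplier_of (star a) = star (multiplier_of a)"
  by transfer (simp add: blinfun_adjoint_eq[OF mult_adjoint_mult_left])

lemma norm_multiplier_of: "norm (multiplier_of a) = norm a"
  by transfer (rule norm_mult_left_blinfun)


section \<open>Positivity in a C*-algebra without unit\<close>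

text \<open>Membership is tested in the multiplier algebra, where \<open>1\<close> is available.
  Unlike the form \<open>star b * b\<close>, it is visibly stable under sums, and it covers all
  elements of that form.\<close>

definition pos_cone :: "'a::cstar_algebra set" where
  "pos_cone = {a. pos_elem (multiplier_of a)}"

lemma pos_cone_star_mult [simp]: "star b * b \<in> pos_cone"
  by (simp add: pos_cone_def multiplier_of_mult multiplier_of_star pos_elem_star_mult)

lemma pos_cone_zero [simp]: "0 \<in> pos_cone"
  using pos_cone_star_mult[of 0] by simp

lemma pos_cone_add: "a \<in> pos_cone \<Longrightarrow> b \<in> pos_cone \<Longrightarrow> a + b \<in> pos_cone"
  by (simp add: pos_cone_def multiplier_of_add pos_elem_add)

lemma pos_cone_scaleR: "a \<in> pos_cone \<Longrightarrow> 0 \<le> r \<Longrightarrow> r *\<^sub>R a \<in> pos_cone"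
  by (simp add: pos_cone_def multiplier_of_scaleR pos_elem_scaleR)

lemma norm_le_norm_add_pos_cone:
  assumes "a \<in> pos_cone" "b \<in> pos_cone"
  shows "norm a \<le> norm (a + b)"
  using pos_elem_norm_mono[of "multiplier_of a" "multiplier_of b"] assms
  by (simp add: pos_cone_def norm_multiplier_of flip: multiplier_of_add)

text \<open>\<open>s - k\<close> has norm at most \<open>s\<close> as a multiplier, although it need
  not lie in the algebra.\<close>

lemma norm_scaleR_diff_mult_le:
  assumes k: "k \<in> pos_cone" "norm k \<le> s"
  shows "norm (s *\<^sub>R m - k * m) \<le> s * norm m"
proof -
  have "norm (s *\<^sub>R m - k * m) = norm (multiplier_of (s *\<^sub>R m - k * m))"
    by (simp only: norm_multiplier_of)
  also have "\<dots> = norm ((s *\<^sub>R 1 - multiplier_of k) * multiplier_of m)"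
    by (simp add: left_diff_distrib multiplier_of_diff multiplier_of_scaleR multiplier_of_mult)
  also have "\<dots> \<le> norm (s *\<^sub>R 1 - multiplier_of k) * norm (multiplier_of m)"
    by (rule norm_mult_ineq)
  also have "\<dots> \<le> s * norm m"
    using pos_elem_norm[of "multiplier_of k" s] k
    by (auto simp: norm_multiplier_of pos_cone_def intro: mult_right_mono)
  finally show ?thesis .
qed

text \<open>\<open>m\<close> stands for \<open>(\<epsilon> + k)\<^sup>-\<^sup>1 c\<close>. With
  \<open>t = norm k + \<epsilon>\<close> it is the fixed point of
  \<open>m \<mapsto> ((norm k - k) m + c) / t\<close>, a contraction with factor
  \<open>norm k / t < 1\<close>.\<close>

lemma solve_eps_plus_pos:
  fixes k c :: "'a::cstar_algebra"
  assumes k: "k \<in> pos_cone" and "0 < \<epsilon>"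
  obtains m where "\<epsilon> *\<^sub>R m + k * m = c"
proof -
  define s where "s = norm k"
  define t where "t = s + \<epsilon>"
  have s: "0 \<le> s" "s < t" "0 < t" using \<open>0 < \<epsilon>\<close> by (auto simp: s_def t_def add_nonneg_pos)
  define f where "f m = (1/t) *\<^sub>R (s *\<^sub>R m - k * m + c)" for m
  have "dist (f x) (f y) \<le> (s / t) * dist x y" for x y
  proof -
    have "f x - f y = (1/t) *\<^sub>R (s *\<^sub>R (x - y) - k * (x - y))"
      by (simp add: f_def algebra_simps)
    then have "dist (f x) (f y) = (1/t) * norm (s *\<^sub>R (x - y) - k * (x - y))"
      using s by (simp add: dist_norm)
    also have "\<dots> \<le> (1/t) * (s * norm (x - y))"
      using s k by (intro mult_left_mono norm_scaleR_diff_mult_le) (auto simp: s_def)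
    finally show ?thesis by (simp add: dist_norm)
  qed
  then obtain m where "f m = m"
    using banach_fix_type[of "s / t" f] s by auto
  then have "t *\<^sub>R m = t *\<^sub>R f m" by simp
  also have "\<dots> = s *\<^sub>R m - k * m + c" using s by (simp add: f_def)
  finally have "\<epsilon> *\<^sub>R m + k * m = c" by (simp add: t_def algebra_simps)
  then show ?thesis by (rule that)
qed

text \<open>The solution is \<open>m = k (\<epsilon> + k)\<^sup>-\<^sup>1\<close>, for which \<open>(1 - m)\<^sup>* k (1 - m) = \<epsilon> (m - m\<^sup>2)\<close>.\<close>

lemma approximate_unit_pos:
  fixes k :: "'a::cstar_algebra"
  assumes k: "k = star b * b" and "0 < \<epsilon>"
  obtains m where "norm (k - k * m - star m * k + star m * k * m) \<le> 2 * \<epsilon>"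
proof -
  have "k \<in> pos_cone" by (simp add: k)
  from this \<open>0 < \<epsilon>\<close> obtain m where m: "\<epsilon> *\<^sub>R m + k * m = k" by (rule solve_eps_plus_pos)
  have sk: "star k = k" by (simp add: k star_simps)
  \<comment> \<open>\<open>v = (1 - m) y\<close> solves
    \<open>(\<epsilon> + k) v = \<epsilon> y\<close>. The adjoint of this equation times the
    equation exhibits the inner square of \<open>\<epsilon> y\<close> as that of
    \<open>\<epsilon> v\<close> plus a positive \<open>r\<close>.\<close>
  have contr: "norm (y - m * y) \<le> norm y" for y
  proof -
    define v where "v = y - m * y"
    have "\<epsilon> *\<^sub>R v + k * v = \<epsilon> *\<^sub>R y + k * y - (\<epsilon> *\<^sub>R m + k * m) * y"
      by (simp add: v_def algebra_simps)
    then have v: "\<epsilon> *\<^sub>R v + k * v = \<epsilon> *\<^sub>R y" by (simp add: m)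
    define r where "r = (2 * \<epsilon>) *\<^sub>R (star (b * v) * (b * v)) + star (k * v) * (k * v)"
    have "star (\<epsilon> *\<^sub>R y) * (\<epsilon> *\<^sub>R y) = star (\<epsilon> *\<^sub>R v) * (\<epsilon> *\<^sub>R v) + r"
      unfolding r_def v[symmetric]
      by (simp add: star_simps sk algebra_simps scaleR_2 flip: scaleR_scaleR) (simp add: k mult.assoc)
    moreover have "r \<in> pos_cone"
      unfolding r_def using \<open>0 < \<epsilon>\<close> by (intro pos_cone_add pos_cone_scaleR pos_cone_star_mult) simp
    ultimately have "norm (star (\<epsilon> *\<^sub>R v) * (\<epsilon> *\<^sub>R v)) \<le> norm (star (\<epsilon> *\<^sub>R y) * (\<epsilon> *\<^sub>R y))"
      by (simp only: norm_le_norm_add_pos_cone pos_cone_star_mult)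
    then have "(norm (\<epsilon> *\<^sub>R v))\<^sup>2 \<le> (norm (\<epsilon> *\<^sub>R y))\<^sup>2" by (simp only: cstar_identity)
    then have "norm (\<epsilon> *\<^sub>R v) \<le> norm (\<epsilon> *\<^sub>R y)" by (rule power2_le_imp_le) simp
    then show ?thesis using \<open>0 < \<epsilon>\<close> by (simp add: v_def)
  qed
  define d where "d = k - k * m - star m * k + star m * k * m"
  have km: "k - k * m = \<epsilon> *\<^sub>R m" using m by (simp add: algebra_simps)
  have "d = (k - k * m) - star m * (k - k * m)" by (simp add: d_def algebra_simps)
  then have d: "d = \<epsilon> *\<^sub>R (m - star m * m)" by (simp add: km scaleR_diff_right)
  \<comment> \<open>\<open>d = \<epsilon> (m - star m * m)\<close> and \<open>star m * m\<close> are
    both selfadjoint, hence so is \<open>m\<close>.\<close>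
  have "star d = d" by (simp add: d_def star_simps sk mult.assoc)
  then have sm: "star m = m" using d \<open>0 < \<epsilon>\<close> by (simp add: star_simps)
  \<comment> \<open>\<open>contr\<close> with \<open>y = m\<close> bounds
    \<open>m - m\<^sup>2\<close> by \<open>norm m\<close>; the quadratic inequality that results
    yields \<open>norm m \<le> 2\<close>, the origin of the factor 2 in the statement.\<close>
  have "norm (m * m) \<le> norm m + norm (m - m * m)"
    using norm_triangle_ineq4[of m "m - m * m"] by simp
  also have "\<dots> \<le> 2 * norm m" using contr[of m] by simp
  finally have "norm m * norm m \<le> 2 * norm m"
    using norm_selfadjoint_square[OF sm] by (simp add: power2_eq_square)
  then have "norm m \<le> 2" by (cases "m = 0") auto
  then have "norm (m - m * m) \<le> 2" using contr[of m] by simp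
  then have "norm d \<le> 2 * \<epsilon>" using \<open>0 < \<epsilon>\<close> by (simp add: d sm)
  then show ?thesis unfolding d_def by (rule that)
qed

section \<open>Sublinear functionals\<close>

text \<open>The inequality for scalars is the convenient form for infima; applied to
  \<open>1 / r\<close> as well, it gives equality.\<close>

definition sublinear :: "('a::real_vector \<Rightarrow> real) \<Rightarrow> bool" where
  "sublinear q \<longleftrightarrow> q 0 = 0 \<and> (\<forall>x y. q (x + y) \<le> q x + q y) \<and> (\<forall>r>0. \<forall>x. q (r *\<^sub>R x) \<le> r * q x)"

lemma sublinearI:
  assumes "q 0 = 0" "\<And>x y. q (x + y) \<le> q x + q y" "\<And>r x. 0 < r \<Longrightarrow> q (r *\<^sub>R x) \<le> r * q x"
  shows "sublinear q"
  using assms by (simp add: sublinear_def)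

lemma
  assumes "sublinear q"
  shows sublinear_zero: "q 0 = 0"
    and sublinear_add: "q (x + y) \<le> q x + q y"
  using assms by (auto simp: sublinear_def)

lemma sublinear_scaleR:
  assumes "sublinear q" "0 \<le> r"
  shows "q (r *\<^sub>R x) = r * q x"
proof (cases "r = 0")
  case False
  with assms(2) have r: "0 < r" by simp
  have "q ((1 / r) *\<^sub>R (r *\<^sub>R x)) \<le> (1 / r) * q (r *\<^sub>R x)"
    using assms(1) r unfolding sublinear_def by (metis divide_pos_pos zero_less_one)
  then have "r * q x \<le> q (r *\<^sub>R x)" using r by (simp add: field_simps)
  moreover have "q (r *\<^sub>R x) \<le> r * q x" using assms(1) r by (simp add: sublinear_def)
  ultimately show ?thesis by simp
qed (use assms in \<open>simp add: sublinear_zero\<close>)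

lemma sublinear_ge_minus: "sublinear q \<Longrightarrow> - q (- x) \<le> q x"
  using sublinear_add[of q x "- x"] sublinear_zero[of q] by simp

text \<open>A sublinear functional that is minimal for the pointwise order is linear.\<close>

theorem sublinear_dominates_linear:
  fixes p :: "'a::real_vector \<Rightarrow> real"
  assumes p: "sublinear p"
  obtains f where "linear f" "\<And>x. f x \<le> p x"
proof -
  define A where "A = {q. sublinear q \<and> q \<le> p}"
  \<comment> \<open>Zorn's lemma yields maximal elements, so the order is reversed; upper bounds of
    chains are then pointwise infima.\<close>
  define R :: "('a \<Rightarrow> real) \<Rightarrow> ('a \<Rightarrow> real) \<Rightarrow> bool" where "R = (\<lambda>q q'. q' \<le> q)"
  \<comment> \<open>This bounds all members of \<open>A\<close> from below at once, so that the real
    infima exist.\<close>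
  have lower: "- p (- x) \<le> q x" if "q \<in> A" for q x
    using that sublinear_ge_minus[of q x] le_funD[of q p "- x"] by (force simp: A_def)
  have "\<exists>m\<in>A. \<forall>a\<in>A. R m a \<longrightarrow> a = m"
  proof (rule predicate_Zorn)
    show "partial_order_on A (relation_of R A)"
      by (rule partial_order_on_relation_ofI) (auto simp: R_def)
    fix C assume C: "C \<in> Chains (relation_of R A)"
    have CA: "C \<subseteq> A" and chain: "\<And>q q'. q \<in> C \<Longrightarrow> q' \<in> C \<Longrightarrow> q \<le> q' \<or> q' \<le> q"
      using C by (auto simp: Chains_def relation_of_def R_def)
    show "\<exists>u\<in>A. \<forall>q\<in>C. R q u"
    proof (cases "C = {}")
      case True
      then show ?thesis using p by (auto simp: A_def)
    next
      case False
      define u where "u x = (INF q\<in>C. q x)" for x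
      have bdd: "bdd_below ((\<lambda>q. q x) ` C)" for x
        using CA lower by (intro bdd_belowI[of _ "- p (- x)"]) auto
      have le: "u x \<le> q x" if "q \<in> C" for q x
        unfolding u_def using bdd that by (rule cINF_lower)
      have ge: "c \<le> u x" if "\<And>q. q \<in> C \<Longrightarrow> c \<le> q x" for c x
        unfolding u_def using False that by (rule cINF_greatest)
      have sub: "sublinear q" if "q \<in> C" for q using CA that by (auto simp: A_def)
      have "sublinear u"
      proof (rule sublinearI)
        have "u 0 = (INF q\<in>C. 0)"
          unfolding u_def by (rule INF_cong) (auto simp: sub sublinear_zero)
        then show "u 0 = 0" using False by simp
      next
        fix x y
        \<comment> \<open>In a chain, \<open>q\<close> and \<open>q'\<close> may be replaced by the
          smaller of them, which is subadditive.\<close>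
        have "u (x + y) \<le> q x + q' y" if qq: "q \<in> C" "q' \<in> C" for q q'
        proof -
          obtain r where r: "r \<in> C" "r \<le> q" "r \<le> q'" using chain[OF qq] qq by auto
          have "u (x + y) \<le> r x + r y"
            using le[OF r(1)] sublinear_add[OF sub[OF r(1)]] by (rule order_trans)
          then show ?thesis using le_funD[OF r(2), of x] le_funD[OF r(3), of y] by linarith
        qed
        then have "u (x + y) - q' y \<le> u x" if "q' \<in> C" for q'
          using that by (intro ge) (simp add: algebra_simps)
        then have "u (x + y) - u x \<le> u y"
          by (intro ge) (simp add: algebra_simps)
        then show "u (x + y) \<le> u x + u y" by simp
      next
        fix r :: real and x assume r: "0 < r"
        have "(1 / r) * u (r *\<^sub>R x) \<le> u x"
        proof (rule ge)
          fix q assume q: "q \<in> C"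
          have "u (r *\<^sub>R x) \<le> r * q x"
            using le[OF q, of "r *\<^sub>R x"] sublinear_scaleR[OF sub[OF q], of r x] r by simp
          then show "(1 / r) * u (r *\<^sub>R x) \<le> q x" using r by (simp add: field_simps)
        qed
        then show "u (r *\<^sub>R x) \<le> r * u x" using r by (simp add: field_simps)
      qed
      moreover obtain q where q: "q \<in> C" using False by blast
      then have "u \<le> q" "q \<le> p" using le CA by (auto simp: A_def le_fun_def)
      then have "u \<le> p" by (rule order_trans)
      ultimately show ?thesis using le by (auto simp: A_def R_def le_fun_def)
    qed
  qed
  then obtain q where qA: "q \<in> A" and "\<forall>a\<in>A. R q a \<longrightarrow> a = q" ..
  have q: "sublinear q" "q \<le> p" using qA by (simp_all add: A_def)
  have min: "q' = q" if "sublinear q'" "q' \<le> q" for q'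
    using \<open>\<forall>a\<in>A. R q a \<longrightarrow> a = q\<close> that order_trans[OF that(2) q(2)] by (simp add: A_def R_def)
  have super: "q x + q v \<le> q (x + v)" for x v
  proof -
    \<comment> \<open>\<open>w\<close> is sublinear and lies below \<open>q\<close> by the choice
      \<open>t = 0\<close>, so it equals \<open>q\<close> by minimality; \<open>t = 1\<close> then
      gives superadditivity.\<close>
    define w where "w x = (INF t\<in>{0::real..}. q (x + t *\<^sub>R v) - t * q v)" for x
    have lower: "- q (- x) \<le> q (x + t *\<^sub>R v) - t * q v" if "0 \<le> t" for t x
      using sublinear_add[OF q(1), of "x + t *\<^sub>R v" "- x"] sublinear_scaleR[OF q(1) that, of v] by simp
    have bdd: "bdd_below ((\<lambda>t. q (x + t *\<^sub>R v) - t * q v) ` {0..})" for x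
      using lower by (intro bdd_belowI[of _ "- q (- x)"]) auto
    have le: "w x \<le> q (x + t *\<^sub>R v) - t * q v" if "0 \<le> t" for t x
      unfolding w_def using bdd that by (intro cINF_lower) auto
    have ge: "c \<le> w x" if "\<And>t. 0 \<le> t \<Longrightarrow> c \<le> q (x + t *\<^sub>R v) - t * q v" for c x
      unfolding w_def using that by (intro cINF_greatest) auto
    have "sublinear w"
    proof (rule sublinearI)
      show "w 0 = 0"
        using le[of 0 0] ge[of 0 0] sublinear_zero[OF q(1)] sublinear_scaleR[OF q(1), of _ v] by force
    next
      fix x y
      have "w (x + y) \<le> (q (x + s *\<^sub>R v) - s * q v) + (q (y + t *\<^sub>R v) - t * q v)" if "0 \<le> s" "0 \<le> t" for s t
        using le[of "s + t" "x + y"] that sublinear_add[OF q(1), of "x + s *\<^sub>R v" "y + t *\<^sub>R v"]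
        by (simp add: algebra_simps)
      then have "w (x + y) - (q (y + t *\<^sub>R v) - t * q v) \<le> w x" if "0 \<le> t" for t
        using that by (intro ge) (simp add: algebra_simps)
      then have "w (x + y) - w x \<le> w y"
        by (intro ge) (simp add: algebra_simps)
      then show "w (x + y) \<le> w x + w y" by simp
    next
      fix r :: real and x assume r: "0 < r"
      have "(1 / r) * w (r *\<^sub>R x) \<le> w x"
      proof (rule ge)
        fix t :: real assume t: "0 \<le> t"
        have "w (r *\<^sub>R x) \<le> q (r *\<^sub>R (x + t *\<^sub>R v)) - (r * t) * q v"
          using le[of "r * t" "r *\<^sub>R x"] r t by (simp add: scaleR_right_distrib)
        also have "\<dots> = r * (q (x + t *\<^sub>R v) - t * q v)"
          using r sublinear_scaleR[OF q(1), of r "x + t *\<^sub>R v"] by (simp add: right_diff_distrib)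
        finally show "(1 / r) * w (r *\<^sub>R x) \<le> q (x + t *\<^sub>R v) - t * q v"
          using r by (simp add: field_simps)
      qed
      then show "w (r *\<^sub>R x) \<le> r * w x" using r by (simp add: field_simps)
    qed
    moreover have "w \<le> q" using le[of 0] by (simp add: le_fun_def)
    ultimately have "w = q" by (rule min)
    then show ?thesis using le[of 1 x] by simp
  qed
  then have add: "q (x + y) = q x + q y" for x y
    using sublinear_add[OF q(1)] by (intro antisym) auto
  have neg: "q (- x) = - q x" for x
    using add[of x "- x"] sublinear_zero[OF q(1)] by simp
  have "q (r *\<^sub>R x) = r * q x" for r x
    using sublinear_scaleR[OF q(1), of r x] sublinear_scaleR[OF q(1), of "- r" x] neg[of "r *\<^sub>R x"]
    by (cases "0 \<le> r") auto
  then have "linear q" by (intro linearI) (auto simp: add)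
  then show ?thesis using q(2) by (auto simp: le_fun_def intro: that)
qed

text \<open>A pair in \<open>K\<close> is an element with the value demanded of \<open>f\<close>
  there. The infimum \<open>p\<close> of \<open>norm (a + k) - \<mu>\<close> is finite by
  \<open>bound\<close>, and a linear \<open>f \<le> p\<close> satisfies
  \<open>f (- k) \<le> - \<mu>\<close>.\<close>

corollary linear_functional_above_cone:
  fixes K :: "('a::real_normed_vector \<times> real) set"
  assumes zero: "(0, 0) \<in> K"
    and add: "\<And>k \<mu> l \<nu>. (k, \<mu>) \<in> K \<Longrightarrow> (l, \<nu>) \<in> K \<Longrightarrow> (k + l, \<mu> + \<nu>) \<in> K"
    and scale: "\<And>k \<mu> r. (k, \<mu>) \<in> K \<Longrightarrow> 0 < r \<Longrightarrow> (r *\<^sub>R k, r * \<mu>) \<in> K"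
    and bound: "\<And>k \<mu>. (k, \<mu>) \<in> K \<Longrightarrow> \<mu> \<le> norm k"
  obtains f where "linear f" "\<And>k \<mu>. (k, \<mu>) \<in> K \<Longrightarrow> \<mu> \<le> f k"
proof -
  define p where "p a = (INF z\<in>K. norm (a + fst z) - snd z)" for a
  have lower: "- norm a \<le> norm (a + k) - \<mu>" if "(k, \<mu>) \<in> K" for a k \<mu>
    using bound[OF that] norm_triangle_ineq4[of "a + k" a] by simp
  have bdd: "bdd_below ((\<lambda>z. norm (a + fst z) - snd z) ` K)" for a
    using lower by (intro bdd_belowI[of _ "- norm a"]) auto
  have le: "p a \<le> norm (a + k) - \<mu>" if "(k, \<mu>) \<in> K" for a k \<mu>
    unfolding p_def using cINF_lower[OF bdd that] by simp
  have ge: "c \<le> p a" if "\<And>k \<mu>. (k, \<mu>) \<in> K \<Longrightarrow> c \<le> norm (a + k) - \<mu>" for c a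
    unfolding p_def using zero that by (intro cINF_greatest) auto
  have "sublinear p"
  proof (rule sublinearI)
    show "p 0 = 0" using le[OF zero, of 0] ge[of 0 0] bound by force
  next
    fix a b
    have sum: "p (a + b) \<le> (norm (a + k) - \<mu>) + (norm (b + l) - \<nu>)" if "(k, \<mu>) \<in> K" "(l, \<nu>) \<in> K" for k \<mu> l \<nu>
      using le[OF add[OF that], of "a + b"] norm_triangle_ineq[of "a + k" "b + l"] by (simp add: algebra_simps)
    have "p (a + b) - (norm (b + l) - \<nu>) \<le> p a" if "(l, \<nu>) \<in> K" for l \<nu>
      using sum[OF _ that] by (intro ge) (simp add: diff_le_eq)
    then have "p (a + b) - p a \<le> p b"
      by (intro ge) (simp add: diff_le_eq add.commute)
    then show "p (a + b) \<le> p a + p b" by simp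
  next
    fix r :: real and a assume r: "0 < r"
    have "(1 / r) * p (r *\<^sub>R a) \<le> p a"
    proof (rule ge)
      fix k \<mu> assume "(k, \<mu>) \<in> K"
      then have "p (r *\<^sub>R a) \<le> norm (r *\<^sub>R (a + k)) - r * \<mu>"
        using le[OF scale[OF _ r], of k \<mu> "r *\<^sub>R a"] by (simp add: scaleR_right_distrib)
      also have "\<dots> = r * (norm (a + k) - \<mu>)" using r by (simp add: right_diff_distrib)
      finally show "(1 / r) * p (r *\<^sub>R a) \<le> norm (a + k) - \<mu>" using r by (simp add: field_simps)
    qed
    then show "p (r *\<^sub>R a) \<le> r * p a" using r by (simp add: field_simps)
  qed
  then obtain f where f: "linear f" "\<And>x. f x \<le> p x" by (rule sublinear_dominates_linear) blast
  have "\<mu> \<le> f k" if "(k, \<mu>) \<in> K" for k \<mu>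
    using f(2)[of "- k"] le[OF that, of "- k"] linear_neg[OF f(1), of k] by simp
  with f(1) show ?thesis by (rule that)
qed

section \<open>Completions of semi-inner product spaces\<close>

text \<open>\<open>hilbert_space\<close> without definiteness and completeness, to cover the
  balanced tensor product and the form \<open>F (star a * b)\<close> on an algebra.\<close>

locale pre_hilbert =
  fixes V :: "'v ip_space"
  assumes plus_closed [simp]: "\<lbrakk>u \<in> hcarrier V; v \<in> hcarrier V\<rbrakk> \<Longrightarrow> hplus V u v \<in> hcarrier V"
    and zero_closed [simp]: "hzero V \<in> hcarrier V"
    and scale_closed [simp]: "u \<in> hcarrier V \<Longrightarrow> hscale V c u \<in> hcarrier V"
    and plus_assoc: "\<lbrakk>u \<in> hcarrier V; v \<in> hcarrier V; w \<in> hcarrier V\<rbrakk>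
          \<Longrightarrow> hplus V (hplus V u v) w = hplus V u (hplus V v w)"
    and plus_commute: "\<lbrakk>u \<in> hcarrier V; v \<in> hcarrier V\<rbrakk> \<Longrightarrow> hplus V u v = hplus V v u"
    and plus_zero: "u \<in> hcarrier V \<Longrightarrow> hplus V (hzero V) u = u"
    and plus_minus: "u \<in> hcarrier V \<Longrightarrow> hplus V u (hscale V (- 1) u) = hzero V"
    and scale_plus: "\<lbrakk>u \<in> hcarrier V; v \<in> hcarrier V\<rbrakk>
          \<Longrightarrow> hscale V c (hplus V u v) = hplus V (hscale V c u) (hscale V c v)"
    and scale_add: "u \<in> hcarrier V \<Longrightarrow> hscale V (c + d) u = hplus V (hscale V c u) (hscale V d u)"
    and scale_scale: "u \<in> hcarrier V \<Longrightarrow> hscale V c (hscale V d u) = hscale V (c * d) u"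
    and scale_one: "u \<in> hcarrier V \<Longrightarrow> hscale V 1 u = u"
    and inner_plus: "\<lbrakk>u \<in> hcarrier V; v \<in> hcarrier V; w \<in> hcarrier V\<rbrakk>
          \<Longrightarrow> hinner V u (hplus V v w) = hinner V u v + hinner V u w"
    and inner_scale: "\<lbrakk>u \<in> hcarrier V; v \<in> hcarrier V\<rbrakk>
          \<Longrightarrow> hinner V u (hscale V c v) = c * hinner V u v"
    and inner_cnj: "\<lbrakk>u \<in> hcarrier V; v \<in> hcarrier V\<rbrakk> \<Longrightarrow> hinner V v u = cnj (hinner V u v)"
    and inner_nonneg: "u \<in> hcarrier V \<Longrightarrow> Re (hinner V u u) \<ge> 0"
begin

section \<open>Norm and distance of a semi-inner product\<close>

definition hnorm :: "'v \<Rightarrow> real" where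
  "hnorm u = sqrt (Re (hinner V u u))"

abbreviation hdiff :: "'v \<Rightarrow> 'v \<Rightarrow> 'v" where
  "hdiff u v \<equiv> hplus V u (hscale V (- 1) v)"

lemma hdist_hnorm: "hdist V u v = hnorm (hdiff u v)"
  by (simp add: hdist_def hnorm_def Let_def)

lemma inner_plus_left:
  assumes "u \<in> hcarrier V" "v \<in> hcarrier V" "w \<in> hcarrier V"
  shows "hinner V (hplus V v w) u = hinner V v u + hinner V w u"
proof -
  have "hinner V (hplus V v w) u = cnj (hinner V u (hplus V v w))"
    using assms by (intro inner_cnj) auto
  also have "\<dots> = cnj (hinner V u v) + cnj (hinner V u w)"
    using assms by (simp add: inner_plus)
  also have "\<dots> = hinner V v u + hinner V w u"
    using inner_cnj[OF assms(1,2)] inner_cnj[OF assms(1,3)] by simp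
  finally show ?thesis .
qed

lemma inner_scale_left:
  assumes "u \<in> hcarrier V" "v \<in> hcarrier V"
  shows "hinner V (hscale V c v) u = cnj c * hinner V v u"
proof -
  have "hinner V (hscale V c v) u = cnj (hinner V u (hscale V c v))"
    using assms by (intro inner_cnj) auto
  then show ?thesis using assms inner_cnj[OF assms] by (simp add: inner_scale)
qed

lemma inner_zero_right [simp]: "u \<in> hcarrier V \<Longrightarrow> hinner V u (hzero V) = 0"
  using inner_plus[of u u "hscale V (-1) u"] by (simp add: plus_minus inner_scale)

lemma inner_zero_left [simp]: "u \<in> hcarrier V \<Longrightarrow> hinner V (hzero V) u = 0"
  using inner_cnj[of u "hzero V"] by simp

lemmas inner_simps = inner_plus inner_plus_left inner_scale inner_scale_left

lemma Re_inner_commute: "\<lbrakk>u \<in> hcarrier V; v \<in> hcarrier V\<rbrakk> \<Longrightarrow> Re (hinner V v u) = Re (hinner V u v)"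
  using inner_cnj[of u v] by simp

lemma hnorm_ge_zero [simp]: "u \<in> hcarrier V \<Longrightarrow> 0 \<le> hnorm u"
  by (simp add: hnorm_def inner_nonneg)

lemma hnorm_square: "u \<in> hcarrier V \<Longrightarrow> (hnorm u)\<^sup>2 = Re (hinner V u u)"
  by (simp add: hnorm_def inner_nonneg)

lemma hnorm_zero [simp]: "hnorm (hzero V) = 0"
  by (simp add: hnorm_def)

lemma inner_self: "u \<in> hcarrier V \<Longrightarrow> hinner V u u = complex_of_real ((hnorm u)\<^sup>2)"
  using inner_cnj[of u u] by (simp add: hnorm_square complex_eq_iff)

lemma hnorm_scale: "u \<in> hcarrier V \<Longrightarrow> hnorm (hscale V c u) = cmod c * hnorm u"
proof -
  assume u: "u \<in> hcarrier V"
  have "hinner V (hscale V c u) (hscale V c u) = (cnj c * c) * hinner V u u"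
    using u by (simp add: inner_simps)
  also have "\<dots> = complex_of_real ((cmod c)\<^sup>2 * (hnorm u)\<^sup>2)"
    using u by (simp add: inner_self mult.commute[of "cnj c"] complex_norm_square[symmetric] del: complex_norm_square)
  finally have "hnorm (hscale V c u) = sqrt ((cmod c)\<^sup>2 * (hnorm u)\<^sup>2)"
    by (simp add: hnorm_def)
  then show ?thesis using u by (simp add: real_sqrt_mult)
qed

lemma cauchy_schwarz:
  assumes u: "u \<in> hcarrier V" and v: "v \<in> hcarrier V"
  shows "cmod (hinner V u v) \<le> hnorm u * hnorm v"
proof -
  define z where "z = hinner V u v"
  define A where "A = (hnorm u)\<^sup>2"
  define B where "B = (hnorm v)\<^sup>2"
  have vu: "hinner V v u = cnj z" unfolding z_def using u v by (rule inner_cnj)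
  \<comment> \<open>The quadratic is the square norm of \<open>t z u - v\<close>; for
    \<open>0 < A\<close> and \<open>z\<close> nonzero its minimum is at
    \<open>t = 1 / A\<close>.\<close>
  have quad: "0 \<le> t\<^sup>2 * (cmod z)\<^sup>2 * A - 2 * t * (cmod z)\<^sup>2 + B" for t
  proof -
    define w where "w = hplus V (hscale V (complex_of_real t * z) u) (hscale V (- 1) v)"
    have "hinner V w w = (t * t * (z * cnj z)) * hinner V u u - 2 * t * (z * cnj z) + hinner V v v"
      using u v vu by (simp add: w_def inner_simps z_def[symmetric]) (simp add: algebra_simps)
    also have "\<dots> = complex_of_real (t\<^sup>2 * (cmod z)\<^sup>2 * A - 2 * t * (cmod z)\<^sup>2 + B)"
      using u v by (simp add: inner_self A_def B_def complex_norm_square[symmetric] power2_eq_square[of t] del: complex_norm_square)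
    finally have "Re (hinner V w w) = t\<^sup>2 * (cmod z)\<^sup>2 * A - 2 * t * (cmod z)\<^sup>2 + B"
      by simp
    moreover have "w \<in> hcarrier V" using u v by (simp add: w_def)
    ultimately show ?thesis using inner_nonneg[of w] by simp
  qed
  have "(cmod z)\<^sup>2 \<le> A * B"
  proof (cases "A = 0")
    case True
    have "(cmod z)\<^sup>2 = 0"
    proof (rule ccontr)
      assume z: "(cmod z)\<^sup>2 \<noteq> 0"
      \<comment> \<open>For \<open>A = 0\<close> the expression is affine in \<open>t\<close>; this
        \<open>t\<close> gives it the value -1.\<close>
      show False using quad[of "(B + 1) / (2 * (cmod z)\<^sup>2)"] z by (simp add: True)
    qed
    then show ?thesis using True by simp
  next
    case False
    then have A: "0 < A" by (simp add: A_def)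
    show ?thesis using quad[of "1 / A"] A by (simp add: field_simps power2_eq_square)
  qed
  also have "A * B = (hnorm u * hnorm v)\<^sup>2" by (simp add: A_def B_def power_mult_distrib)
  finally show ?thesis unfolding z_def by (rule power2_le_imp_le) (use u v in simp)
qed

lemma hnorm_triangle:
  assumes u: "u \<in> hcarrier V" and v: "v \<in> hcarrier V"
  shows "hnorm (hplus V u v) \<le> hnorm u + hnorm v"
proof (rule power2_le_imp_le)
  have "(hnorm (hplus V u v))\<^sup>2 = (hnorm u)\<^sup>2 + (hnorm v)\<^sup>2 + 2 * Re (hinner V u v)"
    using u v by (simp add: hnorm_square inner_simps Re_inner_commute)
  also have "Re (hinner V u v) \<le> hnorm u * hnorm v"
    using complex_Re_le_cmod cauchy_schwarz[OF u v] by (rule order_trans)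
  finally show "(hnorm (hplus V u v))\<^sup>2 \<le> (hnorm u + hnorm v)\<^sup>2"
    by (simp add: power2_eq_square algebra_simps)
qed (use u v in simp)

lemma hdist_nonneg [simp]: "\<lbrakk>u \<in> hcarrier V; v \<in> hcarrier V\<rbrakk> \<Longrightarrow> 0 \<le> hdist V u v"
  by (simp add: hdist_hnorm)

lemma hdist_self [simp]: "u \<in> hcarrier V \<Longrightarrow> hdist V u u = 0"
  by (simp add: hdist_hnorm plus_minus)

lemma hdist_commute: "\<lbrakk>u \<in> hcarrier V; v \<in> hcarrier V\<rbrakk> \<Longrightarrow> hdist V u v = hdist V v u"
  by (simp add: hdist_hnorm hnorm_def inner_simps)

lemma hdist_zero [simp]: "u \<in> hcarrier V \<Longrightarrow> hdist V u (hzero V) = hnorm u"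
  by (simp add: hdist_hnorm hnorm_def inner_simps)

lemma hdist_triangle:
  assumes "u \<in> hcarrier V" "v \<in> hcarrier V" "w \<in> hcarrier V"
  shows "hdist V u w \<le> hdist V u v + hdist V v w"
proof -
  \<comment> \<open>The norms agree by expansion of inner products, which spares the vector space
    laws on the carrier.\<close>
  have "hdist V u w = hnorm (hplus V (hdiff u v) (hdiff v w))"
    using assms by (simp add: hdist_hnorm hnorm_def inner_simps)
  also have "\<dots> \<le> hdist V u v + hdist V v w"
    unfolding hdist_hnorm using assms by (intro hnorm_triangle) auto
  finally show ?thesis .
qed

lemma hdist_plus:
  assumes "u \<in> hcarrier V" "v \<in> hcarrier V" "u' \<in> hcarrier V" "v' \<in> hcarrier V"
  shows "hdist V (hplus V u v) (hplus V u' v') \<le> hdist V u u' + hdist V v v'"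
proof -
  have "hdist V (hplus V u v) (hplus V u' v') = hnorm (hplus V (hdiff u u') (hdiff v v'))"
    using assms by (simp add: hdist_hnorm hnorm_def inner_simps algebra_simps)
  also have "\<dots> \<le> hdist V u u' + hdist V v v'"
    unfolding hdist_hnorm using assms by (intro hnorm_triangle) auto
  finally show ?thesis .
qed

lemma hdist_scale:
  assumes "u \<in> hcarrier V" "v \<in> hcarrier V"
  shows "hdist V (hscale V c u) (hscale V c v) = cmod c * hdist V u v"
proof -
  have "hdist V (hscale V c u) (hscale V c v) = hnorm (hscale V c (hdiff u v))"
    using assms by (simp add: hdist_hnorm hnorm_def inner_simps algebra_simps)
  then show ?thesis using assms by (simp add: hnorm_scale hdist_hnorm)
qed

lemma cmod_inner_diff_le:
  assumes "u \<in> hcarrier V" "v \<in> hcarrier V" "u' \<in> hcarrier V" "v' \<in> hcarrier V"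
  shows "cmod (hinner V u v - hinner V u' v') \<le> hdist V u u' * hnorm v + hnorm u' * hdist V v v'"
proof -
  have "hinner V u v - hinner V u' v' = hinner V (hdiff u u') v + hinner V u' (hdiff v v')"
    using assms by (simp add: inner_simps)
  then show ?thesis
    unfolding hdist_hnorm using assms
    by (metis norm_triangle_mono cauchy_schwarz plus_closed scale_closed)
qed

lemma hnorm_le_hdist:
  assumes "u \<in> hcarrier V" "v \<in> hcarrier V"
  shows "hnorm u \<le> hnorm v + hdist V u v"
  using hdist_triangle[of u v "hzero V"] assms by simp


section \<open>Cauchy sequences modulo null sequences\<close>

definition equiv_seq :: "(nat \<Rightarrow> 'v) \<Rightarrow> (nat \<Rightarrow> 'v) \<Rightarrow> bool" where
  "equiv_seq s t \<longleftrightarrow> (\<lambda>n. hdist V (s n) (t n)) \<longlonglongrightarrow> 0"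

abbreviation cc :: "(nat \<Rightarrow> 'v) \<Rightarrow> (nat \<Rightarrow> 'v) set" where
  "cc \<equiv> completion_class V"

abbreviation const_class :: "'v \<Rightarrow> (nat \<Rightarrow> 'v) set" where
  "const_class v \<equiv> completion_class V (\<lambda>_. v)"

lemma hcauchy_carrier [simp]: "hcauchy V s \<Longrightarrow> s n \<in> hcarrier V"
  by (simp add: hcauchy_def)

lemma tendsto_zero_le:
  fixes f g :: "nat \<Rightarrow> real"
  assumes "g \<longlonglongrightarrow> 0" "\<And>n. 0 \<le> f n" "\<And>n. f n \<le> g n"
  shows "f \<longlonglongrightarrow> 0"
  using tendsto_sandwich[of "\<lambda>_. 0" f sequentially g 0] assms by simp

lemma equiv_seq_sym: "hcauchy V s \<Longrightarrow> hcauchy V t \<Longrightarrow> equiv_seq s t \<Longrightarrow> equiv_seq t s"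
  by (simp add: equiv_seq_def hdist_commute)

lemma equiv_seq_trans:
  assumes "hcauchy V s" "hcauchy V t" "hcauchy V r" "equiv_seq s t" "equiv_seq t r"
  shows "equiv_seq s r"
  unfolding equiv_seq_def
proof (rule tendsto_zero_le)
  show "(\<lambda>n. hdist V (s n) (t n) + hdist V (t n) (r n)) \<longlonglongrightarrow> 0"
    using tendsto_add[OF assms(4,5)[unfolded equiv_seq_def]] by simp
qed (use assms in \<open>auto intro: hdist_triangle\<close>)

lemma cc_eq_iff:
  assumes "hcauchy V s" "hcauchy V t"
  shows "cc s = cc t \<longleftrightarrow> equiv_seq s t"
proof
  assume "cc s = cc t"
  moreover have "t \<in> cc t" using assms by (simp add: completion_class_def)
  ultimately have "t \<in> cc s" by simp
  then show "equiv_seq s t" by (simp add: completion_class_def equiv_seq_def)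
next
  assume st: "equiv_seq s t"
  have "equiv_seq s r \<longleftrightarrow> equiv_seq t r" if "hcauchy V r" for r
    using st assms that by (meson equiv_seq_sym equiv_seq_trans)
  then show "cc s = cc t" unfolding completion_class_def equiv_seq_def[symmetric] by blast
qed

text \<open>The chosen representative is merely equivalent to \<open>s\<close>; this is what moves
  the operations of \<open>completion\<close> to arbitrary representatives.\<close>

lemma rep_cc:
  assumes "hcauchy V s"
  shows "hcauchy V (rep (cc s))" "equiv_seq s (rep (cc s))"
proof -
  have "s \<in> cc s" using assms by (simp add: completion_class_def)
  then have "rep (cc s) \<in> cc s" unfolding rep_def by (rule someI[where P="\<lambda>x. x \<in> cc s"])
  then show "hcauchy V (rep (cc s))" "equiv_seq s (rep (cc s))"
    by (auto simp: completion_class_def equiv_seq_def)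
qed

lemma hcauchyI:
  assumes "\<And>n. s n \<in> hcarrier V" "\<And>e. 0 < e \<Longrightarrow> \<exists>N. \<forall>m\<ge>N. \<forall>n\<ge>N. hdist V (s m) (s n) < e"
  shows "hcauchy V s"
  using assms by (simp add: hcauchy_def)

lemma hcauchyE:
  assumes "hcauchy V s" "0 < e"
  obtains N where "\<And>m n. N \<le> m \<Longrightarrow> N \<le> n \<Longrightarrow> hdist V (s m) (s n) < e"
  using assms unfolding hcauchy_def by blast

lemma hcauchy_const [simp]: "v \<in> hcarrier V \<Longrightarrow> hcauchy V (\<lambda>_. v)"
  by (intro hcauchyI) auto

lemma hcauchy_plus [simp]:
  assumes s: "hcauchy V s" and t: "hcauchy V t"
  shows "hcauchy V (\<lambda>n. hplus V (s n) (t n))"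
proof (rule hcauchyI)
  fix e :: real assume "0 < e"
  then have "0 < e / 2" by simp
  obtain M where M: "\<And>m n. M \<le> m \<Longrightarrow> M \<le> n \<Longrightarrow> hdist V (s m) (s n) < e / 2"
    using hcauchyE[OF s \<open>0 < e / 2\<close>] by blast
  obtain N where N: "\<And>m n. N \<le> m \<Longrightarrow> N \<le> n \<Longrightarrow> hdist V (t m) (t n) < e / 2"
    using hcauchyE[OF t \<open>0 < e / 2\<close>] by blast
  show "\<exists>K. \<forall>m\<ge>K. \<forall>n\<ge>K. hdist V (hplus V (s m) (t m)) (hplus V (s n) (t n)) < e"
  proof (intro exI[of _ "max M N"] allI impI)
    fix m n assume "max M N \<le> m" "max M N \<le> n"
    then show "hdist V (hplus V (s m) (t m)) (hplus V (s n) (t n)) < e"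
      using hdist_plus[of "s m" "t m" "s n" "t n"] M[of m n] N[of m n] s t by simp
  qed
qed (use s t in simp)

lemma hcauchy_lipschitz:
  assumes s: "hcauchy V s" and f: "\<And>u. u \<in> hcarrier V \<Longrightarrow> f u \<in> hcarrier V"
    and lip: "\<And>u v. u \<in> hcarrier V \<Longrightarrow> v \<in> hcarrier V \<Longrightarrow> hdist V (f u) (f v) \<le> K * hdist V u v"
  shows "hcauchy V (\<lambda>n. f (s n))"
proof (rule hcauchyI)
  fix e :: real assume "0 < e"
  \<comment> \<open>\<open>K\<close> may be zero or negative; \<open>c\<close> is a positive bound
    to divide by.\<close>
  define c where "c = \<bar>K\<bar> + 1"
  have c: "0 < c" "K \<le> c" by (auto simp: c_def)
  have "0 < e / c" using \<open>0 < e\<close> c by simp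
  then obtain N where N: "\<And>m n. N \<le> m \<Longrightarrow> N \<le> n \<Longrightarrow> hdist V (s m) (s n) < e / c"
    using hcauchyE[OF s] by blast
  show "\<exists>K. \<forall>m\<ge>K. \<forall>n\<ge>K. hdist V (f (s m)) (f (s n)) < e"
  proof (intro exI[of _ N] allI impI)
    fix m n assume "N \<le> m" "N \<le> n"
    then have "c * hdist V (s m) (s n) < e" using N[of m n] c by (simp add: field_simps)
    moreover have "K * hdist V (s m) (s n) \<le> c * hdist V (s m) (s n)"
      using c s by (intro mult_right_mono) auto
    ultimately show "hdist V (f (s m)) (f (s n)) < e"
      using lip[of "s m" "s n"] s by simp
  qed
qed (use s f in simp)

lemma equiv_seq_lipschitz:
  assumes s: "hcauchy V s" "hcauchy V t" "equiv_seq s t" and f: "\<And>u. u \<in> hcarrier V \<Longrightarrow> f u \<in> hcarrier V"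
    and lip: "\<And>u v. u \<in> hcarrier V \<Longrightarrow> v \<in> hcarrier V \<Longrightarrow> hdist V (f u) (f v) \<le> K * hdist V u v"
  shows "equiv_seq (\<lambda>n. f (s n)) (\<lambda>n. f (t n))"
  unfolding equiv_seq_def
proof (rule tendsto_zero_le)
  show "(\<lambda>n. K * hdist V (s n) (t n)) \<longlonglongrightarrow> 0"
    using tendsto_mult_left[OF s(3)[unfolded equiv_seq_def], of K] by simp
qed (use s f lip in auto)

lemma hcauchy_scale [simp]: "hcauchy V s \<Longrightarrow> hcauchy V (\<lambda>n. hscale V c (s n))"
  by (rule hcauchy_lipschitz[where K="cmod c"]) (auto simp: hdist_scale)

lemma hcauchy_bounded:
  assumes s: "hcauchy V s"
  obtains K where "0 \<le> K" "\<And>n. hnorm (s n) \<le> K"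
proof -
  obtain N where N: "\<And>m n. N \<le> m \<Longrightarrow> N \<le> n \<Longrightarrow> hdist V (s m) (s n) < 1"
    using hcauchyE[OF s zero_less_one] by blast
  define K where "K = Max ((\<lambda>n. hnorm (s n)) ` {..N}) + 1"
  have K: "hnorm (s n) \<le> K - 1" if "n \<le> N" for n
    using that by (simp add: K_def)
  have "hnorm (s n) \<le> K" for n
  proof (cases "n \<le> N")
    case True
    then show ?thesis using K[of n] by simp
  next
    case False
    then show ?thesis using hnorm_le_hdist[of "s n" "s N"] N[of n N] K[of N] s by simp
  qed
  moreover have "0 \<le> K" using K[OF order_refl] hnorm_ge_zero[OF hcauchy_carrier[OF s, of N]] by linarith
  ultimately show ?thesis using that by blast
qed

lemma convergent_inner:
  assumes s: "hcauchy V s" and t: "hcauchy V t"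
  shows "convergent (\<lambda>n. hinner V (s n) (t n))"
proof (rule Cauchy_convergent, rule metric_CauchyI)
  fix e :: real assume "0 < e"
  obtain K where K: "0 \<le> K" "\<And>n. hnorm (t n) \<le> K" using hcauchy_bounded[OF t] by blast
  obtain L where L: "0 \<le> L" "\<And>n. hnorm (s n) \<le> L" using hcauchy_bounded[OF s] by blast
  define c where "c = K + L + 1"
  have c: "0 < c" using K L by (simp add: c_def)
  have "0 < e / c" using \<open>0 < e\<close> c by simp
  obtain M where M: "\<And>m n. M \<le> m \<Longrightarrow> M \<le> n \<Longrightarrow> hdist V (s m) (s n) < e / c"
    using hcauchyE[OF s \<open>0 < e / c\<close>] by blast
  obtain N where N: "\<And>m n. N \<le> m \<Longrightarrow> N \<le> n \<Longrightarrow> hdist V (t m) (t n) < e / c"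
    using hcauchyE[OF t \<open>0 < e / c\<close>] by blast
  show "\<exists>M. \<forall>m\<ge>M. \<forall>n\<ge>M. dist (hinner V (s m) (t m)) (hinner V (s n) (t n)) < e"
  proof (intro exI[of _ "max M N"] allI impI)
    fix m n assume mn: "max M N \<le> m" "max M N \<le> n"
    have "dist (hinner V (s m) (t m)) (hinner V (s n) (t n))
        \<le> hdist V (s m) (s n) * hnorm (t m) + hnorm (s n) * hdist V (t m) (t n)"
      unfolding dist_norm using s t by (intro cmod_inner_diff_le) auto
    also have "\<dots> \<le> (e / c) * K + L * (e / c)"
      using M[of m n] N[of m n] mn K(2)[of m] L(2)[of n] L(1) s t c \<open>0 < e\<close>
      by (intro add_mono mult_mono) auto
    also have "\<dots> < e" using c \<open>0 < e\<close> by (simp add: field_simps) (simp add: c_def algebra_simps)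
    finally show "dist (hinner V (s m) (t m)) (hinner V (s n) (t n)) < e" .
  qed
qed

lemma inner_diff_tendsto_zero:
  assumes "hcauchy V s" "hcauchy V t" "hcauchy V s'" "hcauchy V t'" "equiv_seq s s'" "equiv_seq t t'"
  shows "(\<lambda>n. hinner V (s n) (t n) - hinner V (s' n) (t' n)) \<longlonglongrightarrow> 0"
proof -
  obtain K where K: "0 \<le> K" "\<And>n. hnorm (t n) \<le> K" using hcauchy_bounded[OF assms(2)] by blast
  obtain L where L: "0 \<le> L" "\<And>n. hnorm (s' n) \<le> L" using hcauchy_bounded[OF assms(3)] by blast
  have "(\<lambda>n. cmod (hinner V (s n) (t n) - hinner V (s' n) (t' n))) \<longlonglongrightarrow> 0"
  proof (rule tendsto_zero_le)
    have "(\<lambda>n. hdist V (s n) (s' n) * K + L * hdist V (t n) (t' n)) \<longlonglongrightarrow> 0 * K + L * 0"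
      by (intro tendsto_intros assms(5,6)[unfolded equiv_seq_def])
    then show "(\<lambda>n. hdist V (s n) (s' n) * K + L * hdist V (t n) (t' n)) \<longlonglongrightarrow> 0" by simp
    fix n
    have "cmod (hinner V (s n) (t n) - hinner V (s' n) (t' n))
        \<le> hdist V (s n) (s' n) * hnorm (t n) + hnorm (s' n) * hdist V (t n) (t' n)"
      using assms by (intro cmod_inner_diff_le) auto
    also have "\<dots> \<le> hdist V (s n) (s' n) * K + L * hdist V (t n) (t' n)"
      using assms K L by (intro add_mono mult_mono) auto
    finally show "cmod (hinner V (s n) (t n) - hinner V (s' n) (t' n))
        \<le> hdist V (s n) (s' n) * K + L * hdist V (t n) (t' n)" .
  qed simp
  then show ?thesis by (rule tendsto_norm_zero_cancel)
qed

section \<open>Operations, density and completeness of the completion\<close>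

abbreviation C :: "(nat \<Rightarrow> 'v) set ip_space" where
  "C \<equiv> completion V"

lemma completion_carrier: "P \<in> hcarrier C \<longleftrightarrow> (\<exists>s. hcauchy V s \<and> P = cc s)"
  by (auto simp: completion_def)

lemma cc_closed [simp]: "hcauchy V s \<Longrightarrow> cc s \<in> hcarrier C"
  by (auto simp: completion_carrier)

lemma completion_zero: "hzero C = const_class (hzero V)"
  by (simp add: completion_def)

lemma completion_plus:
  assumes "hcauchy V s" "hcauchy V t"
  shows "hplus C (cc s) (cc t) = cc (\<lambda>n. hplus V (s n) (t n))"
proof -
  note r = rep_cc[OF assms(1)] rep_cc[OF assms(2)]
  have "equiv_seq (\<lambda>n. hplus V (rep (cc s) n) (rep (cc t) n)) (\<lambda>n. hplus V (s n) (t n))"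
    unfolding equiv_seq_def
  proof (rule tendsto_zero_le)
    show "(\<lambda>n. hdist V (rep (cc s) n) (s n) + hdist V (rep (cc t) n) (t n)) \<longlonglongrightarrow> 0"
      using equiv_seq_sym[OF assms(1) r(1,2)] equiv_seq_sym[OF assms(2) r(3,4)] tendsto_add
      unfolding equiv_seq_def by fastforce
  qed (use assms r in \<open>auto intro: hdist_plus\<close>)
  then show ?thesis using assms r by (simp add: completion_def cc_eq_iff)
qed

lemma completion_scale:
  assumes "hcauchy V s"
  shows "hscale C c (cc s) = cc (\<lambda>n. hscale V c (s n))"
proof -
  note r = rep_cc[OF assms]
  have "equiv_seq (\<lambda>n. hscale V c (rep (cc s) n)) (\<lambda>n. hscale V c (s n))"
    by (rule equiv_seq_lipschitz[OF r(1) assms equiv_seq_sym[OF assms r], where K="cmod c"])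
      (simp_all add: hdist_scale)
  then show ?thesis using assms r by (simp add: completion_def cc_eq_iff)
qed

text \<open>\<open>hinner\<close> of the completion is a \<open>lim\<close> along chosen
  representatives; here it becomes an actual limit along any representatives.\<close>

lemma completion_inner_tendsto:
  assumes s: "hcauchy V s" and t: "hcauchy V t"
  shows "(\<lambda>n. hinner V (s n) (t n)) \<longlonglongrightarrow> hinner C (cc s) (cc t)"
proof -
  note r = rep_cc[OF s] rep_cc[OF t]
  obtain l where l: "(\<lambda>n. hinner V (s n) (t n)) \<longlonglongrightarrow> l"
    using convergent_inner[OF s t] by (auto simp: convergent_def)
  have "(\<lambda>n. hinner V (s n) (t n) - (hinner V (s n) (t n) - hinner V (rep (cc s) n) (rep (cc t) n))) \<longlonglongrightarrow> l - 0"
    using s t r by (intro tendsto_diff l inner_diff_tendsto_zero) auto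
  then have "(\<lambda>n. hinner V (rep (cc s) n) (rep (cc t) n)) \<longlonglongrightarrow> l" by simp
  then have "hinner C (cc s) (cc t) = l" by (simp add: completion_def limI)
  with l show ?thesis by simp
qed

lemma completion_inner_eq:
  assumes "hcauchy V s" "hcauchy V t" "(\<lambda>n. hinner V (s n) (t n)) \<longlonglongrightarrow> l"
  shows "hinner C (cc s) (cc t) = l"
  using completion_inner_tendsto[OF assms(1,2)] assms(3) by (rule LIMSEQ_unique)

lemma completion_dist_tendsto:
  assumes s: "hcauchy V s" and t: "hcauchy V t"
  shows "(\<lambda>n. hdist V (s n) (t n)) \<longlonglongrightarrow> hdist C (cc s) (cc t)"
proof -
  define d where "d = (\<lambda>n. hdiff (s n) (t n))"
  have d: "hcauchy V d" unfolding d_def using s t by simp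
  have "hplus C (cc s) (hscale C (- 1) (cc t)) = cc d"
    using s t by (simp add: completion_scale completion_plus d_def)
  then have "hdist C (cc s) (cc t) = sqrt (Re (hinner C (cc d) (cc d)))"
    by (simp add: hdist_def Let_def)
  moreover have "(\<lambda>n. sqrt (Re (hinner V (d n) (d n)))) \<longlonglongrightarrow> sqrt (Re (hinner C (cc d) (cc d)))"
    by (intro tendsto_intros completion_inner_tendsto d)
  ultimately show ?thesis by (simp add: hdist_def Let_def d_def)
qed

lemma completion_dist_const:
  "\<lbrakk>u \<in> hcarrier V; v \<in> hcarrier V\<rbrakk> \<Longrightarrow> hdist C (const_class u) (const_class v) = hdist V u v"
  using completion_dist_tendsto[of "\<lambda>_. u" "\<lambda>_. v"] by (simp add: LIMSEQ_const_iff)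

lemma completion_inner_const:
  "\<lbrakk>u \<in> hcarrier V; v \<in> hcarrier V\<rbrakk> \<Longrightarrow> hinner C (const_class u) (const_class v) = hinner V u v"
  by (rule completion_inner_eq) auto

lemma pre_hilbert_completion: "pre_hilbert C"
proof
  fix P Q R and c d :: complex
  show "hzero C \<in> hcarrier C" by (simp add: completion_zero)
  assume "P \<in> hcarrier C"
  then obtain s where s: "hcauchy V s" "P = cc s" by (auto simp: completion_carrier)
  note [simp] = completion_zero completion_plus completion_scale s
  show "hscale C c P \<in> hcarrier C" by simp
  show "hplus C (hzero C) P = P" by (simp add: plus_zero)
  show "hplus C P (hscale C (- 1) P) = hzero C" by (simp add: plus_minus)
  show "hscale C (c + d) P = hplus C (hscale C c P) (hscale C d P)" by (simp add: scale_add)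
  show "hscale C c (hscale C d P) = hscale C (c * d) P" by (simp add: scale_scale)
  show "hscale C 1 P = P" by (simp add: scale_one)
  have "(\<lambda>n. Re (hinner V (s n) (s n))) \<longlonglongrightarrow> Re (hinner C P P)"
    by (simp add: tendsto_Re completion_inner_tendsto)
  then show "0 \<le> Re (hinner C P P)" by (rule LIMSEQ_le_const) (simp add: inner_nonneg)
  assume "Q \<in> hcarrier C"
  then obtain t where t: "hcauchy V t" "Q = cc t" by (auto simp: completion_carrier)
  note [simp] = t
  show "hplus C P Q \<in> hcarrier C" by simp
  show "hplus C P Q = hplus C Q P" by (simp add: plus_commute)
  show "hscale C c (hplus C P Q) = hplus C (hscale C c P) (hscale C c Q)" by (simp add: scale_plus)
  have "(\<lambda>n. c * hinner V (s n) (t n)) \<longlonglongrightarrow> c * hinner C P Q"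
    by (intro tendsto_intros) (simp add: completion_inner_tendsto)
  then show "hinner C P (hscale C c Q) = c * hinner C P Q"
    by simp (rule completion_inner_eq, simp_all add: inner_scale)
  have "(\<lambda>n. cnj (hinner V (s n) (t n))) \<longlonglongrightarrow> cnj (hinner C P Q)"
    by (intro tendsto_intros) (simp add: completion_inner_tendsto)
  then show "hinner C Q P = cnj (hinner C P Q)"
    by simp (rule completion_inner_eq, simp_all flip: inner_cnj)
  assume "R \<in> hcarrier C"
  then obtain r where r: "hcauchy V r" "R = cc r" by (auto simp: completion_carrier)
  note [simp] = r
  show "hplus C (hplus C P Q) R = hplus C P (hplus C Q R)" by (simp add: plus_assoc)
  have "(\<lambda>n. hinner V (s n) (t n) + hinner V (s n) (r n)) \<longlonglongrightarrow> hinner C P Q + hinner C P R"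
    by (intro tendsto_intros) (simp_all add: completion_inner_tendsto)
  then show "hinner C P (hplus C Q R) = hinner C P Q + hinner C P R"
    by simp (rule completion_inner_eq, simp_all add: inner_plus)
qed

lemma completion_dense:
  assumes s: "hcauchy V s"
  shows "(\<lambda>n. hdist C (const_class (s n)) (cc s)) \<longlonglongrightarrow> 0"
proof (rule LIMSEQ_I)
  fix e :: real assume "0 < e"
  then have "0 < e / 2" by simp
  then obtain N where N: "\<And>m n. N \<le> m \<Longrightarrow> N \<le> n \<Longrightarrow> hdist V (s m) (s n) < e / 2"
    using hcauchyE[OF s] by blast
  have "norm (hdist C (const_class (s m)) (cc s) - 0) < e" if m: "N \<le> m" for m
  proof -
    have "(\<lambda>n. hdist V (s m) (s n)) \<longlonglongrightarrow> hdist C (const_class (s m)) (cc s)"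
      by (rule completion_dist_tendsto) (use s in auto)
    then have "hdist C (const_class (s m)) (cc s) \<le> e / 2"
      by (rule LIMSEQ_le_const2) (use N[OF m] in \<open>auto intro: less_imp_le\<close>)
    moreover have "0 \<le> hdist C (const_class (s m)) (cc s)"
      using pre_hilbert.hdist_nonneg[OF pre_hilbert_completion] s by simp
    ultimately show ?thesis using \<open>0 < e\<close> by simp
  qed
  then show "\<exists>N. \<forall>m\<ge>N. norm (hdist C (const_class (s m)) (cc s) - 0) < e" by blast
qed

lemma completion_approx:
  assumes "P \<in> hcarrier C" "0 < e"
  obtains v where "v \<in> hcarrier V" "hdist C P (const_class v) < e"
proof -
  interpret C: pre_hilbert C by (rule pre_hilbert_completion)
  obtain s where s: "hcauchy V s" "P = cc s" using assms by (auto simp: completion_carrier)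
  obtain n where "norm (hdist C (const_class (s n)) (cc s) - 0) < e"
    using LIMSEQ_D[OF completion_dense[OF s(1)] assms(2)] by blast
  then show ?thesis using s C.hdist_commute[of P "const_class (s n)"] by (intro that[of "s n"]) auto
qed

text \<open>For completeness, the \<open>k\<close>-th term is replaced by a constant class within
  \<open>1 / (k + 1)\<close>. These constants form a Cauchy sequence in \<open>V\<close>, whose
  class is the limit.\<close>

lemma hilbert_space_completion: "hilbert_space C"
proof -
  interpret C: pre_hilbert C by (rule pre_hilbert_completion)
  have definite: "P = hzero C" if P: "P \<in> hcarrier C" "hinner C P P = 0" for P
  proof -
    obtain s where s: "hcauchy V s" "P = cc s" using P by (auto simp: completion_carrier)
    have "(\<lambda>n. hdist V (s n) (hzero V)) \<longlonglongrightarrow> hdist C P (hzero C)"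
      using completion_dist_tendsto[OF s(1), of "\<lambda>_. hzero V"] by (simp add: s(2) completion_zero)
    moreover have "hdist C P (hzero C) = 0" using P by (simp add: C.hnorm_def)
    ultimately have "equiv_seq s (\<lambda>_. hzero V)" by (simp add: equiv_seq_def)
    then show ?thesis using s by (simp add: cc_eq_iff completion_zero)
  qed
  have complete: "\<exists>P\<in>hcarrier C. hconverges C S P" if S: "hcauchy C S" for S
  proof -
    have Sc: "S k \<in> hcarrier C" for k using S by (simp add: hcauchy_def)
    have "\<exists>v. v \<in> hcarrier V \<and> hdist C (S k) (const_class v) < 1 / (real k + 1)" for k
      using completion_approx[OF Sc, of "1 / (real k + 1)" k] by fastforce
    then obtain r where r: "\<And>k. r k \<in> hcarrier V" "\<And>k. hdist C (S k) (const_class (r k)) < 1 / (real k + 1)"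
      by metis
    have "(\<lambda>k. 1 / (real k + 1)) \<longlonglongrightarrow> 0"
      using LIMSEQ_inverse_real_of_nat by (simp add: inverse_eq_divide add.commute)
    then have close: "(\<lambda>k. hdist C (S k) (const_class (r k))) \<longlonglongrightarrow> 0"
      by (rule tendsto_zero_le) (use Sc r in \<open>auto intro: less_imp_le\<close>)
    have "hcauchy V r"
    proof (rule hcauchyI)
      fix e :: real assume "0 < e"
      then obtain M where M: "\<And>m n. M \<le> m \<Longrightarrow> M \<le> n \<Longrightarrow> hdist C (S m) (S n) < e / 3"
        using S unfolding hcauchy_def by (metis divide_pos_pos zero_less_numeral)
      obtain N where N: "\<And>n. N \<le> n \<Longrightarrow> hdist C (S n) (const_class (r n)) < e / 3"
        using LIMSEQ_D[OF close, of "e / 3"] \<open>0 < e\<close> Sc r(1) by auto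
      show "\<exists>N. \<forall>m\<ge>N. \<forall>n\<ge>N. hdist V (r m) (r n) < e"
      proof (intro exI[of _ "max M N"] allI impI)
        fix m n assume mn: "max M N \<le> m" "max M N \<le> n"
        have "hdist V (r m) (r n) = hdist C (const_class (r m)) (const_class (r n))"
          by (simp add: completion_dist_const r)
        also have "\<dots> \<le> hdist C (const_class (r m)) (S m) + hdist C (S m) (const_class (r n))"
          using Sc r by (intro C.hdist_triangle) auto
        also have "\<dots> \<le> hdist C (const_class (r m)) (S m) + (hdist C (S m) (S n) + hdist C (S n) (const_class (r n)))"
          using Sc r by (intro add_left_mono C.hdist_triangle) auto
        also have "hdist C (const_class (r m)) (S m) = hdist C (S m) (const_class (r m))"
          using Sc r by (intro C.hdist_commute) auto
        finally show "hdist V (r m) (r n) < e" using M[of m n] N[of m] N[of n] mn by simp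
      qed
    qed (rule r)
    have "(\<lambda>k. hdist C (S k) (cc r)) \<longlonglongrightarrow> 0"
    proof (rule tendsto_zero_le)
      show "(\<lambda>k. hdist C (S k) (const_class (r k)) + hdist C (const_class (r k)) (cc r)) \<longlonglongrightarrow> 0"
        using tendsto_add[OF close completion_dense[OF \<open>hcauchy V r\<close>]] by simp
    qed (use Sc r \<open>hcauchy V r\<close> in \<open>auto intro: C.hdist_triangle\<close>)
    then show ?thesis using \<open>hcauchy V r\<close> by (auto simp: hconverges_def)
  qed
  show ?thesis
    by unfold_locales (fact C.plus_closed C.zero_closed C.scale_closed C.plus_assoc C.plus_commute C.plus_zero
      C.plus_minus C.scale_plus C.scale_add C.scale_scale C.scale_one C.inner_plus C.inner_scale C.inner_cnj
      C.inner_nonneg definite complete)+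
qed

end

lemma (in hilbert_space) pre_hilbert: "pre_hilbert H"
  by unfold_locales (fact hplus_closed hzero_closed hscale_closed hplus_assoc hplus_commute hplus_zero hplus_minus
      hscale_plus hscale_add hscale_hscale hscale_one hinner_plus hinner_scale hinner_cnj hinner_nonneg)+

section \<open>The interior tensor product\<close>

context hilbert_module
begin

lemma ip_add_left: "ip (x + y) z = ip x z + ip y z"
  by (metis ip_add_right ip_star star_add)

lemma ip_scaleC_left: "ip (scaleC c x) z = scaleC (cnj c) (ip x z)"
  by (metis ip_scaleC_right ip_star star_scaleC)

lemma ip_act_left: "ip (act x a) z = star a * ip x z"
  by (metis ip_act_right ip_star star_mult)

lemma ip_diff_right: "ip x (y - z) = ip x y - ip x z"
  using ip_add_right[of x "y - z" z] by simp

lemma ip_diff_left: "ip (x - y) z = ip x z - ip y z"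
  using ip_add_left[of "x - y" y z] by simp

lemma ip_scaleR_right: "ip x (r *\<^sub>R y) = r *\<^sub>R ip x y"
  by (simp add: scaleR_scaleC ip_scaleC_right)

lemma ip_scaleR_left: "ip (r *\<^sub>R x) y = r *\<^sub>R ip x y"
  by (simp add: scaleR_scaleC ip_scaleC_left)

lemmas ip_simps = ip_add_left ip_add_right ip_diff_left ip_diff_right ip_scaleR_left ip_scaleR_right
  ip_scaleC_left ip_scaleC_right ip_act_left ip_act_right

lemma norm_ip_self: "norm (ip x x) = (norm x)\<^sup>2"
  by (simp add: norm_eq)

lemma ip_self_pos_cone: "ip x x \<in> pos_cone"
  using ip_positive[of x] by (auto simp: cstar_positive_def)

end

lemma fscale_add_right: "fscale c (f + g) = fscale c f + fscale c g"
  by (rule free_space.scale_right_distrib)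

lemma diff_conv_fscale: "f - g = f + fscale (- 1) g"
  by (rule poly_mapping_eqI) (simp add: lookup_add lookup_fscale lookup_minus)

lemma keys_fscale: "Poly_Mapping.keys (fscale c f) \<subseteq> Poly_Mapping.keys f"
  by (auto simp: in_keys_iff lookup_fscale)

section \<open>Norm bounds for representations and positivity of Gram matrices\<close>

locale represented_module = hilbert_module ip act + H: pre_hilbert H
  for ip :: "'x::complex_banach \<Rightarrow> 'x \<Rightarrow> 'a::cstar_algebra" and act :: "'x \<Rightarrow> 'a \<Rightarrow> 'x"
    and H :: "'h ip_space" +
  fixes \<sigma> :: "'a \<Rightarrow> 'h \<Rightarrow> 'h"
  assumes representation: "cstar_representation H \<sigma>"
begin

lemma
  assumes "u \<in> hcarrier H"
  shows rep_closed [simp]: "\<sigma> a u \<in> hcarrier H"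
    and rep_add: "\<sigma> (a + b) u = hplus H (\<sigma> a u) (\<sigma> b u)"
    and rep_scaleC: "\<sigma> (scaleC c a) u = hscale H c (\<sigma> a u)"
    and rep_mult: "\<sigma> (a * b) u = \<sigma> a (\<sigma> b u)"
    and rep_hscale: "\<sigma> a (hscale H c u) = hscale H c (\<sigma> a u)"
  using representation assms unfolding cstar_representation_def bounded_operator_def by blast+

lemma
  assumes "u \<in> hcarrier H" "v \<in> hcarrier H"
  shows rep_hplus: "\<sigma> a (hplus H u v) = hplus H (\<sigma> a u) (\<sigma> a v)"
    and rep_adjoint: "hinner H (\<sigma> a u) v = hinner H u (\<sigma> (star a) v)"
  using representation assms unfolding cstar_representation_def bounded_operator_def by blast+

lemma rep_scaleR: "u \<in> hcarrier H \<Longrightarrow> \<sigma> (r *\<^sub>R a) u = hscale H (complex_of_real r) (\<sigma> a u)"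
  by (simp add: scaleR_scaleC rep_scaleC)

text \<open>For \<open>norm c < 1\<close> write formally \<open>1 - c = (1 - b)\<^sup>2\<close>;
  then \<open>\<langle>h, h\<rangle> - \<langle>h, \<sigma> c h\<rangle>\<close> is the square norm
  of \<open>h - \<sigma> b h\<close>. This yields the constant \<open>norm c\<close>, whereas
  \<open>bounded_operator\<close> grants only some bound.\<close>

lemma rep_form_bound:
  assumes c: "star c = c" and h: "h \<in> hcarrier H"
  shows "Re (hinner H h (\<sigma> c h)) \<le> norm c * (H.hnorm h)\<^sup>2"
proof -
  have lt1: "Re (hinner H h (\<sigma> c h)) \<le> (H.hnorm h)\<^sup>2" if c: "star c = c" "norm c < 1" for c
  proof -
    obtain b where b: "star b = b" "c = 2 *\<^sub>R b - b * b"
      using selfadjoint_one_minus_sqrt[OF c] by blast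
    have "\<sigma> (c + b * b) h = \<sigma> (2 *\<^sub>R b) h" by (simp add: b(2))
    then have "hplus H (\<sigma> c h) (\<sigma> b (\<sigma> b h)) = hscale H 2 (\<sigma> b h)"
      using h by (simp add: rep_add rep_mult rep_scaleR)
    then have "hinner H h (hplus H (\<sigma> c h) (\<sigma> b (\<sigma> b h))) = hinner H h (hscale H 2 (\<sigma> b h))" by simp
    then have "hinner H h (\<sigma> c h) + hinner H (\<sigma> b h) (\<sigma> b h) = 2 * hinner H h (\<sigma> b h)"
      using h b(1) by (simp add: H.inner_simps rep_adjoint)
    then have eq: "Re (hinner H h (\<sigma> c h)) + Re (hinner H (\<sigma> b h) (\<sigma> b h)) = 2 * Re (hinner H h (\<sigma> b h))"
      by (metis plus_complex.simps(1) mult_2)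
    have "0 \<le> Re (hinner H (H.hdiff h (\<sigma> b h)) (H.hdiff h (\<sigma> b h)))"
      using h by (intro H.inner_nonneg) simp
    also have "\<dots> = Re (hinner H h h) - 2 * Re (hinner H h (\<sigma> b h)) + Re (hinner H (\<sigma> b h) (\<sigma> b h))"
      using h H.Re_inner_commute[of h "\<sigma> b h"] by (simp add: H.inner_simps)
    finally show ?thesis using eq h by (simp add: H.hnorm_square)
  qed
  show ?thesis
  proof (rule field_le_epsilon)
    fix e :: real assume "0 < e"
    define r where "r = norm c + e / ((H.hnorm h)\<^sup>2 + 1)"
    have pos: "0 < (H.hnorm h)\<^sup>2 + 1" by (simp add: add_nonneg_pos)
    have r: "norm c < r" "0 < r" using \<open>0 < e\<close> pos by (auto simp: r_def add_nonneg_pos)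
    have "Re (hinner H h (\<sigma> ((1 / r) *\<^sub>R c) h)) \<le> (H.hnorm h)\<^sup>2"
      using c r by (intro lt1) (auto simp: star_simps)
    then have "Re (hinner H h (\<sigma> c h)) \<le> r * (H.hnorm h)\<^sup>2"
      using h r by (simp add: rep_scaleR H.inner_simps field_simps)
    also have "\<dots> = norm c * (H.hnorm h)\<^sup>2 + e * ((H.hnorm h)\<^sup>2 / ((H.hnorm h)\<^sup>2 + 1))"
      by (simp add: r_def algebra_simps)
    also have "\<dots> \<le> norm c * (H.hnorm h)\<^sup>2 + e * 1"
      using \<open>0 < e\<close> pos by (intro add_left_mono mult_left_mono) auto
    finally show "Re (hinner H h (\<sigma> c h)) \<le> norm c * (H.hnorm h)\<^sup>2 + e" by simp
  qed
qed

text \<open>\<open>G\<close> stands for the sum of the \<open>g i\<close>, which has to be built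
  from \<open>hplus\<close>; its inner products are all that is used later.\<close>

lemma exists_finite_sum:
  assumes "finite I" "\<And>i. i \<in> I \<Longrightarrow> g i \<in> hcarrier H"
  obtains G where "G \<in> hcarrier H" "\<And>u. u \<in> hcarrier H \<Longrightarrow> hinner H u G = (\<Sum>i\<in>I. hinner H u (g i))"
proof -
  have "\<exists>G\<in>hcarrier H. \<forall>u\<in>hcarrier H. hinner H u G = (\<Sum>i\<in>I. hinner H u (g i))"
    using assms
  proof (induction I)
    case empty
    show ?case by (rule bexI[of _ "hzero H"]) auto
  next
    case (insert j I)
    then obtain G where "G \<in> hcarrier H" "\<And>u. u \<in> hcarrier H \<Longrightarrow> hinner H u G = (\<Sum>i\<in>I. hinner H u (g i))"
      by auto
    with insert show ?case
      by (intro bexI[of _ "hplus H (g j) G"]) (auto simp: H.inner_plus)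
  qed
  then show ?thesis using that by blast
qed

text \<open>
  Induction over the number of tensors. With \<open>X = x n\<close>, \<open>k = \<langle>X, X\<rangle>\<close> and
  \<open>m i = (\<epsilon> + k)\<^sup>-\<^sup>1 \<langle>X, x i\<rangle>\<close>, replacing \<open>x i\<close> by \<open>x i - X m i\<close> completes the square up to an
  error of order \<open>\<epsilon>\<close>.
\<close>

lemma gram_nonneg:
  assumes "finite I" "\<And>i. i \<in> I \<Longrightarrow> h i \<in> hcarrier H"
  shows "0 \<le> Re (\<Sum>i\<in>I. \<Sum>j\<in>I. hinner H (h i) (\<sigma> (ip (x i) (x j)) (h j)))"
  using assms
\<comment> \<open>\<open>x\<close> is arbitrary because the induction hypothesis is applied to the
  modified \<open>x'\<close>; the vectors \<open>h\<close> stay fixed.\<close>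
proof (induction I arbitrary: x)
  case (insert n I)
  have hn: "h n \<in> hcarrier H" and hI: "\<And>i. i \<in> I \<Longrightarrow> h i \<in> hcarrier H" using insert by auto
  define X where "X = x n"
  define k where "k = ip X X"
  obtain b where b: "k = star b * b" using ip_positive[of X] by (auto simp: cstar_positive_def k_def)
  have sk: "star k = k" by (simp add: b star_simps)
  define S where "S = (\<Sum>i\<in>insert n I. \<Sum>j\<in>insert n I. hinner H (h i) (\<sigma> (ip (x i) (x j)) (h j)))"
  have est: "- (\<epsilon> / 2) * (H.hnorm (h n))\<^sup>2 \<le> Re S" if \<epsilon>: "0 < \<epsilon>" for \<epsilon>
  proof -
    have "\<exists>m. \<epsilon> *\<^sub>R m + k * m = ip X (x i)" for i
      using solve_eps_plus_pos[OF ip_self_pos_cone[of X] \<epsilon>, of "ip X (x i)"] unfolding k_def by blast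
    then obtain m where m: "\<And>i. \<epsilon> *\<^sub>R m i + k * m i = ip X (x i)" by metis
    define x' where "x' i = x i - act X (m i)" for i
    have Xx': "ip X (x' i) = \<epsilon> *\<^sub>R m i" for i
      by (simp add: x'_def ip_simps flip: m k_def)
    have x'X: "ip (x' i) X = \<epsilon> *\<^sub>R star (m i)" for i
      using ip_star[of X "x' i"] by (simp add: Xx' star_simps)
    have xX: "ip (x i) X = \<epsilon> *\<^sub>R star (m i) + star (m i) * k" for i
      using ip_star[of X "x i"] by (simp add: star_simps sk flip: m)
    \<comment> \<open>The two mixed terms contribute \<open>\<epsilon>\<close> each; the rest is the
      exact completion of the square.\<close>
    have xx: "ip (x i) (x j) = ip (x' i) (x' j) + (2 * \<epsilon>) *\<^sub>R (star (m i) * m j) + star (m i) * (k * m j)" for i j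
    proof -
      have "ip (x i) (x j) = ip (x' i + act X (m i)) (x' j + act X (m j))" by (simp add: x'_def)
      also have "\<dots> = ip (x' i) (x' j) + (2 * \<epsilon>) *\<^sub>R (star (m i) * m j) + star (m i) * (k * m j)"
        by (simp only: ip_add_left ip_add_right ip_act_left ip_act_right Xx' x'X flip: k_def)
          (simp add: distrib_right mult.assoc scaleR_2 flip: scaleR_scaleR)
      finally show ?thesis .
    qed
    define g where "g i = \<sigma> (m i) (h i)" for i
    have g: "g i \<in> hcarrier H" if "i \<in> I" for i using hI[OF that] by (simp add: g_def)
    \<comment> \<open>With the sum \<open>G\<close> of the \<open>g i\<close>, all terms that
      contain \<open>k\<close> combine into the square norm of
      \<open>\<sigma> b (G + h n)\<close>.\<close>
    obtain G where G: "G \<in> hcarrier H" "\<And>u. u \<in> hcarrier H \<Longrightarrow> hinner H u G = (\<Sum>i\<in>I. hinner H u (g i))"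
      using exists_finite_sum[of I g] insert.hyps(1) g by blast
    have G': "hinner H G u = (\<Sum>i\<in>I. hinner H (g i) u)" if u: "u \<in> hcarrier H" for u
    proof -
      have "hinner H G u = cnj (hinner H u G)" using G u by (intro H.inner_cnj) auto
      also have "\<dots> = (\<Sum>i\<in>I. cnj (hinner H u (g i)))" using G(2)[OF u] by simp
      also have "\<dots> = (\<Sum>i\<in>I. hinner H (g i) u)"
        using u g by (intro sum.cong refl H.inner_cnj[symmetric]) auto
      finally show ?thesis .
    qed
    have swap_k: "hinner H u (\<sigma> k v) = hinner H (\<sigma> k u) v" if "u \<in> hcarrier H" "v \<in> hcarrier H" for u v
      using rep_adjoint[OF that, of k] by (simp add: sk)
    have Gk: "(\<Sum>i\<in>I. hinner H u (\<sigma> k (g i))) = hinner H u (\<sigma> k G)" if u: "u \<in> hcarrier H" for u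
      using u g G by (simp add: swap_k)
    have e1: "hinner H (h i) (\<sigma> (star (m i) * a) v) = hinner H (g i) (\<sigma> a v)"
      if "i \<in> I" "v \<in> hcarrier H" for i a v
      using hI[OF that(1)] that(2) by (simp add: g_def rep_mult rep_adjoint)
    define Q where "Q = (\<Sum>i\<in>I. \<Sum>j\<in>I. hinner H (h i) (\<sigma> (ip (x' i) (x' j)) (h j)))"
    have Q: "0 \<le> Re Q" unfolding Q_def by (rule insert.IH[OF hI])
    have "(\<Sum>i\<in>I. \<Sum>j\<in>I. hinner H (h i) (\<sigma> (ip (x i) (x j)) (h j)))
        = (\<Sum>i\<in>I. \<Sum>j\<in>I. hinner H (h i) (\<sigma> (ip (x' i) (x' j)) (h j))
            + (complex_of_real (2 * \<epsilon>) * hinner H (g i) (g j) + hinner H (g i) (\<sigma> k (g j))))"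
    proof (intro sum.cong refl)
      fix i j assume ij: "i \<in> I" "j \<in> I"
      note [simp] = hI[OF ij(1)] hI[OF ij(2)]
      have "hinner H (h i) (\<sigma> (ip (x i) (x j)) (h j))
          = hinner H (h i) (\<sigma> (ip (x' i) (x' j)) (h j))
            + complex_of_real (2 * \<epsilon>) * hinner H (h i) (\<sigma> (star (m i) * m j) (h j))
            + hinner H (h i) (\<sigma> (star (m i) * (k * m j)) (h j))"
        unfolding xx by (simp add: rep_add rep_scaleR H.inner_simps)
      moreover have "hinner H (h i) (\<sigma> (star (m i) * m j) (h j)) = hinner H (g i) (g j)"
        by (simp only: e1[OF ij(1) hI[OF ij(2)]] g_def)
      moreover have "hinner H (h i) (\<sigma> (star (m i) * (k * m j)) (h j)) = hinner H (g i) (\<sigma> k (g j))"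
        using e1[OF ij(1) hI[OF ij(2)], of "k * m j"] by (simp only: rep_mult[OF hI[OF ij(2)], of k] g_def[of j])
      ultimately show "hinner H (h i) (\<sigma> (ip (x i) (x j)) (h j))
          = hinner H (h i) (\<sigma> (ip (x' i) (x' j)) (h j))
            + (complex_of_real (2 * \<epsilon>) * hinner H (g i) (g j) + hinner H (g i) (\<sigma> k (g j)))"
        by (simp only: add.assoc)
    qed
    also have "\<dots> = Q + (complex_of_real (2 * \<epsilon>) * hinner H G G + hinner H G (\<sigma> k G))"
    proof -
      have "(\<Sum>i\<in>I. \<Sum>j\<in>I. hinner H (g i) (g j)) = hinner H G G"
        using g G by (simp add: G' flip: G(2))
      moreover have "(\<Sum>i\<in>I. \<Sum>j\<in>I. hinner H (g i) (\<sigma> k (g j))) = hinner H G (\<sigma> k G)"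
        using g G by (simp add: G' Gk)
      ultimately show ?thesis
        by (simp add: sum.distrib Q_def flip: sum_distrib_left)
    qed
    finally have s1: "(\<Sum>i\<in>I. \<Sum>j\<in>I. hinner H (h i) (\<sigma> (ip (x i) (x j)) (h j)))
        = Q + (complex_of_real (2 * \<epsilon>) * hinner H G G + hinner H G (\<sigma> k G))" .
    have "(\<Sum>j\<in>I. hinner H (h n) (\<sigma> (ip X (x j)) (h j)))
        = (\<Sum>j\<in>I. complex_of_real \<epsilon> * hinner H (h n) (g j) + hinner H (h n) (\<sigma> k (g j)))"
      using hn hI by (intro sum.cong refl)
        (simp add: rep_add rep_scaleR rep_mult H.inner_simps g_def flip: m)
    also have "\<dots> = complex_of_real \<epsilon> * hinner H (h n) G + hinner H (h n) (\<sigma> k G)"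
      using hn by (simp add: sum.distrib Gk G flip: sum_distrib_left)
    finally have s2: "(\<Sum>j\<in>I. hinner H (h n) (\<sigma> (ip X (x j)) (h j)))
        = complex_of_real \<epsilon> * hinner H (h n) G + hinner H (h n) (\<sigma> k G)" .
    have "(\<Sum>i\<in>I. hinner H (h i) (\<sigma> (ip (x i) X) (h n)))
        = (\<Sum>i\<in>I. complex_of_real \<epsilon> * hinner H (g i) (h n) + hinner H (g i) (\<sigma> k (h n)))"
    proof (intro sum.cong refl)
      fix i assume i: "i \<in> I"
      have "hinner H (h i) (\<sigma> (ip (x i) X) (h n))
          = complex_of_real \<epsilon> * hinner H (h i) (\<sigma> (star (m i)) (h n)) + hinner H (h i) (\<sigma> (star (m i) * k) (h n))"
        unfolding xX using hn hI[OF i] by (simp add: rep_add rep_scaleR H.inner_simps)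
      moreover have "hinner H (h i) (\<sigma> (star (m i)) (h n)) = hinner H (g i) (h n)"
        unfolding g_def using hn hI[OF i] by (simp add: rep_adjoint)
      ultimately show "hinner H (h i) (\<sigma> (ip (x i) X) (h n))
          = complex_of_real \<epsilon> * hinner H (g i) (h n) + hinner H (g i) (\<sigma> k (h n))"
        using e1[OF i hn] by simp
    qed
    also have "\<dots> = complex_of_real \<epsilon> * hinner H G (h n) + hinner H G (\<sigma> k (h n))"
      using hn by (simp add: sum.distrib G' flip: sum_distrib_left)
    finally have s3: "(\<Sum>i\<in>I. hinner H (h i) (\<sigma> (ip (x i) X) (h n)))
        = complex_of_real \<epsilon> * hinner H G (h n) + hinner H G (\<sigma> k (h n))" .
    have "S = hinner H (h n) (\<sigma> k (h n)) + (\<Sum>j\<in>I. hinner H (h n) (\<sigma> (ip X (x j)) (h j)))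
        + ((\<Sum>i\<in>I. hinner H (h i) (\<sigma> (ip (x i) X) (h n)))
          + (\<Sum>i\<in>I. \<Sum>j\<in>I. hinner H (h i) (\<sigma> (ip (x i) (x j)) (h j))))"
      using insert.hyps by (simp add: S_def sum.distrib k_def X_def)
    also have "\<dots> = Q + complex_of_real \<epsilon> * (2 * hinner H G G + hinner H (h n) G + hinner H G (h n))
        + hinner H (hplus H G (h n)) (\<sigma> k (hplus H G (h n)))"
      unfolding s1 s2 s3 using hn G(1) by (simp add: rep_hplus H.inner_simps algebra_simps)
    also have "hinner H (hplus H G (h n)) (\<sigma> k (hplus H G (h n)))
        = hinner H (\<sigma> b (hplus H G (h n))) (\<sigma> b (hplus H G (h n)))"
      using hn G(1) by (simp add: b rep_mult rep_adjoint)
    finally have "Re S = Re Q + \<epsilon> * (2 * Re (hinner H G G) + Re (hinner H (h n) G) + Re (hinner H G (h n)))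
        + Re (hinner H (\<sigma> b (hplus H G (h n))) (\<sigma> b (hplus H G (h n))))"
      by simp
    moreover have "0 \<le> Re (hinner H (\<sigma> b (hplus H G (h n))) (\<sigma> b (hplus H G (h n))))"
      using hn G(1) by (intro H.inner_nonneg) simp
    \<comment> \<open>The square norm of \<open>2 G + h n\<close> controls the error:
      \<open>2 \<langle>G, G\<rangle> + 2 Re \<langle>h n, G\<rangle>\<close> is at least
      \<open>- 1 / 2\<close> times the square norm of \<open>h n\<close>.\<close>
    moreover have "0 \<le> Re (hinner H (hplus H (hscale H 2 G) (h n)) (hplus H (hscale H 2 G) (h n)))"
      using hn G(1) by (intro H.inner_nonneg) simp
    then have "0 \<le> 4 * Re (hinner H G G) + 2 * Re (hinner H (h n) G) + 2 * Re (hinner H G (h n)) + (H.hnorm (h n))\<^sup>2"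
      using hn G(1) by (simp add: H.inner_simps H.hnorm_square)
    then have "- (1 / 2) * (H.hnorm (h n))\<^sup>2 \<le> 2 * Re (hinner H G G) + Re (hinner H (h n) G) + Re (hinner H G (h n))"
      by simp
    then have "\<epsilon> * (- (1 / 2) * (H.hnorm (h n))\<^sup>2)
        \<le> \<epsilon> * (2 * Re (hinner H G G) + Re (hinner H (h n) G) + Re (hinner H G (h n)))"
      using \<epsilon> by (intro mult_left_mono) auto
    ultimately show ?thesis using Q by simp
  qed
  have "0 \<le> Re S"
  proof (rule field_le_epsilon)
    fix e :: real assume "0 < e"
    define N where "N = (H.hnorm (h n))\<^sup>2 + 1"
    have N: "0 < N" "(H.hnorm (h n))\<^sup>2 \<le> N" by (auto simp: N_def add_nonneg_pos)
    have "(e / N) * (H.hnorm (h n))\<^sup>2 \<le> (e / N) * N"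
      using N \<open>0 < e\<close> by (intro mult_left_mono) auto
    also have "\<dots> = e" using N by simp
    finally have "(e / N) * (H.hnorm (h n))\<^sup>2 \<le> e" .
    moreover have "- ((2 * (e / N)) / 2) * (H.hnorm (h n))\<^sup>2 \<le> Re S"
      using N \<open>0 < e\<close> by (intro est) auto
    ultimately show "0 \<le> Re S + e" by simp
  qed
  then show ?case by (simp only: S_def)
qed simp

end

text \<open>The tensor form with a pure tensor on the left. Linearity in \<open>g\<close> holds for
  all formal sums; the left argument of \<open>tensor_form\<close> is later treated through
  hermitian symmetry, which uses that second components lie in the carrier.\<close>

definition tensor_row :: "('x \<Rightarrow> 'x \<Rightarrow> 'a) \<Rightarrow> 'h ip_space \<Rightarrow> ('a \<Rightarrow> 'h \<Rightarrow> 'h) \<Rightarrow>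
    'x \<times> 'h \<Rightarrow> (('x \<times> 'h) \<Rightarrow>\<^sub>0 complex) \<Rightarrow> complex" where
  "tensor_row ip H \<sigma> p g = (\<Sum>q\<in>Poly_Mapping.keys g.
     Poly_Mapping.lookup g q * hinner H (snd p) (\<sigma> (ip (fst p) (fst q)) (snd q)))"

text \<open>Keys may cancel in a sum, so linearity is checked over a common finite superset.\<close>

lemma tensor_row_superset:
  assumes "finite B" "Poly_Mapping.keys g \<subseteq> B"
  shows "tensor_row ip H \<sigma> p g = (\<Sum>q\<in>B. Poly_Mapping.lookup g q * hinner H (snd p) (\<sigma> (ip (fst p) (fst q)) (snd q)))"
  unfolding tensor_row_def using assms by (intro sum.mono_neutral_left) (auto simp: in_keys_iff)

lemma tensor_row_add: "tensor_row ip H \<sigma> p (f + g) = tensor_row ip H \<sigma> p f + tensor_row ip H \<sigma> p g"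
proof -
  define B where "B = Poly_Mapping.keys f \<union> Poly_Mapping.keys g"
  have B: "finite B" by (simp add: B_def)
  show ?thesis
    using keys_add[of f g]
    by (simp add: tensor_row_superset[OF B] B_def lookup_add distrib_right sum.distrib)
qed

lemma tensor_row_fscale: "tensor_row ip H \<sigma> p (fscale c f) = c * tensor_row ip H \<sigma> p f"
  by (simp add: tensor_row_superset[OF finite_keys keys_fscale] lookup_fscale sum_distrib_left mult.assoc)
    (simp add: tensor_row_def sum_distrib_left)

lemma tensor_row_diff: "tensor_row ip H \<sigma> p (f - g) = tensor_row ip H \<sigma> p f - tensor_row ip H \<sigma> p g"
  unfolding diff_conv_fscale[of f] tensor_row_add tensor_row_fscale by simp

lemma tensor_row_gen: "tensor_row ip H \<sigma> p (gen y k) = hinner H (snd p) (\<sigma> (ip (fst p) y) k)"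
  by (simp add: tensor_row_def gen_def)

lemma tensor_form_eq_row:
  "tensor_form ip H \<sigma> f g = (\<Sum>p\<in>Poly_Mapping.keys f. cnj (Poly_Mapping.lookup f p) * tensor_row ip H \<sigma> p g)"
  by (simp add: tensor_form_def tensor_row_def sum_distrib_left mult.assoc)

lemma tensor_form_add_right: "tensor_form ip H \<sigma> f (g + g') = tensor_form ip H \<sigma> f g + tensor_form ip H \<sigma> f g'"
  by (simp add: tensor_form_eq_row tensor_row_add distrib_left sum.distrib)

lemma tensor_form_fscale_right: "tensor_form ip H \<sigma> f (fscale c g) = c * tensor_form ip H \<sigma> f g"
  by (simp add: tensor_form_eq_row tensor_row_fscale sum_distrib_left mult.left_commute)

lemma tensor_form_diff_right: "tensor_form ip H \<sigma> f (g - g') = tensor_form ip H \<sigma> f g - tensor_form ip H \<sigma> f g'"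
  unfolding diff_conv_fscale[of g] tensor_form_add_right tensor_form_fscale_right by simp

lemma tensor_form_zero_right [simp]: "tensor_form ip H \<sigma> f 0 = 0"
  by (simp add: tensor_form_def)

lemma tensor_form_gen_left: "tensor_form ip H \<sigma> (gen x h) g = tensor_row ip H \<sigma> (x, h) g"
  by (simp add: tensor_form_eq_row gen_def)

section \<open>The tensor form on cosets and the balanced tensor product\<close>

context represented_module
begin

abbreviation tform :: "(('x \<times> 'h) \<Rightarrow>\<^sub>0 complex) \<Rightarrow> (('x \<times> 'h) \<Rightarrow>\<^sub>0 complex) \<Rightarrow> complex" where
  "tform \<equiv> tensor_form ip H \<sigma>"

abbreviation rels :: "(('x \<times> 'h) \<Rightarrow>\<^sub>0 complex) set" where
  "rels \<equiv> bilinear_relations H \<union> balancing_relations act H \<sigma>"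

abbreviation coset :: "(('x \<times> 'h) \<Rightarrow>\<^sub>0 complex) \<Rightarrow> (('x \<times> 'h) \<Rightarrow>\<^sub>0 complex) set" where
  "coset \<equiv> tensor_coset act H \<sigma>"

abbreviation BT :: "(('x \<times> 'h) \<Rightarrow>\<^sub>0 complex) set ip_space" where
  "BT \<equiv> balanced_tensor ip act H \<sigma>"

definition supported :: "(('x \<times> 'h) \<Rightarrow>\<^sub>0 complex) set" where
  "supported = {f. Poly_Mapping.keys f \<subseteq> UNIV \<times> hcarrier H}"

lemma supported_add [simp]: "f \<in> supported \<Longrightarrow> g \<in> supported \<Longrightarrow> f + g \<in> supported"
  using keys_add[of f g] by (auto simp: supported_def)

lemma supported_fscale [simp]: "f \<in> supported \<Longrightarrow> fscale c f \<in> supported"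
  using keys_fscale[of c f] by (auto simp: supported_def)

lemma supported_zero [simp]: "0 \<in> supported"
  by (simp add: supported_def)

lemma supported_diff [simp]: "f \<in> supported \<Longrightarrow> g \<in> supported \<Longrightarrow> f - g \<in> supported"
  unfolding diff_conv_fscale[of f] by (intro supported_add supported_fscale)

lemma supported_gen [simp]: "h \<in> hcarrier H \<Longrightarrow> gen x h \<in> supported"
  by (simp add: supported_def gen_def)

lemma tform_cnj:
  assumes "f \<in> supported" "g \<in> supported"
  shows "tform g f = cnj (tform f g)"
proof -
  have "tform g f = (\<Sum>p\<in>Poly_Mapping.keys f. \<Sum>q\<in>Poly_Mapping.keys g.
        cnj (Poly_Mapping.lookup g q) * Poly_Mapping.lookup f p * hinner H (snd q) (\<sigma> (ip (fst q) (fst p)) (snd p)))"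
    unfolding tensor_form_def by (rule sum.swap)
  also have "\<dots> = (\<Sum>p\<in>Poly_Mapping.keys f. \<Sum>q\<in>Poly_Mapping.keys g.
        cnj (cnj (Poly_Mapping.lookup f p) * Poly_Mapping.lookup g q * hinner H (snd p) (\<sigma> (ip (fst p) (fst q)) (snd q))))"
  proof (intro sum.cong refl)
    fix p q assume "p \<in> Poly_Mapping.keys f" "q \<in> Poly_Mapping.keys g"
    then have pq: "snd p \<in> hcarrier H" "snd q \<in> hcarrier H" using assms by (auto simp: supported_def)
    have "hinner H (snd q) (\<sigma> (ip (fst q) (fst p)) (snd p)) = hinner H (\<sigma> (ip (fst p) (fst q)) (snd q)) (snd p)"
      using pq rep_adjoint[of "snd q" "snd p" "ip (fst p) (fst q)"] by (simp add: ip_star)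
    also have "\<dots> = cnj (hinner H (snd p) (\<sigma> (ip (fst p) (fst q)) (snd q)))"
      using pq by (intro H.inner_cnj) auto
    finally show "cnj (Poly_Mapping.lookup g q) * Poly_Mapping.lookup f p * hinner H (snd q) (\<sigma> (ip (fst q) (fst p)) (snd p))
      = cnj (cnj (Poly_Mapping.lookup f p) * Poly_Mapping.lookup g q * hinner H (snd p) (\<sigma> (ip (fst p) (fst q)) (snd q)))"
      by (simp add: ac_simps)
  qed
  also have "\<dots> = cnj (tform f g)" by (simp add: tensor_form_def)
  finally show ?thesis .
qed

lemma tform_add_left:
  "f \<in> supported \<Longrightarrow> f' \<in> supported \<Longrightarrow> g \<in> supported \<Longrightarrow> tform (f + f') g = tform f g + tform f' g"
  by (simp add: tform_cnj[of g] tensor_form_add_right)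

lemma tform_fscale_left: "f \<in> supported \<Longrightarrow> g \<in> supported \<Longrightarrow> tform (fscale c f) g = cnj c * tform f g"
  by (simp add: tform_cnj[of g] tensor_form_fscale_right)

lemma tform_diff_left:
  "f \<in> supported \<Longrightarrow> f' \<in> supported \<Longrightarrow> g \<in> supported \<Longrightarrow> tform (f - f') g = tform f g - tform f' g"
  by (simp add: tform_cnj[of g] tensor_form_diff_right)

lemma tform_nonneg:
  assumes f: "f \<in> supported"
  shows "0 \<le> Re (tform f f)"
proof -
  \<comment> \<open>The coefficients are absorbed into the second components, so that
    \<open>gram_nonneg\<close> applies.\<close>
  define h where "h p = hscale H (Poly_Mapping.lookup f p) (snd p)" for p
  have c: "snd p \<in> hcarrier H" if "p \<in> Poly_Mapping.keys f" for p using f that by (auto simp: supported_def)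
  have "tform f f = (\<Sum>p\<in>Poly_Mapping.keys f. \<Sum>q\<in>Poly_Mapping.keys f. hinner H (h p) (\<sigma> (ip (fst p) (fst q)) (h q)))"
    unfolding tensor_form_def
    by (intro sum.cong refl) (simp add: h_def c rep_hscale H.inner_simps)
  then show ?thesis
    using gram_nonneg[of "Poly_Mapping.keys f" h fst] c by (simp add: h_def)
qed

text \<open>The relations lie in the radical of the form; hence it descends to cosets.\<close>

lemma tensor_row_rels:
  assumes "snd p \<in> hcarrier H" "r \<in> rels"
  shows "tensor_row ip H \<sigma> p r = 0"
  using assms unfolding bilinear_relations_def balancing_relations_def
  by (auto simp: tensor_row_diff tensor_row_fscale tensor_row_gen ip_simps rep_add rep_hplus rep_scaleC rep_hscale
      rep_mult H.inner_simps)

lemma tensor_row_span_rels: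
  assumes "snd p \<in> hcarrier H" "r \<in> free_space.span rels"
  shows "tensor_row ip H \<sigma> p r = 0"
  using assms(2)
proof (induction rule: free_space.span_induct_alt)
  case base
  show ?case by (simp add: tensor_row_def)
next
  case (step c r r')
  then show ?case using tensor_row_rels[OF assms(1)] by (simp add: tensor_row_add tensor_row_fscale)
qed

lemma tform_span_rels:
  assumes "f \<in> supported" "r \<in> free_space.span rels"
  shows "tform f r = 0"
  unfolding tensor_form_eq_row
  using assms by (intro sum.neutral ballI) (auto simp: supported_def tensor_row_span_rels)

lemma span_rels_supported: "free_space.span rels \<subseteq> supported"
proof (rule free_space.span_minimal)
  show "rels \<subseteq> supported"
    unfolding bilinear_relations_def balancing_relations_def by auto
  show "free_space.subspace supported"
    by (rule free_space.subspaceI) auto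
qed

lemma coset_eq_iff: "coset f = coset g \<longleftrightarrow> f - g \<in> free_space.span rels"
proof
  assume "coset f = coset g"
  moreover have "f \<in> coset f" by (simp add: tensor_coset_def free_space.span_zero)
  ultimately have "f \<in> coset g" by simp
  then show "f - g \<in> free_space.span rels" by (simp add: tensor_coset_def)
next
  assume fg: "f - g \<in> free_space.span rels"
  have "r - f \<in> free_space.span rels \<longleftrightarrow> r - g \<in> free_space.span rels" for r
    using free_space.span_add[OF _ fg, of "r - f"] free_space.span_diff[OF _ fg, of "r - g"] by auto
  then show "coset f = coset g" by (simp add: tensor_coset_def)
qed

lemma rep_coset: "rep (coset f) - f \<in> free_space.span rels"
proof -
  have "f \<in> coset f" by (simp add: tensor_coset_def free_space.span_zero)
  then have "rep (coset f) \<in> coset f" unfolding rep_def by (rule someI[where P="\<lambda>x. x \<in> coset f"])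
  then show ?thesis by (simp add: tensor_coset_def)
qed

lemma rep_coset_supported [simp]: "f \<in> supported \<Longrightarrow> rep (coset f) \<in> supported"
  using supported_add[of "rep (coset f) - f" f] rep_coset[of f] span_rels_supported by auto

lemma tform_rep_coset:
  assumes f: "f \<in> supported" and g: "g \<in> supported"
  shows "tform (rep (coset f)) (rep (coset g)) = tform f g"
proof -
  \<comment> \<open>The representative is changed on the right only; hermitian symmetry carries this
    over to the left.\<close>
  have right: "tform f' (rep (coset g')) = tform f' g'" if "f' \<in> supported" for f' g'
    using tform_span_rels[OF that rep_coset[of g']] by (simp add: tensor_form_diff_right)
  have "tform (rep (coset f)) (rep (coset g)) = tform (rep (coset f)) g"
    using f by (intro right) simp
  also have "\<dots> = cnj (tform g (rep (coset f)))" using f g by (intro tform_cnj) auto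
  also have "\<dots> = cnj (tform g f)" using g by (simp only: right)
  also have "\<dots> = tform f g" using f g by (simp only: tform_cnj[of g f] complex_cnj_cnj)
  finally show ?thesis .
qed

lemma BT_carrier: "C \<in> hcarrier BT \<longleftrightarrow> (\<exists>f\<in>supported. C = coset f)"
  by (auto simp: balanced_tensor_def Let_def supported_def)

lemma coset_closed [simp]: "f \<in> supported \<Longrightarrow> coset f \<in> hcarrier BT"
  by (auto simp: BT_carrier)

lemma BT_zero: "hzero BT = coset 0"
  by (simp add: balanced_tensor_def Let_def)

lemma BT_plus: "hplus BT (coset f) (coset g) = coset (f + g)"
proof -
  have "rep (coset f) + rep (coset g) - (f + g) = (rep (coset f) - f) + (rep (coset g) - g)" by simp
  also have "\<dots> \<in> free_space.span rels" by (intro free_space.span_add rep_coset)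
  finally show ?thesis by (simp add: balanced_tensor_def Let_def coset_eq_iff)
qed

lemma BT_scale: "hscale BT c (coset f) = coset (fscale c f)"
proof -
  have "fscale c (rep (coset f)) - fscale c f = fscale c (rep (coset f) - f)"
    by (rule free_space.scale_right_diff_distrib[symmetric])
  also have "\<dots> \<in> free_space.span rels" by (intro free_space.span_scale rep_coset)
  finally show ?thesis by (simp add: balanced_tensor_def Let_def coset_eq_iff)
qed

lemma BT_inner: "f \<in> supported \<Longrightarrow> g \<in> supported \<Longrightarrow> hinner BT (coset f) (coset g) = tform f g"
  by (simp add: balanced_tensor_def Let_def tform_rep_coset)

lemma BT_dist: "f \<in> supported \<Longrightarrow> g \<in> supported \<Longrightarrow> hdist BT (coset f) (coset g) = sqrt (Re (tform (f - g) (f - g)))"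
  by (simp add: hdist_def Let_def BT_scale BT_plus BT_inner)

lemma pre_hilbert_BT: "pre_hilbert BT"
proof
  fix P Q R and c d :: complex
  show "hzero BT \<in> hcarrier BT" by (simp add: BT_zero)
  assume "P \<in> hcarrier BT"
  then obtain f where f: "f \<in> supported" "P = coset f" by (auto simp: BT_carrier)
  note [simp] = BT_zero BT_plus BT_scale BT_inner f
  show "hscale BT c P \<in> hcarrier BT" by simp
  show "hplus BT (hzero BT) P = P" by simp
  show "hplus BT P (hscale BT (- 1) P) = hzero BT" by simp
  show "hscale BT (c + d) P = hplus BT (hscale BT c P) (hscale BT d P)"
    by (simp add: free_space.scale_left_distrib)
  show "hscale BT c (hscale BT d P) = hscale BT (c * d) P" by (simp add: free_space.scale_scale)
  show "hscale BT 1 P = P" by (simp add: free_space.scale_one)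
  show "0 \<le> Re (hinner BT P P)" by (simp add: tform_nonneg)
  assume "Q \<in> hcarrier BT"
  then obtain g where g: "g \<in> supported" "Q = coset g" by (auto simp: BT_carrier)
  note [simp] = g
  show "hplus BT P Q \<in> hcarrier BT" by simp
  show "hplus BT P Q = hplus BT Q P" by (simp add: add.commute)
  show "hscale BT c (hplus BT P Q) = hplus BT (hscale BT c P) (hscale BT c Q)"
    by (simp add: fscale_add_right)
  show "hinner BT P (hscale BT c Q) = c * hinner BT P Q" by (simp add: tensor_form_fscale_right)
  show "hinner BT Q P = cnj (hinner BT P Q)" by (simp add: tform_cnj[of f g])
  assume "R \<in> hcarrier BT"
  then obtain r where r: "r \<in> supported" "R = coset r" by (auto simp: BT_carrier)
  note [simp] = r
  show "hplus BT (hplus BT P Q) R = hplus BT P (hplus BT Q R)" by (simp add: add.assoc)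
  show "hinner BT P (hplus BT Q R) = hinner BT P Q + hinner BT P R" by (simp add: tensor_form_add_right)
qed

sublocale BT: pre_hilbert BT
  by (rule pre_hilbert_BT)

sublocale IT: pre_hilbert "completion BT"
  by (rule BT.pre_hilbert_completion)

lemma gen_add_left: "h \<in> hcarrier H \<Longrightarrow> coset (gen (x + y) h) = coset (gen x h + gen y h)"
  unfolding coset_eq_iff
  by (rule free_space.span_base) (auto simp: bilinear_relations_def diff_diff_eq[symmetric])

lemma gen_scaleC_left: "h \<in> hcarrier H \<Longrightarrow> coset (gen (scaleC c x) h) = coset (fscale c (gen x h))"
  unfolding coset_eq_iff
  by (rule free_space.span_base) (auto simp: bilinear_relations_def)

lemma hdist_gen_left:
  assumes h: "h \<in> hcarrier H"
  shows "hdist BT (coset (gen x h)) (coset (gen y h)) \<le> norm (x - y) * H.hnorm h"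
proof -
  have "tform (gen x h - gen y h) (gen x h - gen y h) = hinner H h (\<sigma> (ip (x - y) (x - y)) h)"
  proof -
    have "hinner H h (\<sigma> (ip x' (x - y)) h) = hinner H h (\<sigma> (ip x' x) h) - hinner H h (\<sigma> (ip x' y) h)" for x'
    proof -
      have "\<sigma> (ip x' x) h = hplus H (\<sigma> (ip x' (x - y)) h) (\<sigma> (ip x' y) h)"
        using h by (simp add: ip_diff_right flip: rep_add)
      then show ?thesis using h by (simp add: H.inner_simps)
    qed
    moreover have "hinner H h (\<sigma> (ip (x - y) x') h) = hinner H h (\<sigma> (ip x x') h) - hinner H h (\<sigma> (ip y x') h)" for x'
    proof -
      have "\<sigma> (ip x x') h = hplus H (\<sigma> (ip (x - y) x') h) (\<sigma> (ip y x') h)"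
        using h by (simp add: ip_diff_left flip: rep_add)
      then show ?thesis using h by (simp add: H.inner_simps)
    qed
    ultimately show ?thesis
      using h by (simp add: tform_diff_left tensor_form_diff_right tensor_form_gen_left tensor_row_gen)
  qed
  then have "hdist BT (coset (gen x h)) (coset (gen y h)) = sqrt (Re (hinner H h (\<sigma> (ip (x - y) (x - y)) h)))"
    using h by (simp add: BT_dist)
  also have "\<dots> \<le> sqrt ((norm (x - y) * H.hnorm h)\<^sup>2)"
    using rep_form_bound[OF ip_star h, of "x - y"]
    by (simp add: norm_ip_self power_mult_distrib)
  also have "\<dots> = norm (x - y) * H.hnorm h" using h by simp
  finally show ?thesis .
qed

lemma hdist_gen_right:
  assumes h: "h \<in> hcarrier H" "k \<in> hcarrier H"
  shows "hdist BT (coset (gen x h)) (coset (gen x k)) \<le> norm x * hdist H h k"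
proof -
  have "tform (gen x h - gen x k) (gen x h - gen x k) = hinner H (H.hdiff h k) (\<sigma> (ip x x) (H.hdiff h k))"
    using h by (simp add: tform_diff_left tensor_form_diff_right tensor_form_gen_left tensor_row_gen
        rep_hplus rep_hscale H.inner_simps)
  then have "hdist BT (coset (gen x h)) (coset (gen x k)) = sqrt (Re (hinner H (H.hdiff h k) (\<sigma> (ip x x) (H.hdiff h k))))"
    using h by (simp add: BT_dist)
  also have "\<dots> \<le> sqrt ((norm x * hdist H h k)\<^sup>2)"
    using rep_form_bound[OF ip_star, of "H.hdiff h k" x] h
    by (simp add: norm_ip_self power_mult_distrib H.hdist_hnorm)
  also have "\<dots> = norm x * hdist H h k" using h by simp
  finally show ?thesis .
qed

end

section \<open>Density of the span of \<open>BX\<close> passes to the tensor product\<close>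

context represented_module
begin

abbreviation IT :: "(nat \<Rightarrow> (('x \<times> 'h) \<Rightarrow>\<^sub>0 complex) set) set ip_space" where
  "IT \<equiv> completion BT"

abbreviation const_coset :: "(('x \<times> 'h) \<Rightarrow>\<^sub>0 complex) \<Rightarrow> (nat \<Rightarrow> (('x \<times> 'h) \<Rightarrow>\<^sub>0 complex) set) set" where
  "const_coset f \<equiv> BT.const_class (coset f)"

lemma const_coset_zero: "const_coset 0 = hzero IT"
  by (simp add: BT.completion_zero BT_zero)

lemma const_coset_add:
  "f \<in> supported \<Longrightarrow> g \<in> supported \<Longrightarrow> const_coset (f + g) = hplus IT (const_coset f) (const_coset g)"
  by (simp add: BT.completion_plus BT_plus)

lemma const_coset_fscale: "f \<in> supported \<Longrightarrow> const_coset (fscale c f) = hscale IT c (const_coset f)"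
  by (simp add: BT.completion_scale BT_scale)

abbreviation gens :: "(('x \<times> 'h) \<Rightarrow>\<^sub>0 complex) set" where
  "gens \<equiv> {gen x h | x h. h \<in> hcarrier H}"

lemma supported_subset_span: "supported \<subseteq> free_space.span gens"
proof
  fix f assume f: "f \<in> supported"
  have "f = (\<Sum>p\<in>Poly_Mapping.keys f. fscale (Poly_Mapping.lookup f p) (gen (fst p) (snd p)))"
    by (rule poly_mapping_eqI)
      (simp add: lookup_sum lookup_fscale gen_def lookup_single when_def in_keys_iff if_distrib cong: if_cong)
  also have "\<dots> \<in> free_space.span gens"
    using f by (intro free_space.span_sum free_space.span_scale free_space.span_base) (fastforce simp: supported_def)
  finally show "f \<in> free_space.span gens" .
qed

lemma closed_subspace_carrier: "closed_subspace IT (hcarrier IT)"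
  by (auto simp: closed_subspace_def)

lemma acts_nondegenerately_imp_sigma:
  assumes nondeg: "acts_nondegenerately \<phi>"
  shows "acts_sigma_nondegenerately ip act \<phi> H \<sigma>"
proof -
  define S where "S = {const_coset (gen (\<phi> b x) h) | b x h. h \<in> hcarrier H}"
  have "hcarrier IT \<subseteq> M" if M: "closed_subspace IT M" "S \<subseteq> M" for M
  proof -
    have M_add: "u \<in> M \<Longrightarrow> v \<in> M \<Longrightarrow> hplus IT u v \<in> M"
      and M_scale: "u \<in> M \<Longrightarrow> hscale IT c u \<in> M" and M_zero: "hzero IT \<in> M" for u v c
      using M(1) by (auto simp: closed_subspace_def)
    have M_lim: "v \<in> M" if "\<And>n. s n \<in> M" "v \<in> hcarrier IT" "hconverges IT s v" for s v
      using M(1) that unfolding closed_subspace_def by blast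
    have span: "const_coset (gen y h) \<in> M"
      if h: "h \<in> hcarrier H" and y: "y \<in> complex_vector.span {\<phi> b x | b x. True}" for y h
      using y
    proof (induction rule: complex_vector.span_induct_alt)
      case base
      have "coset (gen 0 h) = coset 0" using gen_scaleC_left[OF h, of 0 0] by simp
      then show ?case using M_zero by (simp add: const_coset_zero)
    next
      case (step c z y)
      have "const_coset (gen z h) \<in> M" using step(1) M(2) h by (auto simp: S_def)
      moreover have "const_coset (gen (scaleC c z + y) h) = hplus IT (hscale IT c (const_coset (gen z h))) (const_coset (gen y h))"
      proof -
        have "coset (gen (scaleC c z + y) h) = hplus BT (coset (gen (scaleC c z) h)) (coset (gen y h))"
          by (simp add: gen_add_left h BT_plus)
        also have "coset (gen (scaleC c z) h) = hscale BT c (coset (gen z h))"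
          by (simp add: gen_scaleC_left h BT_scale)
        finally show ?thesis using h by (simp add: BT.completion_plus BT.completion_scale)
      qed
      ultimately show ?case using step(2) by (simp add: M_add M_scale)
    qed
    have gen: "const_coset (gen x h) \<in> M" if h: "h \<in> hcarrier H" for x h
    proof -
      have "x \<in> closure (complex_vector.span {\<phi> b x | b x. True})"
        using nondeg by (simp add: acts_nondegenerately_def)
      then obtain y where y: "\<And>n. y n \<in> complex_vector.span {\<phi> b x | b x. True}" "y \<longlonglongrightarrow> x"
        unfolding closure_sequential by blast
      show ?thesis
      proof (rule M_lim)
        show "const_coset (gen (y n) h) \<in> M" for n using h y(1) by (rule span)
        have "(\<lambda>n. norm (y n - x) * H.hnorm h) \<longlonglongrightarrow> 0"
          using y(2) by (intro tendsto_mult_left_zero tendsto_norm_zero) (simp add: LIM_zero_iff)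
        then show "hconverges IT (\<lambda>n. const_coset (gen (y n) h)) (const_coset (gen x h))"
          unfolding hconverges_def
          by (rule BT.tendsto_zero_le) (use h hdist_gen_left in \<open>auto simp: BT.completion_dist_const\<close>)
      qed (use h in simp)
    qed
    \<comment> \<open>Membership in \<open>supported\<close> is carried through the induction, as
      \<open>const_coset_add\<close> demands it.\<close>
    have all: "f \<in> supported \<and> const_coset f \<in> M" if "f \<in> supported" for f
      using that supported_subset_span
    proof (intro free_space.span_induct_alt[of f "gens" "\<lambda>f. f \<in> supported \<and> const_coset f \<in> M"])
      fix c z f assume "z \<in> gens" "f \<in> supported \<and> const_coset f \<in> M"
      then show "fscale c z + f \<in> supported \<and> const_coset (fscale c z + f) \<in> M"
        using gen by (auto simp: const_coset_add const_coset_fscale M_add M_scale)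
    qed (use M_zero in \<open>auto simp: const_coset_zero\<close>)
    show ?thesis
    proof
      fix P assume P: "P \<in> hcarrier IT"
      then obtain s where s: "hcauchy BT s" "P = completion_class BT s" by (auto simp: BT.completion_carrier)
      show "P \<in> M"
      proof (rule M_lim)
        show "BT.const_class (s n) \<in> M" for n
          using BT.hcauchy_carrier[OF s(1), of n] all by (auto simp: BT_carrier)
        show "hconverges IT (\<lambda>n. BT.const_class (s n)) P"
          unfolding hconverges_def s(2) by (rule BT.completion_dense[OF s(1)])
      qed (rule P)
    qed
  qed
  moreover have "S \<subseteq> hcarrier IT" by (auto simp: S_def)
  ultimately have "closed_subspace_generated IT S = hcarrier IT"
    unfolding closed_subspace_generated_def using closed_subspace_carrier by blast
  then show ?thesis
    by (simp add: acts_sigma_nondegenerately_def interior_tensor_def elementary_tensor_def S_def)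
qed

end


section \<open>The GNS construction\<close>

text \<open>Transport of structure along \<open>j\<close>. It will move the GNS completion, whose
  points are sets of sequences, into \<open>'a \<Rightarrow> complex\<close>.\<close>

definition image_space :: "('k \<Rightarrow> 'h) \<Rightarrow> 'k ip_space \<Rightarrow> 'h ip_space" where
  "image_space j K = (let i = inv_into (hcarrier K) j in \<lparr>
     hcarrier = j ` hcarrier K,
     hplus = (\<lambda>u v. j (hplus K (i u) (i v))),
     hzero = j (hzero K),
     hscale = (\<lambda>c u. j (hscale K c (i u))),
     hinner = (\<lambda>u v. hinner K (i u) (i v)) \<rparr>)"

context
  fixes K :: "'k ip_space" and j :: "'k \<Rightarrow> 'h"
  assumes K: "hilbert_space K" and inj: "inj_on j (hcarrier K)"
begin

interpretation K: hilbert_space K by (rule K)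

lemma image_space_simps:
  "hcarrier (image_space j K) = j ` hcarrier K"
  "hzero (image_space j K) = j (hzero K)"
  "P \<in> hcarrier K \<Longrightarrow> Q \<in> hcarrier K \<Longrightarrow> hplus (image_space j K) (j P) (j Q) = j (hplus K P Q)"
  "P \<in> hcarrier K \<Longrightarrow> hscale (image_space j K) c (j P) = j (hscale K c P)"
  "P \<in> hcarrier K \<Longrightarrow> Q \<in> hcarrier K \<Longrightarrow> hinner (image_space j K) (j P) (j Q) = hinner K P Q"
  using inj by (auto simp: image_space_def Let_def)

lemma image_space_dist:
  "P \<in> hcarrier K \<Longrightarrow> Q \<in> hcarrier K \<Longrightarrow> hdist (image_space j K) (j P) (j Q) = hdist K P Q"
  by (simp add: hdist_def Let_def image_space_simps K.hplus_closed K.hscale_closed)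

lemma hilbert_space_image: "hilbert_space (image_space j K)"
proof -
  have complete: "\<exists>v\<in>hcarrier (image_space j K). hconverges (image_space j K) s v"
    if s: "hcauchy (image_space j K) s" for s
  proof -
    have "\<forall>n. \<exists>P. P \<in> hcarrier K \<and> s n = j P"
      using s by (auto simp: hcauchy_def image_space_simps)
    from choice[OF this] obtain t where t: "\<And>n. t n \<in> hcarrier K" "\<And>n. s n = j (t n)" by blast
    have "hcauchy K t" using s t by (simp add: hcauchy_def image_space_dist)
    then obtain P where P: "P \<in> hcarrier K" "hconverges K t P" using K.hcomplete by blast
    then have "hconverges (image_space j K) s (j P)"
      by (simp add: hconverges_def image_space_dist t)
    then show ?thesis using P by (auto simp: image_space_simps)
  qed
  note [simp] = image_space_simps K.hplus_closed K.hzero_closed K.hscale_closed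
  show ?thesis
  proof (rule hilbert_space.intro)
    let ?H = "image_space j K"
    show "hinner ?H v u = cnj (hinner ?H u v)" if "u \<in> hcarrier ?H" "v \<in> hcarrier ?H" for u v
      using that by (auto intro: K.hinner_cnj)
    show "hplus ?H u v = hplus ?H v u" if uv: "u \<in> hcarrier ?H" "v \<in> hcarrier ?H" for u v
    proof -
      obtain P Q where PQ: "P \<in> hcarrier K" "Q \<in> hcarrier K" "u = j P" "v = j Q" using uv by auto
      then show ?thesis using K.hplus_commute[OF PQ(1,2)] by simp
    qed
    show "u = hzero ?H" if "u \<in> hcarrier ?H" "hinner ?H u u = 0" for u
      using that K.hinner_definite by auto
  qed (use complete in \<open>auto simp: K.hplus_assoc K.hplus_zero K.hplus_minus K.hscale_plus
        K.hscale_add K.hscale_hscale K.hscale_one K.hinner_plus K.hinner_scale K.hinner_nonneg\<close>)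
qed

lemma cstar_representation_image:
  assumes "cstar_representation K \<sigma>"
  shows "cstar_representation (image_space j K) (\<lambda>a u. j (\<sigma> a (inv_into (hcarrier K) j u)))"
proof -
  have i: "inv_into (hcarrier K) j (j P) = P" if "P \<in> hcarrier K" for P using inj that by simp
  have bd: "\<And>a. bounded_operator K (\<sigma> a)" using assms by (simp add: cstar_representation_def)
  have c: "\<sigma> a P \<in> hcarrier K" if "P \<in> hcarrier K" for a P
    using bd that by (simp add: bounded_operator_def)
  note [simp] = image_space_simps K.hplus_closed K.hzero_closed K.hscale_closed i c image_space_dist
  have "bounded_operator (image_space j K) (\<lambda>u. j (\<sigma> a (inv_into (hcarrier K) j u)))" for a
    using bd[of a] unfolding bounded_operator_def by auto
  then show ?thesis
    using assms unfolding cstar_representation_def by auto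
qed

end

definition functional_space :: "('a::cstar_algebra \<Rightarrow> complex) \<Rightarrow> 'a ip_space" where
  "functional_space F = \<lparr>hcarrier = UNIV, hplus = (+), hzero = 0, hscale = scaleC,
     hinner = (\<lambda>a b. F (star a * b))\<rparr>"

lemma functional_space_simps [simp]:
  "hcarrier (functional_space F) = UNIV"
  "hplus (functional_space F) = (+)"
  "hzero (functional_space F) = 0"
  "hscale (functional_space F) = scaleC"
  "hinner (functional_space F) a b = F (star a * b)"
  by (simp_all add: functional_space_def)

section \<open>The GNS space of a positive functional\<close>

locale positive_functional =
  fixes F :: "'a::cstar_algebra \<Rightarrow> complex"
  assumes F_add: "F (a + b) = F a + F b"
    and F_scaleC: "F (scaleC c a) = c * F a"
    and F_star: "F (star a) = cnj (F a)"
    and F_nonneg: "0 \<le> Re (F (star a * a))"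
begin

lemma F_diff: "F (a - b) = F a - F b"
  using F_add[of "a - b" b] by simp

abbreviation V :: "'a ip_space" where
  "V \<equiv> functional_space F"

lemma scaleC_minus_one: "scaleC (- 1) a = - (a :: 'a)"
  by (simp add: complex_vector.scale_minus_left scaleC_one)

sublocale V: pre_hilbert V
proof
  fix u v :: 'a
  have "hinner V v u = F (star (star u * v))" by (simp add: star_simps)
  then show "hinner V v u = cnj (hinner V u v)" by (simp add: F_star)
qed (auto simp: add.assoc add.commute scaleC_minus_one scaleC_add_left scaleC_add_right scaleC_scaleC scaleC_one
    distrib_left F_add mult_scaleC_right F_scaleC F_nonneg)

lemma hdist_V: "hdist V a b = V.hnorm (a - b)"
  by (simp add: V.hdist_hnorm scaleC_minus_one)

text \<open>For \<open>norm c < 1\<close> write formally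
  \<open>1 - star c * c = (1 - b)\<^sup>2\<close>; then
  \<open>star a * a - star (c * a) * (c * a)\<close> is the inner square of
  \<open>a - b * a\<close>. Left multiplication therefore extends to the completion.\<close>

lemma hnorm_mult_le: "V.hnorm (c * a) \<le> norm c * V.hnorm a"
proof -
  have lt1: "V.hnorm (c * a) \<le> V.hnorm a" if c: "norm c < 1" for c
  proof -
    have "norm (star c * c) < 1" using c by (simp add: cstar_identity abs_square_less_1)
    moreover have "star (star c * c) = star c * c" by (simp add: star_simps)
    ultimately obtain b where b: "star b = b" "star c * c = 2 *\<^sub>R b - b * b"
      using selfadjoint_one_minus_sqrt by metis
    have "star a * a - star (c * a) * (c * a) = star (a - b * a) * (a - b * a)"
    proof -
      have "star (c * a) * (c * a) = star a * (star c * c) * a" by (simp add: star_simps mult.assoc)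
      then show ?thesis by (simp add: b star_simps) (simp add: algebra_simps scaleR_2)
    qed
    then have "0 \<le> Re (F (star a * a)) - Re (F (star (c * a) * (c * a)))"
      using F_nonneg[of "a - b * a"] by (metis F_diff minus_complex.simps(1))
    then show ?thesis by (simp add: V.hnorm_def)
  qed
  show ?thesis
  proof (rule field_le_epsilon)
    fix e :: real assume "0 < e"
    define r where "r = norm c + e / (V.hnorm a + 1)"
    have n: "0 \<le> V.hnorm a" by simp
    then have pos: "0 < V.hnorm a + 1" by linarith
    then have r: "norm c < r" "0 < r" using \<open>0 < e\<close> by (auto simp: r_def add_nonneg_pos)
    have "V.hnorm (((1 / r) *\<^sub>R c) * a) \<le> V.hnorm a" using r by (intro lt1) simp
    moreover have "V.hnorm (((1 / r) *\<^sub>R c) * a) = (1 / r) * V.hnorm (c * a)"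
      using V.hnorm_scale[of "c * a" "complex_of_real (1 / r)"] r by (simp add: scaleC_of_real del: of_real_divide)
    ultimately have "(1 / r) * V.hnorm (c * a) \<le> V.hnorm a" by (simp only:)
    then have "V.hnorm (c * a) \<le> r * V.hnorm a" using r by (simp add: field_simps)
    also have "\<dots> = norm c * V.hnorm a + e * (V.hnorm a / (V.hnorm a + 1))"
      by (simp add: r_def algebra_simps)
    also have "\<dots> \<le> norm c * V.hnorm a + e * 1"
      using \<open>0 < e\<close> by (intro add_left_mono mult_left_mono) (simp_all add: pos_divide_le_eq[OF pos])
    finally show "V.hnorm (c * a) \<le> norm c * V.hnorm a + e" by simp
  qed
qed

abbreviation K :: "(nat \<Rightarrow> 'a) set ip_space" where
  "K \<equiv> completion V"

sublocale K: hilbert_space K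
  by (rule V.hilbert_space_completion)

sublocale K: pre_hilbert K
  by (rule V.pre_hilbert_completion)

definition left_action :: "'a \<Rightarrow> (nat \<Rightarrow> 'a) set \<Rightarrow> (nat \<Rightarrow> 'a) set" where
  "left_action c P = V.cc (\<lambda>n. c * rep P n)"

lemma hdist_mult_le: "hdist V (c * a) (c * b) \<le> norm c * hdist V a b"
  using hnorm_mult_le[of c "a - b"] by (simp add: hdist_V right_diff_distrib)

lemma hcauchy_mult: "hcauchy V s \<Longrightarrow> hcauchy V (\<lambda>n. c * s n)"
  by (rule V.hcauchy_lipschitz[where K="norm c"]) (auto simp: hdist_mult_le)

lemma left_action_cc:
  assumes s: "hcauchy V s"
  shows "left_action c (V.cc s) = V.cc (\<lambda>n. c * s n)"
proof -
  note r = V.rep_cc[OF s]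
  have "V.equiv_seq (\<lambda>n. c * rep (V.cc s) n) (\<lambda>n. c * s n)"
    by (rule V.equiv_seq_lipschitz[OF r(1) s V.equiv_seq_sym[OF s r], where K="norm c"])
      (auto simp: hdist_mult_le)
  then show ?thesis
    using s r(1) by (simp add: left_action_def V.cc_eq_iff hcauchy_mult)
qed

lemma left_action_const: "left_action c (V.const_class a) = V.const_class (c * a)"
  by (simp add: left_action_cc)

lemma left_action_bounded:
  assumes "P \<in> hcarrier K"
  shows "hdist K (left_action c P) (hzero K) \<le> norm c * hdist K P (hzero K)"
proof -
  obtain s where s: "hcauchy V s" "P = V.cc s" using assms by (auto simp: V.completion_carrier)
  have z: "hcauchy V (\<lambda>_. 0)" by simp
  have "(\<lambda>n. hdist V (c * s n) 0) \<longlonglongrightarrow> hdist K (left_action c P) (hzero K)"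
    using V.completion_dist_tendsto[OF hcauchy_mult[OF s(1), of c] z] s
    by (simp add: left_action_cc V.completion_zero)
  moreover have "(\<lambda>n. norm c * hdist V (s n) 0) \<longlonglongrightarrow> norm c * hdist K P (hzero K)"
    using V.completion_dist_tendsto[OF s(1) z] s by (intro tendsto_intros) (simp add: V.completion_zero)
  ultimately show ?thesis
    by (rule LIMSEQ_le) (use hdist_mult_le[of c _ 0] in auto)
qed

lemma cstar_representation_left_action: "cstar_representation K left_action"
  unfolding cstar_representation_def bounded_operator_def
proof (intro conjI allI ballI)
  fix c d :: 'a and z :: complex and P Q
  assume "P \<in> hcarrier K"
  then obtain s where s: "hcauchy V s" "P = V.cc s" by (auto simp: V.completion_carrier)
  note [simp] = s left_action_cc hcauchy_mult V.completion_plus V.completion_scale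
  have plus [simp]: "hcauchy V f \<Longrightarrow> hcauchy V g \<Longrightarrow> hcauchy V (\<lambda>n. f n + g n)" for f g
    using V.hcauchy_plus[of f g] by simp
  have scale [simp]: "hcauchy V f \<Longrightarrow> hcauchy V (\<lambda>n. scaleC z (f n))" for f z
    using V.hcauchy_scale[of f z] by simp
  show "left_action c P \<in> hcarrier K" by simp
  show "left_action c (hscale K z P) = hscale K z (left_action c P)" by (simp add: mult_scaleC_right)
  show "left_action (c + d) P = hplus K (left_action c P) (left_action d P)" by (simp add: distrib_right)
  show "left_action (scaleC z c) P = hscale K z (left_action c P)" by (simp add: mult_scaleC_left)
  show "left_action (c * d) P = left_action c (left_action d P)" by (simp add: mult.assoc)
  assume "Q \<in> hcarrier K"
  then obtain t where t: "hcauchy V t" "Q = V.cc t" by (auto simp: V.completion_carrier)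
  note [simp] = t
  show "left_action c (hplus K P Q) = hplus K (left_action c P) (left_action c Q)" by (simp add: distrib_left)
  have "hinner V (c * s n) (t n) = hinner V (s n) (star c * t n)" for n by (simp add: star_simps mult.assoc)
  then show "hinner K (left_action c P) Q = hinner K P (left_action (star c) Q)"
    using V.completion_inner_tendsto[of s "\<lambda>n. star c * t n"]
    by simp (rule V.completion_inner_eq, auto)
qed (use left_action_bounded in blast)

text \<open>A point of the completion is determined by its inner products with the dense classes of
  constants, so this map is injective on the carrier.\<close>

definition gns_vector :: "(nat \<Rightarrow> 'a) set \<Rightarrow> 'a \<Rightarrow> complex" where
  "gns_vector P = (\<lambda>a. hinner K (V.const_class a) P)"

lemma inj_gns_vector: "inj_on gns_vector (hcarrier K)"
proof (rule inj_onI)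
  fix P Q assume PQ: "P \<in> hcarrier K" "Q \<in> hcarrier K" and "gns_vector P = gns_vector Q"
  then have eq: "hinner K (V.const_class a) P = hinner K (V.const_class a) Q" for a
    unfolding gns_vector_def by metis
  define D where "D = K.hdiff P Q"
  have D: "D \<in> hcarrier K" using PQ by (simp add: D_def)
  have orth: "hinner K (V.const_class a) D = 0" for a
    using PQ eq[of a] by (simp add: D_def K.inner_simps)
  have "K.hnorm D \<le> e" if e: "0 < e" for e
  proof -
    obtain a where a: "hdist K D (V.const_class a) < e"
      using V.completion_approx[OF D e] by blast
    \<comment> \<open>\<open>D\<close> is orthogonal to all classes of constants, one of which is
      close to \<open>D\<close>.\<close>
    have "(K.hnorm D)\<^sup>2 = Re (hinner K (K.hdiff D (V.const_class a)) D)"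
      using D orth[of a] by (simp add: K.hnorm_square K.inner_simps)
    also have "\<dots> \<le> K.hnorm (K.hdiff D (V.const_class a)) * K.hnorm D"
      using D by (intro order_trans[OF complex_Re_le_cmod] K.cauchy_schwarz) auto
    also have "\<dots> = hdist K D (V.const_class a) * K.hnorm D" by (simp add: K.hdist_hnorm)
    also have "\<dots> \<le> e * K.hnorm D" using a D by (intro mult_right_mono) auto
    finally have "K.hnorm D * K.hnorm D \<le> e * K.hnorm D" by (simp add: power2_eq_square)
    then show ?thesis using e K.hnorm_ge_zero[OF D] by (cases "K.hnorm D = 0") auto
  qed
  then have "K.hnorm D \<le> 0" by (rule field_le_epsilon[where y=0, simplified])
  then have "K.hnorm D = 0" using K.hnorm_ge_zero[OF D] by simp
  then have "D = hzero K" using D by (intro K.hinner_definite) (auto simp: K.inner_self)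
  have "P = hplus K (hplus K P (hscale K (- 1) Q)) Q"
  proof -
    have "hplus K (hplus K P (hscale K (- 1) Q)) Q = hplus K P (hplus K Q (hscale K (- 1) Q))"
      using PQ by (simp add: K.plus_assoc K.plus_commute[of Q])
    also have "\<dots> = P" using PQ by (simp add: K.plus_minus K.plus_commute[of P] K.plus_zero)
    finally show ?thesis ..
  qed
  also have "\<dots> = Q" using \<open>D = hzero K\<close> PQ by (simp add: D_def K.plus_zero)
  finally show "P = Q" .
qed

text \<open>Without a unit there is no evident cyclic vector; its place is taken by the dense family
  \<open>e a\<close>, where \<open>e a\<close> comes from the class of the constant
  \<open>a\<close>.\<close>

theorem gns:
  obtains H :: "('a \<Rightarrow> complex) ip_space" and \<sigma> e
  where "hilbert_space H" "cstar_representation H \<sigma>" "\<And>a. e a \<in> hcarrier H"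
    "\<And>a b. hinner H (e a) (e b) = F (star a * b)" "\<And>c a. \<sigma> c (e a) = e (c * a)"
    "\<And>h \<epsilon>. h \<in> hcarrier H \<Longrightarrow> 0 < \<epsilon> \<Longrightarrow> \<exists>a. hdist H h (e a) < \<epsilon>"
proof
  let ?H = "image_space gns_vector K"
  let ?e = "\<lambda>a. gns_vector (V.const_class a)"
  note simps = image_space_simps[OF K.hilbert_space_axioms inj_gns_vector]
    image_space_dist[OF K.hilbert_space_axioms inj_gns_vector]
  show "hilbert_space ?H" by (rule hilbert_space_image[OF K.hilbert_space_axioms inj_gns_vector])
  show "cstar_representation ?H (\<lambda>a u. gns_vector (left_action a (inv_into (hcarrier K) gns_vector u)))"
    by (rule cstar_representation_image[OF K.hilbert_space_axioms inj_gns_vector cstar_representation_left_action])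
  show "?e a \<in> hcarrier ?H" for a by (simp add: simps)
  show "hinner ?H (?e a) (?e b) = F (star a * b)" for a b
    by (simp add: simps V.completion_inner_const)
  show "gns_vector (left_action c (inv_into (hcarrier K) gns_vector (?e a))) = ?e (c * a)" for c a
    using inj_gns_vector by (simp add: left_action_const)
  show "\<exists>a. hdist ?H h (?e a) < \<epsilon>" if h: "h \<in> hcarrier ?H" "0 < \<epsilon>" for h \<epsilon>
  proof -
    obtain P where P: "P \<in> hcarrier K" "h = gns_vector P" using h(1) by (auto simp: simps)
    obtain a where "hdist K P (V.const_class a) < \<epsilon>" using V.completion_approx[OF P(1) h(2)] by blast
    then show ?thesis using P by (auto simp: simps)
  qed
qed

end

section \<open>Nondegeneracy\<close>

context hilbert_module
begin

text \<open>The square of \<open>norm (x - act x m)\<close> is the norm that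
  \<open>approximate_unit_pos\<close> bounds for \<open>k = ip x x\<close>; with the parameter
  \<open>e\<^sup>2 / 4\<close> the bound is \<open>e\<^sup>2 / 2\<close>.\<close>

lemma act_approximates:
  assumes "0 < e"
  obtains m where "norm (x - act x m) < e"
proof -
  obtain b where b: "ip x x = star b * b" using ip_positive[of x] by (auto simp: cstar_positive_def)
  have "0 < e\<^sup>2 / 4" using assms by simp
  from b this obtain m where m: "norm (ip x x - ip x x * m - star m * ip x x + star m * ip x x * m) \<le> 2 * (e\<^sup>2 / 4)"
    by (rule approximate_unit_pos)
  have "(norm (x - act x m))\<^sup>2 = norm (ip x x - ip x x * m - star m * ip x x + star m * ip x x * m)"
    unfolding norm_ip_self[symmetric] by (simp add: ip_simps algebra_simps)
  also have "\<dots> \<le> 2 * (e\<^sup>2 / 4)" by (rule m)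
  also have "\<dots> < e\<^sup>2" using assms by simp
  finally have "norm (x - act x m) < e" by (rule power_less_imp_less_base) (use assms in simp)
  then show ?thesis by (rule that)
qed

text \<open>A rotation cancels the mixed terms. It serves to merge two generators of a cone into
  one, the second term on the left being positive.\<close>

lemma ip_rotate:
  assumes "c\<^sup>2 + s\<^sup>2 = 1"
  shows "ip (c *\<^sub>R u + s *\<^sub>R v) (c *\<^sub>R u + s *\<^sub>R v) + ip (c *\<^sub>R v - s *\<^sub>R u) (c *\<^sub>R v - s *\<^sub>R u) = ip u u + ip v v"
proof -
  have "ip (c *\<^sub>R u + s *\<^sub>R v) (c *\<^sub>R u + s *\<^sub>R v) + ip (c *\<^sub>R v - s *\<^sub>R u) (c *\<^sub>R v - s *\<^sub>R u)
      = (c\<^sup>2 + s\<^sup>2) *\<^sub>R (ip u u + ip v v)"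
    by (simp add: ip_simps power2_eq_square algebra_simps)
  then show ?thesis by (simp add: assms)
qed

text \<open>
  The cone generated by the elements \<open>\<langle>x - y, x - y\<rangle>\<close> for \<open>y \<in> Y\<close> and the positive elements
  stays away from \<open>0\<close>: rotations show that a sum of two generators is again a generator.
\<close>

lemma separating_functional:
  assumes Y: "complex_vector.subspace Y" and d: "0 < d" "\<And>y. y \<in> Y \<Longrightarrow> d \<le> norm (x - y)"
  obtains f where "linear f" "\<And>b. 0 \<le> f (star b * b)" "\<And>y. y \<in> Y \<Longrightarrow> d\<^sup>2 \<le> f (ip (x - y) (x - y))"
proof -
  have Y0: "0 \<in> Y" and Y_add: "\<And>y z. y \<in> Y \<Longrightarrow> z \<in> Y \<Longrightarrow> y + z \<in> Y"
    and Y_scaleR: "\<And>y r. y \<in> Y \<Longrightarrow> r *\<^sub>R y \<in> Y"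
    using Y by (auto simp: complex_vector.subspace_def scaleR_scaleC)
  \<comment> \<open>The second component is the value demanded of the functional,
    \<open>t\<^sup>2 d\<^sup>2\<close> if \<open>x\<close> occurs with factor \<open>t\<close>:
    \<open>t = 1\<close> is the goal, and \<open>t = 0\<close> covers the positive elements.\<close>
  define K where "K = {(ip (t *\<^sub>R x - y) (t *\<^sub>R x - y) + r, t\<^sup>2 * d\<^sup>2) | t y r. y \<in> Y \<and> r \<in> pos_cone}"
  have KI: "(ip (t *\<^sub>R x - y) (t *\<^sub>R x - y) + r, t\<^sup>2 * d\<^sup>2) \<in> K" if "y \<in> Y" "r \<in> pos_cone" for t y r
    using that by (auto simp: K_def)
  have KE: "\<exists>t y r. y \<in> Y \<and> r \<in> pos_cone \<and> k = ip (t *\<^sub>R x - y) (t *\<^sub>R x - y) + r \<and> \<mu> = t\<^sup>2 * d\<^sup>2" if "(k, \<mu>) \<in> K" for k \<mu>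
    using that by (auto simp: K_def)
  have zero: "(0, 0) \<in> K" using KI[OF Y0 pos_cone_zero, of 0] ip_scaleR_left[of 0 0 0] by simp
  have add: "(k + l, \<mu> + \<nu>) \<in> K" if kl: "(k, \<mu>) \<in> K" "(l, \<nu>) \<in> K" for k \<mu> l \<nu>
  proof -
    obtain t y r where k: "y \<in> Y" "r \<in> pos_cone" "k = ip (t *\<^sub>R x - y) (t *\<^sub>R x - y) + r" "\<mu> = t\<^sup>2 * d\<^sup>2"
      using KE[OF kl(1)] by blast
    obtain s z q where l: "z \<in> Y" "q \<in> pos_cone" "l = ip (s *\<^sub>R x - z) (s *\<^sub>R x - z) + q" "\<nu> = s\<^sup>2 * d\<^sup>2"
      using KE[OF kl(2)] by blast
    \<comment> \<open>The second components dictate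
      \<open>T\<^sup>2 = t\<^sup>2 + s\<^sup>2\<close>; the rotation by \<open>c = t / T\<close> and
      \<open>c' = s / T\<close> then makes the factor of \<open>x\<close> equal to
      \<open>T\<close>.\<close>
    define T where "T = sqrt (t\<^sup>2 + s\<^sup>2)"
    have T2: "T\<^sup>2 = t\<^sup>2 + s\<^sup>2" by (simp add: T_def)
    have "\<exists>w\<in>Y. \<exists>p\<in>pos_cone. ip (t *\<^sub>R x - y) (t *\<^sub>R x - y) + ip (s *\<^sub>R x - z) (s *\<^sub>R x - z)
        = ip (T *\<^sub>R x - w) (T *\<^sub>R x - w) + p"
    proof (cases "T = 0")
      case True
      then have "t = 0" "s = 0" using T2 by (simp_all add: sum_power2_eq_zero_iff)
      then show ?thesis using True k(1) ip_self_pos_cone by blast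
    next
      case False
      define c where "c = t / T"
      define c' where "c' = s / T"
      have "c\<^sup>2 + c'\<^sup>2 = (t\<^sup>2 + s\<^sup>2) / T\<^sup>2" by (simp add: c_def c'_def power_divide add_divide_distrib)
      also have "\<dots> = 1" using False by (simp flip: T2)
      finally have cc: "c\<^sup>2 + c'\<^sup>2 = 1" .
      have T: "c * t + c' * s = T"
      proof -
        have "c * t + c' * s = (t\<^sup>2 + s\<^sup>2) / T"
          by (simp add: c_def c'_def power2_eq_square add_divide_distrib)
        also have "\<dots> = T" unfolding T2[symmetric] using False by (simp add: power2_eq_square)
        finally show ?thesis .
      qed
      define w where "w = c *\<^sub>R y + c' *\<^sub>R z"
      have "c *\<^sub>R (t *\<^sub>R x - y) + c' *\<^sub>R (s *\<^sub>R x - z) = T *\<^sub>R x - w"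
        unfolding T[symmetric] w_def by (simp add: algebra_simps)
      moreover have "w \<in> Y" using k(1) l(1) by (simp add: w_def Y_add Y_scaleR)
      ultimately show ?thesis using ip_rotate[OF cc, of "t *\<^sub>R x - y" "s *\<^sub>R x - z"] ip_self_pos_cone by metis
    qed
    then obtain w p where w: "w \<in> Y" "p \<in> pos_cone" "ip (t *\<^sub>R x - y) (t *\<^sub>R x - y) + ip (s *\<^sub>R x - z) (s *\<^sub>R x - z)
        = ip (T *\<^sub>R x - w) (T *\<^sub>R x - w) + p"
      by blast
    have "k + l = (ip (t *\<^sub>R x - y) (t *\<^sub>R x - y) + ip (s *\<^sub>R x - z) (s *\<^sub>R x - z)) + (r + q)"
      by (simp add: k(3) l(3))
    then have "k + l = ip (T *\<^sub>R x - w) (T *\<^sub>R x - w) + (p + (r + q))" by (simp add: w(3) add.assoc)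
    moreover have "\<mu> + \<nu> = T\<^sup>2 * d\<^sup>2" by (simp add: T2 k(4) l(4) distrib_right)
    ultimately show ?thesis
      using KI[OF w(1) pos_cone_add[OF w(2) pos_cone_add[OF k(2) l(2)]], of T] by simp
  qed
  have scale: "(a *\<^sub>R k, a * \<mu>) \<in> K" if k\<mu>: "(k, \<mu>) \<in> K" and a: "0 < a" for k \<mu> a
  proof -
    obtain t y r where k: "y \<in> Y" "r \<in> pos_cone" "k = ip (t *\<^sub>R x - y) (t *\<^sub>R x - y) + r" "\<mu> = t\<^sup>2 * d\<^sup>2"
      using KE[OF k\<mu>] by blast
    have "(sqrt a * t) *\<^sub>R x - sqrt a *\<^sub>R y = sqrt a *\<^sub>R (t *\<^sub>R x - y)" by (simp add: scaleR_diff_right)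
    then have "ip ((sqrt a * t) *\<^sub>R x - sqrt a *\<^sub>R y) ((sqrt a * t) *\<^sub>R x - sqrt a *\<^sub>R y)
        = (sqrt a * sqrt a) *\<^sub>R ip (t *\<^sub>R x - y) (t *\<^sub>R x - y)"
      by (simp only: ip_scaleR_left ip_scaleR_right scaleR_scaleR)
    then show ?thesis
      using KI[OF Y_scaleR[OF k(1), of "sqrt a"] pos_cone_scaleR[OF k(2), of a], of "sqrt a * t"] a
      by (simp add: k(3,4) scaleR_add_right power_mult_distrib mult.assoc)
  qed
  \<comment> \<open>The hypothesis on \<open>d\<close>, scaled by \<open>t\<close>, bounds the
    generator from below, and adding the positive \<open>r\<close> does not lower the norm.\<close>
  have bound: "\<mu> \<le> norm k" if k\<mu>: "(k, \<mu>) \<in> K" for k \<mu>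
  proof -
    obtain t y r where k: "y \<in> Y" "r \<in> pos_cone" "k = ip (t *\<^sub>R x - y) (t *\<^sub>R x - y) + r" "\<mu> = t\<^sup>2 * d\<^sup>2"
      using KE[OF k\<mu>] by blast
    have "\<bar>t\<bar> * d \<le> norm (t *\<^sub>R x - y)"
    proof (cases "t = 0")
      case False
      have "d \<le> norm (x - (1 / t) *\<^sub>R y)" using k(1) by (intro d(2) Y_scaleR)
      then have "\<bar>t\<bar> * d \<le> norm (t *\<^sub>R (x - (1 / t) *\<^sub>R y))" by (simp add: mult_left_mono)
      then show ?thesis using False by (simp add: scaleR_diff_right)
    qed simp
    then have "(\<bar>t\<bar> * d)\<^sup>2 \<le> (norm (t *\<^sub>R x - y))\<^sup>2" using d(1) by (intro power_mono) auto
    then have "\<mu> \<le> norm (ip (t *\<^sub>R x - y) (t *\<^sub>R x - y))"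
      by (simp only: k(4) norm_ip_self power_mult_distrib power2_abs)
    also have "\<dots> \<le> norm k"
      unfolding k(3) using ip_self_pos_cone k(2) by (rule norm_le_norm_add_pos_cone)
    finally show ?thesis .
  qed
  obtain f where f: "linear f" "\<And>k \<mu>. (k, \<mu>) \<in> K \<Longrightarrow> \<mu> \<le> f k"
    using linear_functional_above_cone[of K] zero add scale bound by blast
  show ?thesis
  proof
    show "0 \<le> f (star b * b)" for b
      using f(2)[OF KI[OF Y0 pos_cone_star_mult, of 0 b]] ip_scaleR_left[of 0 0 0] by simp
    show "d\<^sup>2 \<le> f (ip (x - y) (x - y))" if "y \<in> Y" for y
      using f(2)[OF KI[OF that pos_cone_zero, of 1]] by simp
  qed (rule f)
qed

end

text \<open>The hermitian part of a real-linear functional, extended to a complex-linear one.\<close>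

definition complexify :: "('a::cstar_algebra \<Rightarrow> real) \<Rightarrow> 'a \<Rightarrow> complex" where
  "complexify f a = (let g = (\<lambda>a. (f a + f (star a)) / 2) in Complex (g a) (- g (scaleC \<i> a)))"

lemma complexify_selfadjoint: "star a = a \<Longrightarrow> Re (complexify f a) = f a"
  by (simp add: complexify_def)

lemma positive_functional_complexify:
  assumes f: "linear f" and nonneg: "\<And>b. 0 \<le> f (star b * b)"
  shows "positive_functional (complexify f)"
proof
  define g where "g a = (f a + f (star a)) / 2" for a
  have F: "complexify f a = Complex (g a) (- g (scaleC \<i> a))" for a
    by (simp add: complexify_def g_def)
  have g_add: "g (a + b) = g a + g b" for a b
    by (simp add: g_def star_simps linear_add[OF f] field_simps)
  have g_scaleR: "g (r *\<^sub>R a) = r * g a" for r a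
    by (simp add: g_def star_simps linear_cmul[OF f] field_simps)
  have g_star: "g (star a) = g a" for a by (simp add: g_def star_simps)
  have neg: "scaleC (- c) a = (- 1) *\<^sub>R scaleC c a" for c and a :: 'a
    by (simp add: scaleR_scaleC scaleC_scaleC)
  fix a b :: 'a and c :: complex
  show "complexify f (a + b) = complexify f a + complexify f b"
    by (simp add: F g_add scaleC_add_right complex_eq_iff)
  have "scaleC c a = Re c *\<^sub>R a + Im c *\<^sub>R scaleC \<i> a"
    unfolding scaleR_scaleC scaleC_scaleC scaleC_add_left[symmetric] by (simp add: complex_eq mult.commute)
  moreover have "scaleC \<i> (scaleC c a) = Re c *\<^sub>R scaleC \<i> a + (- Im c) *\<^sub>R a"
    unfolding scaleR_scaleC scaleC_scaleC scaleC_add_left[symmetric]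
    by (rule arg_cong[where f="\<lambda>z. scaleC z a"]) (simp add: complex_eq_iff)
  ultimately show "complexify f (scaleC c a) = c * complexify f a"
    by (simp only: F g_add g_scaleR) (simp add: complex_eq_iff)
  have "star (scaleC \<i> (star a)) = (- 1) *\<^sub>R scaleC \<i> a" by (simp add: star_simps neg)
  then have "g (scaleC \<i> (star a)) = - g (scaleC \<i> a)"
    using g_star[of "scaleC \<i> (star a)"] g_scaleR[of "- 1" "scaleC \<i> a"] by simp
  then show "complexify f (star a) = cnj (complexify f a)" by (simp add: F g_star complex_eq_iff)
  show "0 \<le> Re (complexify f (star a * a))"
    using nonneg[of a] by (simp add: complexify_selfadjoint star_simps)
qed

section \<open>Distances in the tensor product with a GNS space\<close>

locale gns_module = represented_module ip act H \<sigma> + positive_functional F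
  for ip :: "'x::complex_banach \<Rightarrow> 'x \<Rightarrow> 'a::cstar_algebra" and act :: "'x \<Rightarrow> 'a \<Rightarrow> 'x"
    and H :: "'h ip_space" and \<sigma> and F :: "'a \<Rightarrow> complex" +
  fixes e :: "'a \<Rightarrow> 'h"
  assumes e_closed [simp]: "e a \<in> hcarrier H"
    and e_inner: "hinner H (e a) (e b) = F (star a * b)"
    and e_rep: "\<sigma> c (e a) = e (c * a)"
    and e_dense: "h \<in> hcarrier H \<Longrightarrow> 0 < \<epsilon> \<Longrightarrow> \<exists>a. hdist H h (e a) < \<epsilon>"
begin

text \<open>\<open>realizes f z\<close> says that \<open>f\<close> and \<open>z\<close> correspond under the isometry \<open>x \<otimes> e a \<mapsto> x a\<close>.\<close>

definition realizes :: "(('x \<times> 'h) \<Rightarrow>\<^sub>0 complex) \<Rightarrow> 'x \<Rightarrow> bool" where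
  "realizes f z \<longleftrightarrow> f \<in> supported \<and>
     (\<forall>x a. tform (gen x (e a)) f = F (ip (act x a) z)) \<and>
     (\<forall>g w. g \<in> supported \<longrightarrow> (\<forall>x a. tform (gen x (e a)) g = F (ip (act x a) w)) \<longrightarrow> tform f g = F (ip z w))"

lemma realizesI:
  assumes "f \<in> supported" "\<And>x a. tform (gen x (e a)) f = F (ip (act x a) z)"
    and "\<And>g w. g \<in> supported \<Longrightarrow> (\<And>x a. tform (gen x (e a)) g = F (ip (act x a) w)) \<Longrightarrow> tform f g = F (ip z w)"
  shows "realizes f z"
  using assms by (simp add: realizes_def)

lemma
  assumes "realizes f z"
  shows realizes_supported: "f \<in> supported"
    and realizes_gen_left: "tform (gen x (e a)) f = F (ip (act x a) z)"
    and realizes_left: "g \<in> supported \<Longrightarrow> (\<And>x a. tform (gen x (e a)) g = F (ip (act x a) w)) \<Longrightarrow> tform f g = F (ip z w)"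
  using assms by (simp_all add: realizes_def)

text \<open>The last clause of \<open>realizes\<close> is applied to \<open>f\<close> itself, so the
  isometry needs induction on one argument only. \<open>realizes\<close> is a relation, as
  \<open>f\<close> need not determine \<open>z\<close>.\<close>

lemma realizes_inner: "realizes f z \<Longrightarrow> tform f f = F (ip z z)"
  by (rule realizes_left) (auto intro: realizes_supported realizes_gen_left)

lemma realizes_gen: "realizes (gen x (e a)) (act x a)"
  by (rule realizesI) (simp_all add: tensor_form_gen_left tensor_row_gen e_inner e_rep ip_simps mult.assoc)

lemma realizes_add:
  assumes f: "realizes f z" and f': "realizes f' z'"
  shows "realizes (f + f') (z + z')"
proof (rule realizesI)
  note s = realizes_supported[OF f] realizes_supported[OF f']
  show "f + f' \<in> supported" using s by simp
  show "tform (gen x (e a)) (f + f') = F (ip (act x a) (z + z'))" for x a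
    by (simp add: tensor_form_add_right realizes_gen_left[OF f] realizes_gen_left[OF f'] ip_add_right F_add)
  fix g w assume g: "g \<in> supported" "\<And>x a. tform (gen x (e a)) g = F (ip (act x a) w)"
  show "tform (f + f') g = F (ip (z + z') w)"
    using s g(1) realizes_left[OF f g] realizes_left[OF f' g] by (simp add: tform_add_left ip_add_left F_add)
qed

lemma realizes_fscale:
  assumes f: "realizes f z"
  shows "realizes (fscale c f) (scaleC c z)"
proof (rule realizesI)
  show "fscale c f \<in> supported" using realizes_supported[OF f] by simp
  show "tform (gen x (e a)) (fscale c f) = F (ip (act x a) (scaleC c z))" for x a
    by (simp add: tensor_form_fscale_right realizes_gen_left[OF f] ip_scaleC_right F_scaleC)
  fix g w assume g: "g \<in> supported" "\<And>x a. tform (gen x (e a)) g = F (ip (act x a) w)"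
  show "tform (fscale c f) g = F (ip (scaleC c z) w)"
    using realizes_supported[OF f] g(1) realizes_left[OF f g] by (simp add: tform_fscale_left ip_scaleC_left F_scaleC)
qed

lemma realizes_diff: "realizes f z \<Longrightarrow> realizes f' z' \<Longrightarrow> realizes (f - f') (z - z')"
  using realizes_add[OF _ realizes_fscale[of f' z' "- 1"], of f z] by (simp add: scaleC_minus_one)

text \<open>
  The closure of the span of the \<open>y \<otimes> e a\<close> with \<open>y \<in> Y\<close> is a closed subspace. It contains all
  \<open>y \<otimes> h\<close>, but not \<open>x \<otimes> e m\<close>.
\<close>

lemma tensor_not_generated:
  assumes Y: "complex_vector.subspace Y" "\<And>y a. y \<in> Y \<Longrightarrow> act y a \<in> Y"
    and d: "0 < d" "\<And>y. y \<in> Y \<Longrightarrow> d\<^sup>2 \<le> Re (F (ip (act x m - y) (act x m - y)))"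
    and S: "S \<subseteq> {const_coset (gen y h) | y h. y \<in> Y \<and> h \<in> hcarrier H}"
  shows "const_coset (gen x (e m)) \<notin> closed_subspace_generated IT S"
proof
  assume gen: "const_coset (gen x (e m)) \<in> closed_subspace_generated IT S"
  \<comment> \<open>The approximants use only the vectors \<open>e a\<close>, for which
    \<open>realizes\<close> is available.\<close>
  define D where "D = free_space.span {gen y (e a) | y a. y \<in> Y}"
  have D_realizes: "\<exists>z\<in>Y. realizes f z" if "f \<in> D" for f
    using that unfolding D_def
  proof (induction rule: free_space.span_induct_alt)
    case base
    have "realizes 0 (0::'x)" using realizes_fscale[OF realizes_gen, of 0] by simp
    then show ?case using Y(1) complex_vector.subspace_0 by blast
  next
    case (step c g f)
    then obtain y a z where "y \<in> Y" "g = gen y (e a)" "z \<in> Y" "realizes f z" by blast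
    then have "realizes (fscale c g + f) (scaleC c (act y a) + z)"
      by (simp add: realizes_add realizes_fscale realizes_gen)
    moreover have "scaleC c (act y a) + z \<in> Y"
      using Y \<open>y \<in> Y\<close> \<open>z \<in> Y\<close> by (simp add: complex_vector.subspace_add complex_vector.subspace_scale)
    ultimately show ?case by blast
  qed
  have D_supported: "f \<in> supported" if "f \<in> D" for f
    using D_realizes[OF that] by (auto simp: realizes_def)
  have D_add: "f + g \<in> D" if "f \<in> D" "g \<in> D" for f g
    using that unfolding D_def by (rule free_space.span_add)
  have D_fscale: "fscale c f \<in> D" if "f \<in> D" for c f
    using that unfolding D_def by (rule free_space.span_scale)
  have D0: "0 \<in> D" unfolding D_def by (rule free_space.span_zero)
  define M where "M = {P \<in> hcarrier IT. \<forall>\<epsilon>>0. \<exists>f\<in>D. hdist IT P (const_coset f) < \<epsilon>}"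
  have "closed_subspace IT M"
    unfolding closed_subspace_def
  proof (intro conjI allI ballI impI)
    show "M \<subseteq> hcarrier IT" by (auto simp: M_def)
    show "hzero IT \<in> M" unfolding M_def using D0 const_coset_zero by (auto intro!: bexI[of _ 0])
  next
    fix P Q assume PQ: "P \<in> M" "Q \<in> M"
    have "\<exists>f\<in>D. hdist IT (hplus IT P Q) (const_coset f) < \<epsilon>" if \<epsilon>: "0 < \<epsilon>" for \<epsilon>
    proof -
      have "0 < \<epsilon> / 2" using \<epsilon> by simp
      then obtain f g where fg: "f \<in> D" "g \<in> D" "hdist IT P (const_coset f) < \<epsilon> / 2" "hdist IT Q (const_coset g) < \<epsilon> / 2"
        using PQ unfolding M_def by blast
      have "hdist IT (hplus IT P Q) (const_coset (f + g)) \<le> hdist IT P (const_coset f) + hdist IT Q (const_coset g)"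
        using PQ D_supported fg by (simp add: const_coset_add M_def IT.hdist_plus)
      then show ?thesis using fg D_add by (intro bexI[of _ "f + g"]) auto
    qed
    then show "hplus IT P Q \<in> M" using PQ by (simp add: M_def)
  next
    fix c P assume P: "P \<in> M"
    have "\<exists>f\<in>D. hdist IT (hscale IT c P) (const_coset f) < \<epsilon>" if \<epsilon>: "0 < \<epsilon>" for \<epsilon>
    proof -
      \<comment> \<open>The added 1 avoids a division by zero for \<open>c = 0\<close>.\<close>
      define r where "r = \<epsilon> / (cmod c + 1)"
      have c1: "0 < cmod c + 1" by (simp add: add_nonneg_pos)
      then have r: "0 < r" "(cmod c + 1) * r = \<epsilon>" using \<epsilon> by (auto simp: r_def)
      then obtain f where f: "f \<in> D" "hdist IT P (const_coset f) < r"
        using P unfolding M_def by blast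
      have "hdist IT (hscale IT c P) (const_coset (fscale c f)) = cmod c * hdist IT P (const_coset f)"
        using P D_supported f by (simp add: const_coset_fscale M_def IT.hdist_scale)
      also have "\<dots> \<le> cmod c * r" using f by (intro mult_left_mono) auto
      also have "\<dots> < \<epsilon>" using r by (simp add: distrib_right)
      finally show ?thesis using f D_fscale by blast
    qed
    then show "hscale IT c P \<in> M" using P by (simp add: M_def)
  next
    fix s P assume sP: "(\<forall>n. s n \<in> M) \<and> P \<in> hcarrier IT \<and> hconverges IT s P"
    have "\<exists>f\<in>D. hdist IT P (const_coset f) < \<epsilon>" if \<epsilon>: "0 < \<epsilon>" for \<epsilon>
    proof -
      have \<epsilon>2: "0 < \<epsilon> / 2" using \<epsilon> by simp
      have "(\<lambda>n. hdist IT (s n) P) \<longlonglongrightarrow> 0" using sP by (simp add: hconverges_def)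
      then obtain n where n: "norm (hdist IT (s n) P - 0) < \<epsilon> / 2"
        using LIMSEQ_D[OF _ \<epsilon>2] by blast
      have sn: "s n \<in> hcarrier IT" "s n \<in> M" using sP by (auto simp: M_def)
      then obtain f where f: "f \<in> D" "hdist IT (s n) (const_coset f) < \<epsilon> / 2"
        using \<epsilon>2 unfolding M_def by blast
      have "hdist IT P (const_coset f) \<le> hdist IT P (s n) + hdist IT (s n) (const_coset f)"
        using sP sn D_supported[OF f(1)] by (intro IT.hdist_triangle) auto
      moreover have "hdist IT P (s n) = hdist IT (s n) P" using sP sn by (intro IT.hdist_commute) auto
      ultimately show ?thesis using n f by (intro bexI[of _ f]) auto
    qed
    then show "P \<in> M" using sP by (simp add: M_def)
  qed
  moreover have "const_coset (gen y h) \<in> M" if yh: "y \<in> Y" "h \<in> hcarrier H" for y h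
  proof -
    have "\<exists>f\<in>D. hdist IT (const_coset (gen y h)) (const_coset f) < \<epsilon>" if \<epsilon>: "0 < \<epsilon>" for \<epsilon>
    proof -
      define r where "r = \<epsilon> / (norm y + 1)"
      have c1: "0 < norm y + 1" by (simp add: add_nonneg_pos)
      then have r: "0 < r" "(norm y + 1) * r = \<epsilon>" using \<epsilon> by (auto simp: r_def)
      obtain a where a: "hdist H h (e a) < r" using e_dense[OF yh(2) r(1)] by blast
      have "hdist IT (const_coset (gen y h)) (const_coset (gen y (e a))) \<le> norm y * hdist H h (e a)"
        using yh by (simp add: BT.completion_dist_const hdist_gen_right)
      also have "\<dots> \<le> norm y * r" using a by (intro mult_left_mono) auto
      also have "\<dots> < \<epsilon>" using r by (simp add: distrib_right)
      finally have "hdist IT (const_coset (gen y h)) (const_coset (gen y (e a))) < \<epsilon>" .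
      moreover have "gen y (e a) \<in> D" unfolding D_def using yh(1) by (intro free_space.span_base) blast
      ultimately show ?thesis by blast
    qed
    then show ?thesis using yh by (simp add: M_def)
  qed
  then have "S \<subseteq> M" using S by blast
  ultimately have "const_coset (gen x (e m)) \<in> M"
    using gen by (auto simp: closed_subspace_generated_def)
  then obtain f where f: "f \<in> D" "hdist IT (const_coset (gen x (e m))) (const_coset f) < d"
    using d(1) by (auto simp: M_def)
  \<comment> \<open>\<open>f\<close> is realized by a point \<open>z\<close> of \<open>Y\<close>, so
    its distance to \<open>x \<otimes> e m\<close> is that of \<open>z\<close> to
    \<open>act x m\<close>, measured by \<open>F\<close>.\<close>
  obtain z where z: "z \<in> Y" "realizes f z" using D_realizes[OF f(1)] by blast
  have "hdist IT (const_coset (gen x (e m))) (const_coset f)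
      = sqrt (Re (tform (gen x (e m) - f) (gen x (e m) - f)))"
    using D_supported[OF f(1)] by (simp add: BT.completion_dist_const BT_dist)
  also have "\<dots> = sqrt (Re (F (ip (act x m - z) (act x m - z))))"
    by (simp only: realizes_inner[OF realizes_diff[OF realizes_gen z(2)]])
  finally have "(hdist IT (const_coset (gen x (e m))) (const_coset f))\<^sup>2 = Re (F (ip (act x m - z) (act x m - z)))"
    using order_trans[OF zero_le_power2 d(2)[OF z(1)]] by simp
  then have "d\<^sup>2 \<le> (hdist IT (const_coset (gen x (e m))) (const_coset f))\<^sup>2"
    using d(2)[OF z(1)] by simp
  then have "d \<le> hdist IT (const_coset (gen x (e m))) (const_coset f)"
    by (rule power2_le_imp_le) (use D_supported[OF f(1)] in \<open>simp add: IT.hdist_nonneg\<close>)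
  then show False using f(2) by simp
qed

lemma not_sigma_nondegenerate:
  assumes "complex_vector.subspace Y" "\<And>y a. y \<in> Y \<Longrightarrow> act y a \<in> Y"
    and "0 < d" "\<And>y. y \<in> Y \<Longrightarrow> d\<^sup>2 \<le> Re (F (ip (act x m - y) (act x m - y)))"
    and \<phi>: "\<And>b x. \<phi> b x \<in> Y"
  shows "\<not> acts_sigma_nondegenerately ip act \<phi> H \<sigma>"
proof -
  define S where "S = {const_coset (gen (\<phi> b x) h) | b x h. h \<in> hcarrier H}"
  have S: "S \<subseteq> {const_coset (gen y h) | y h. y \<in> Y \<and> h \<in> hcarrier H}"
    unfolding S_def using \<phi> by blast
  have "const_coset (gen x (e m)) \<notin> closed_subspace_generated IT S"
    using assms(1-4) S by (rule tensor_not_generated)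
  moreover have "const_coset (gen x (e m)) \<in> hcarrier IT"
    by (intro BT.cc_closed BT.hcauchy_const coset_closed supported_gen e_closed)
  ultimately have "closed_subspace_generated IT S \<noteq> hcarrier IT" by metis
  then show ?thesis
    unfolding acts_sigma_nondegenerately_def interior_tensor_def elementary_tensor_def S_def .
qed

end

text \<open>\<open>adjointable_maps\<close> consists of arbitrary functions with an adjoint; module
  linearity follows by testing against all \<open>v\<close>. It makes the span of \<open>BX\<close>
  a submodule.\<close>

lemma (in hilbert_module) adjointable_act:
  assumes "s \<in> adjointable_maps ip"
  shows "s (act x a) = act (s x) a"
proof -
  obtain t where t: "\<And>x y. ip (s x) y = ip x (t y)"
    using assms by (auto simp: adjointable_maps_def is_adjoint_def)
  define u where "u = s (act x a) - act (s x) a"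
  have "ip u v = 0" for v by (simp add: u_def ip_simps t)
  then show ?thesis using ip_definite[of u] by (simp add: u_def)
qed

lemma (in hilbert_module) sigma_nondegenerate_imp:
  fixes \<phi> :: "'b::cstar_algebra \<Rightarrow> 'x \<Rightarrow> 'x"
  assumes \<phi>: "star_hom_into_adjointable ip \<phi>"
    and all: "\<And>(H :: ('a \<Rightarrow> complex) ip_space) \<sigma>. hilbert_space H \<Longrightarrow> cstar_representation H \<sigma>
      \<Longrightarrow> acts_sigma_nondegenerately ip act \<phi> H \<sigma>"
  shows "acts_nondegenerately \<phi>"
proof (rule ccontr)
  define Y where "Y = complex_vector.span {\<phi> b x | b x. True}"
  assume "\<not> acts_nondegenerately \<phi>"
  then obtain x where x: "x \<notin> closure Y" by (auto simp: acts_nondegenerately_def Y_def)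
  have Y: "complex_vector.subspace Y" unfolding Y_def by (rule complex_vector.subspace_span)
  have act_Y: "act y a \<in> Y" if "y \<in> Y" for y a
    using that unfolding Y_def
  proof (induction rule: complex_vector.span_induct_alt)
    case base
    have "act 0 a = 0" using act_scaleC_left[of 0 0 a] by simp
    then show ?case by (simp add: complex_vector.span_zero)
  next
    case (step c u y)
    then obtain b z where u: "u = \<phi> b z" by blast
    have "\<phi> b (act z a) = act (\<phi> b z) a"
      using \<phi> by (intro adjointable_act) (simp add: star_hom_into_adjointable_def)
    then have "act u a = \<phi> b (act z a)" by (simp add: u)
    then have "act u a \<in> {\<phi> b x | b x. True}" by blast
    then have "act u a \<in> complex_vector.span {\<phi> b x | b x. True}"
      by (rule complex_vector.span_base)
    then show ?case
      using step by (simp add: act_add_left act_scaleC_left complex_vector.span_add complex_vector.span_scale)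
  qed
  \<comment> \<open>If all \<open>act x m\<close> lay in the closure of \<open>Y\<close>, so would
    \<open>x\<close>, by \<open>act_approximates\<close>.\<close>
  obtain m where m: "act x m \<notin> closure Y"
  proof (rule ccontr)
    assume "\<not> thesis"
    then have "act x m \<in> closure Y" for m using that by blast
    then have "\<exists>y\<in>closure Y. dist y x < \<epsilon>" if "0 < \<epsilon>" for \<epsilon>
      using act_approximates[OF that, of x] by (metis dist_norm norm_minus_commute)
    then have "x \<in> closure (closure Y)" unfolding closure_approachable[of x "closure Y"] by blast
    then show False using x by simp
  qed
  then obtain d where d: "0 < d" "\<And>y. y \<in> Y \<Longrightarrow> d \<le> dist y (act x m)"
    unfolding closure_approachable by (metis not_less)
  then have d': "d \<le> norm (act x m - y)" if "y \<in> Y" for y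
    using that by (simp add: dist_norm norm_minus_commute)
  obtain f where f: "linear f" "\<And>b. 0 \<le> f (star b * b)"
      "\<And>y. y \<in> Y \<Longrightarrow> d\<^sup>2 \<le> f (ip (act x m - y) (act x m - y))"
    using separating_functional[OF Y d(1) d'] by blast
  define F where "F = complexify f"
  have positive: "positive_functional F"
    unfolding F_def using f(1,2) by (rule positive_functional_complexify)
  have F: "d\<^sup>2 \<le> Re (F (ip (act x m - y) (act x m - y)))" if "y \<in> Y" for y
    using f(3)[OF that] by (simp add: F_def complexify_selfadjoint ip_star)
  obtain H :: "('a \<Rightarrow> complex) ip_space" and \<sigma> e
    where H: "hilbert_space H" "cstar_representation H \<sigma>" "\<And>a. e a \<in> hcarrier H"
      "\<And>a b. hinner H (e a) (e b) = F (star a * b)" "\<And>c a. \<sigma> c (e a) = e (c * a)"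
      "\<And>h \<epsilon>. h \<in> hcarrier H \<Longrightarrow> 0 < \<epsilon> \<Longrightarrow> \<exists>a. hdist H h (e a) < \<epsilon>"
    by (rule positive_functional.gns[OF positive]) (rule that; assumption)
  have "gns_module ip act H \<sigma> F e"
  proof (intro gns_module.intro gns_module_axioms.intro represented_module.intro represented_module_axioms.intro)
    show "pre_hilbert H" using H(1) by (rule hilbert_space.pre_hilbert)
    show "hilbert_module ip act" by (rule hilbert_module_axioms)
  qed (fact positive H)+
  then have "\<not> acts_sigma_nondegenerately ip act \<phi> H \<sigma>"
    using Y act_Y d(1) F by (rule gns_module.not_sigma_nondegenerate) (auto simp: Y_def intro: complex_vector.span_base)
  then show False using all[OF H(1,2)] by blast
qed

lemma nondegenerate_imp_sigma:
  assumes "hilbert_module ip act" "acts_nondegenerately \<phi>" "hilbert_space H" "cstar_representation H \<sigma>"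
  shows "acts_sigma_nondegenerately ip act \<phi> H \<sigma>"
proof -
  interpret represented_module ip act H \<sigma>
    using assms(1) hilbert_space.pre_hilbert[OF assms(3)] assms(4)
    by (intro represented_module.intro represented_module_axioms.intro)
  show ?thesis using assms(2) by (rule acts_nondegenerately_imp_sigma)
qed

text \<open>Carrier types cannot be quantified over inside a formula. The equivalence uses
  \<open>'a \<Rightarrow> complex\<close>, which holds the GNS space; the second conjunct gives the
  forward implication for any carrier type.\<close>

theorem theorem2p4:
  fixes ip :: "'x::complex_banach \<Rightarrow> 'x \<Rightarrow> 'a::cstar_algebra"
    and act :: "'x \<Rightarrow> 'a \<Rightarrow> 'x"
    and \<phi> :: "'b::cstar_algebra \<Rightarrow> 'x \<Rightarrow> 'x"
  assumes "hilbert_module ip act"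
    and "star_hom_into_adjointable ip \<phi>"
  shows "(acts_nondegenerately \<phi> \<longleftrightarrow>
           (\<forall>(H :: ('a \<Rightarrow> complex) ip_space) \<sigma>. hilbert_space H \<and> cstar_representation H \<sigma>
              \<longrightarrow> acts_sigma_nondegenerately ip act \<phi> H \<sigma>)) \<and>
         (acts_nondegenerately \<phi> \<longrightarrow>
           (\<forall>(H :: 'h ip_space) \<sigma>. hilbert_space H \<and> cstar_representation H \<sigma>
              \<longrightarrow> acts_sigma_nondegenerately ip act \<phi> H \<sigma>))"
  by (intro conjI iffI allI impI)
    (auto intro: nondegenerate_imp_sigma[OF assms(1)] hilbert_module.sigma_nondegenerate_imp[OF assms])

end
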